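(* Let $0<\lambda<4$ and let $I$ be a compact interval contained in $(0,a_\lambda)$, where $a_\lambda=\operatorname{arcosh}(1+\lambda/2)$. There are $B_I,C_I>0$ and $h_I>0$ such that, for all $a\in I$, $0<h\le h_I$, $\rho\ge B_I$, and every finitely supported $v:\Lambda_h\to\mathbb C$ with $\operatorname{supp}v\subset\Omega_\rho$, $$h\rho^{-1}\|v\|_2^2\le C_I\|\mathcal A_{a,h}v\|_2^2 .$$ There are also $B,C>0$ and $h_0>0$ such that, for all $0<h\le h_0$, $\rho\ge B$, and every finitely supported $v:\Lambda_h\to\mathbb C$ with $\operatorname{supp}v\subset\Omega_\rho$, $$h\rho^{-2}\|v\|_2^2\le C\|\mathcal A_{0,h}v\|_2^2 .$$
   Context: For $h>0$: $\Lambda_h=h\mathbb Z^2$, and $\|\cdot\|_2$ is the norm of $\ell^2(\Lambda_h)$. For $x\in\mathbb R^2$, $R_h(x)=\sqrt{h^2+|x|^2}$, and for $\rho>0$, $\Omega_\rho=\{x\in\mathbb R^2:\rho/2\le R_h(x)\le4\rho\}$ (depending on $h$). For $a\ge0$, $\phi_{a,h}(x)=aR_h(x)+\log R_h(x)$. For $g\in\mathbb Z^2$, $(T_gv)(x)=v(x+hg)$ on functions on $\Lambda_h$, and $P_\lambda=\sum_{|e|_1=1}T_e-\lambda$, the sum being over $e\in\{\pm e_1,\pm e_2\}$. The conjugated operator is $\mathcal A_{a,h}=e^{\phi_{a,h}/h}P_\lambda e^{-\phi_{a,h}/h}$; explicitly $$(\mathcal A_{a,h}v)(x)=\sum_{|e|_1=1}e^{-d_e(x)}v(x+he)-\lambda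 v(x),\qquad d_e(x)=\frac{\phi_{a,h}(x+he)-\phi_{a,h}(x)}{h}.$$ Constants may depend on $\lambda$; those with subscript $I$ may also depend on $I$. *)

theory Defs
  imports "HOL-Analysis.Analysis"
begin

definition pt :: "real \<Rightarrow> int \<times> int \<Rightarrow> real \<times> real" where
  "pt h g = h *\<^sub>R (real_of_int (fst g), real_of_int (snd g))"

definition lattice_pts :: "real \<Rightarrow> (real \<times> real) set" where
  "lattice_pts h = range (pt h)"

text \<open>A function on the lattice is represented by a function on the plane; all notions below
  (support, norm, operators on lattice points) only see its values on \<^term>\<open>lattice_pts h\<close>.\<close>

definition supp :: "real \<Rightarrow> (real \<times> real \<Rightarrow> complex) \<Rightarrow> (real \<times> real) set" where
  "supp h v = {x \<in> lattice_pts h. v x \<noteq> 0}"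

text \<open>Norm of \<open>\<ell>\<^sup>2\<close> with respect to counting measure.\<close>

definition l2norm :: "real \<Rightarrow> (real \<times> real \<Rightarrow> complex) \<Rightarrow> real" where
  "l2norm h v = sqrt (\<Sum>\<^sub>\<infinity>x\<in>lattice_pts h. (cmod (v x))\<^sup>2)"

definition R :: "real \<Rightarrow> real \<times> real \<Rightarrow> real" where
  "R h x = sqrt (h\<^sup>2 + (norm x)\<^sup>2)"

definition Omega :: "real \<Rightarrow> real \<Rightarrow> (real \<times> real) set" where
  "Omega h \<rho> = {x. \<rho> / 2 \<le> R h x \<and> R h x \<le> 4 * \<rho>}"

definition phi :: "real \<Rightarrow> real \<Rightarrow> real \<times> real \<Rightarrow> real" where
  "phi a h x = a * R h x + ln (R h x)"

definition unit_steps :: "(int \<times> int) set" where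
  "unit_steps = {(1, 0), (-1, 0), (0, 1), (0, -1)}"

definition T :: "real \<Rightarrow> int \<times> int \<Rightarrow> (real \<times> real \<Rightarrow> complex) \<Rightarrow> real \<times> real \<Rightarrow> complex" where
  "T h g v x = v (x + pt h g)"

definition P :: "real \<Rightarrow> real \<Rightarrow> (real \<times> real \<Rightarrow> complex) \<Rightarrow> real \<times> real \<Rightarrow> complex" where
  "P lam h v x = (\<Sum>e\<in>unit_steps. T h e v x) - of_real lam * v x"

definition conj_op ::
    "real \<Rightarrow> real \<Rightarrow> real \<Rightarrow> (real \<times> real \<Rightarrow> complex) \<Rightarrow> real \<times> real \<Rightarrow> complex" where
  "conj_op lam a h v x =
     of_real (exp (phi a h x / h)) * P lam h (\<lambda>y. of_real (exp (- phi a h y / h)) * v y) x"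

lemma conj_op_explicit:
  "conj_op lam a h v x =
     (\<Sum>e\<in>unit_steps. of_real (exp (- ((phi a h (x + pt h e) - phi a h x) / h))) * v (x + pt h e))
       - of_real lam * v x"
proof -
  have 1: "complex_of_real (exp (phi a h x / h)) * (of_real (exp (- phi a h y / h)) * w)
      = of_real (exp (- ((phi a h y - phi a h x) / h))) * w" for y w
    by (simp add: mult.assoc[symmetric] of_real_mult[symmetric] exp_add[symmetric]
        diff_divide_distrib del: of_real_mult)
  have 2: "complex_of_real (exp (phi a h x / h)) *
      (of_real lam * (of_real (exp (- phi a h x / h)) * v x)) = of_real lam * v x"
    using 1[of x "v x"] by (simp add: mult.left_commute)
  show ?thesis
    unfolding conj_op_def P_def T_def right_diff_distrib sum_distrib_left 1 2 ..
qed

end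

theory Submission
  imports Defs
begin

text \<open>The conjugated operator is \<open>X + Y\<close> with \<open>X\<close> symmetric and \<open>Y\<close> skew, so its squared norm on \<open>v\<close> is
  \<open>\<parallel>X v\<parallel>\<^sup>2 + \<parallel>Y v\<parallel>\<^sup>2\<close> plus a commutator form. Because the kernel \<open>sinh (f (x + e + e') - f x)\<close>
  contributes nothing by antisymmetry, that form has the small kernel
  \<open>sinh (f (x + e + e') - f x) - sinh (d\<^sub>e + d\<^sub>e\<^sub>')\<close>, where \<open>f = \<phi> / h\<close>, and a Taylor expansion turns it into
  \<open>4 h\<close> times the Hessian of \<open>\<phi>\<close> applied to the vectors \<open>(C\<^sub>j s\<^sub>j v)\<close> and \<open>(S\<^sub>j c\<^sub>j v)\<close>; here \<open>c\<^sub>j, s\<^sub>j\<close> are the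
  symmetric average and difference in direction \<open>j\<close> and \<open>C\<^sub>j, S\<^sub>j\<close> are \<open>cosh, sinh\<close> of the partial derivatives
  of \<open>\<phi>\<close>. The Hessian is at least a positive multiple of \<open>\<kappa> / \<rho>\<close>, \<open>\<kappa> = a + 1 / \<rho>\<close>, in the tangential
  direction and at least \<open>- 1 / R\<^sup>2\<close> in the normal one.

  It remains to see that \<open>v\<close> is controlled by \<open>X v\<close>, \<open>Y v / \<kappa>\<close> and the two tangential components. The tangential
  part of \<open>(C\<^sub>j s\<^sub>j v)\<close> and \<open>Y v / \<kappa>\<close> determine \<open>s\<^sub>1 v, s\<^sub>2 v\<close>, so these are small and \<open>c\<^sub>j\<^sup>2 v\<close> is close to \<open>v\<close>.
  All coefficients vary by \<open>O(h / \<rho>)\<close> per step, hence nearly commute with the \<open>c\<^sub>j\<close>, and eliminating \<open>c\<^sub>1, c\<^sub>2\<close>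
  from \<open>C\<^sub>1 c\<^sub>1 v + C\<^sub>2 c\<^sub>2 v \<approx> \<lambda> v / 2\<close> and \<open>n\<^sub>1 S\<^sub>2 c\<^sub>2 v \<approx> n\<^sub>2 S\<^sub>1 c\<^sub>1 v\<close> leaves two functions that annihilate
  \<open>v\<close> approximately. They have a common zero only if \<open>|\<nabla>\<phi>| \<ge> a\<^sub>\<lambda>\<close>, so compactness bounds \<open>v\<close>.\<close>

section \<open>Norms of finitely supported functions\<close>

definition fsupp :: "('a \<Rightarrow> 'b::zero) \<Rightarrow> bool" where
  "fsupp u \<longleftrightarrow> finite {x. u x \<noteq> 0}"

text \<open>The sum runs over the whole type, so translations are isometries without bookkeeping. A
  sum that does not converge has the default value 0, hence the \<open>fsupp\<close> hypotheses of
  the norm inequalities.\<close>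

definition l2 :: "('a \<Rightarrow> complex) \<Rightarrow> real" where
  "l2 u = sqrt (\<Sum>\<^sub>\<infinity>x. (cmod (u x))\<^sup>2)"

lemma fsupp_mono: "fsupp w \<Longrightarrow> (\<And>x. w x = 0 \<Longrightarrow> u x = 0) \<Longrightarrow> fsupp u"
  unfolding fsupp_def by (rule finite_subset) auto

lemma fsupp_add: "fsupp u \<Longrightarrow> fsupp w \<Longrightarrow> fsupp (\<lambda>x. u x + (w x :: 'b::monoid_add))"
  unfolding fsupp_def by (rule finite_subset[of _ "{x. u x \<noteq> 0} \<union> {x. w x \<noteq> 0}"]) auto

lemma fsupp_diff: "fsupp u \<Longrightarrow> fsupp w \<Longrightarrow> fsupp (\<lambda>x. u x - (w x :: 'b::group_add))"
  unfolding fsupp_def by (rule finite_subset[of _ "{x. u x \<noteq> 0} \<union> {x. w x \<noteq> 0}"]) auto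

lemma fsupp_mult: "fsupp u \<Longrightarrow> fsupp (\<lambda>x. m x * (u x :: 'b::mult_zero))"
  by (erule fsupp_mono) simp

lemma fsupp_divide: "fsupp u \<Longrightarrow> fsupp (\<lambda>x. (u x :: 'b::division_ring) / m x)"
  by (erule fsupp_mono) simp

lemma fsupp_uminus: "fsupp u \<Longrightarrow> fsupp (\<lambda>x. - (u x :: 'b::group_add))"
  by (erule fsupp_mono) simp

lemma fsupp_sum: "(\<And>i. i \<in> I \<Longrightarrow> fsupp (u i)) \<Longrightarrow> fsupp (\<lambda>x. \<Sum>i\<in>I. (u i x :: 'b::comm_monoid_add))"
proof (induction I rule: infinite_finite_induct)
  case (insert i I)
  then show ?case by (simp add: fsupp_add)
qed (simp_all add: fsupp_def)

lemma fsupp_shift: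
  fixes u :: "'a::group_add \<Rightarrow> 'b::zero"
  assumes "fsupp u" shows "fsupp (\<lambda>x. u (x + g))"
proof -
  have "{x. u (x + g) \<noteq> 0} \<subseteq> (\<lambda>y. y - g) ` {x. u x \<noteq> 0}"
    by (auto simp: image_iff intro!: exI[of _ "_ + g"])
  then show ?thesis using assms finite_subset unfolding fsupp_def by blast
qed

lemma fsupp_shift_diff:
  fixes u :: "'a::group_add \<Rightarrow> 'b::zero"
  assumes "fsupp u" shows "fsupp (\<lambda>x. u (x - g))"
  using fsupp_shift[OF assms, of "- g"] by simp

lemmas fsupp_intros = fsupp_add fsupp_diff fsupp_mult fsupp_divide fsupp_uminus fsupp_sum
  fsupp_shift fsupp_shift_diff

lemma fsupp_summable:
  fixes u :: "'a \<Rightarrow> real"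
  shows "fsupp u \<Longrightarrow> u summable_on UNIV"
  unfolding fsupp_def by (rule finite_nonzero_values_imp_summable_on) simp

lemma fsupp_cmod: "fsupp u \<Longrightarrow> fsupp (\<lambda>x. (cmod (u x))\<^sup>2)"
  by (erule fsupp_mono) simp

lemma infsum_shift:
  fixes f :: "'a::group_add \<Rightarrow> real"
  shows "(\<Sum>\<^sub>\<infinity>x. f (x + g)) = (\<Sum>\<^sub>\<infinity>x. f x)"
  by (rule infsum_reindex_bij_betw[of "\<lambda>x. x + g"]) (rule bij_betw_byWitness[of _ "\<lambda>x. x - g"], auto)

lemma l2_nonneg: "0 \<le> l2 u"
  unfolding l2_def by (simp add: infsum_nonneg)

lemma l2_sq: "(l2 u)\<^sup>2 = (\<Sum>\<^sub>\<infinity>x. (cmod (u x))\<^sup>2)"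
  unfolding l2_def by (simp add: infsum_nonneg)

lemma l2_shift: "l2 (\<lambda>x. u (x + g)) = l2 (u :: 'a::group_add \<Rightarrow> complex)"
  unfolding l2_def by (simp only: infsum_shift[of "\<lambda>x. (cmod (u x))\<^sup>2"])

lemma l2_shift_diff: "l2 (\<lambda>x. u (x - g)) = l2 (u :: 'a::group_add \<Rightarrow> complex)"
  using l2_shift[of u "- g"] by simp

lemma l2_eq_L2_set:
  assumes "finite A" and "\<And>x. u x \<noteq> 0 \<Longrightarrow> x \<in> A"
  shows "l2 u = L2_set (\<lambda>x. cmod (u x)) A"
proof -
  have "(\<Sum>\<^sub>\<infinity>x. (cmod (u x))\<^sup>2) = (\<Sum>\<^sub>\<infinity>x\<in>A. (cmod (u x))\<^sup>2)"
    by (rule infsum_cong_neutral) (use assms in auto)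
  then show ?thesis using assms by (simp add: l2_def L2_set_def)
qed

lemma l2_add_le:
  assumes "fsupp u" "fsupp w"
  shows "l2 (\<lambda>x. u x + w x) \<le> l2 u + l2 w"
proof -
  define A where "A = {x. u x \<noteq> 0} \<union> {x. w x \<noteq> 0}"
  have "finite A" using assms by (simp add: A_def fsupp_def)
  then have *: "l2 z = L2_set (\<lambda>x. cmod (z x)) A" if "\<And>x. x \<notin> A \<Longrightarrow> z x = 0" for z
    using that by (intro l2_eq_L2_set) auto
  have u: "l2 u = L2_set (\<lambda>x. cmod (u x)) A" and w: "l2 w = L2_set (\<lambda>x. cmod (w x)) A"
    and uw: "l2 (\<lambda>x. u x + w x) = L2_set (\<lambda>x. cmod (u x + w x)) A"
    by (rule *; simp add: A_def)+
  have "l2 (\<lambda>x. u x + w x) \<le> L2_set (\<lambda>x. cmod (u x) + cmod (w x)) A"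
    unfolding uw by (intro L2_set_mono norm_triangle_ineq) auto
  also have "\<dots> \<le> l2 u + l2 w"
    unfolding u w by (rule L2_set_triangle_ineq)
  finally show ?thesis .
qed

lemma l2_mono:
  assumes "fsupp w" and "\<And>x. cmod (u x) \<le> cmod (w x)"
  shows "l2 u \<le> l2 w"
proof -
  have "u x = 0" if "w x = 0" for x
    using assms(2)[of x] that by simp
  with assms(1) have "fsupp u" by (rule fsupp_mono)
  then have "(\<Sum>\<^sub>\<infinity>x. (cmod (u x))\<^sup>2) \<le> (\<Sum>\<^sub>\<infinity>x. (cmod (w x))\<^sup>2)"
    by (intro infsum_mono fsupp_summable[OF fsupp_cmod] assms(1)) (simp_all add: assms(2))
  then show ?thesis unfolding l2_def by (rule real_sqrt_le_mono)
qed

lemma l2_scale: "l2 (\<lambda>x. c * u x) = cmod c * l2 u"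
  unfolding l2_def norm_mult power_mult_distrib
  by (subst infsum_cmult_right') (simp add: real_sqrt_mult)

text \<open>Only moduli enter, so the triangle inequality is applied to the nonnegative functions
  \<open>K i * cmod (w i x)\<close>. This is how pointwise estimates become norm estimates.\<close>

lemma l2_dominated:
  assumes "finite I" and "\<And>i. i \<in> I \<Longrightarrow> fsupp (w i)" and "\<And>i. i \<in> I \<Longrightarrow> 0 \<le> K i"
    and "\<And>x. cmod (u x) \<le> (\<Sum>i\<in>I. K i * cmod (w i x))"
  shows "l2 u \<le> (\<Sum>i\<in>I. K i * l2 (w i))"
proof -
  have fs: "fsupp (\<lambda>x. complex_of_real (K i * cmod (w i x)))" if "i \<in> I" for i
    using assms(2)[OF that] by (rule fsupp_mono) simp
  then have *: "fsupp (\<lambda>x. \<Sum>i\<in>I. complex_of_real (K i * cmod (w i x)))"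
    by (rule fsupp_sum)
  have "l2 u \<le> l2 (\<lambda>x. \<Sum>i\<in>I. complex_of_real (K i * cmod (w i x)))"
    proof (rule l2_mono[OF *])
    fix x
    show "cmod (u x) \<le> cmod (\<Sum>i\<in>I. complex_of_real (K i * cmod (w i x)))"
      using assms(4)[of x] unfolding of_real_sum[symmetric] norm_of_real by linarith
  qed
  also have "\<dots> \<le> (\<Sum>i\<in>I. K i * l2 (w i))"
    using assms(1,3) fs
  proof (induction I)
    case empty
    then show ?case by (simp add: l2_def)
  next
    case (insert i I)
    have "l2 (\<lambda>x. \<Sum>i\<in>insert i I. complex_of_real (K i * cmod (w i x)))
        \<le> l2 (\<lambda>x. complex_of_real (K i * cmod (w i x))) + l2 (\<lambda>x. \<Sum>i\<in>I. complex_of_real (K i * cmod (w i x)))"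
      unfolding sum.insert[OF insert.hyps] by (intro l2_add_le fsupp_sum insert.prems) auto
    also have "l2 (\<lambda>x. complex_of_real (K i * cmod (w i x))) = K i * l2 (w i)"
      using insert.prems(1)[of i] l2_scale[of "of_real (K i)" "\<lambda>x. of_real (cmod (w i x))"]
      by (simp add: l2_def)
    also have "l2 (\<lambda>x. \<Sum>i\<in>I. complex_of_real (K i * cmod (w i x))) \<le> (\<Sum>i\<in>I. K i * l2 (w i))"
      by (rule insert.IH) (use insert.prems in auto)
    finally show ?case using insert.hyps by simp
  qed
  finally show ?thesis .
qed

lemma l2_bound:
  assumes "fsupp w" "0 \<le> K" "\<And>x. cmod (u x) \<le> K * cmod (w x)"
  shows "l2 u \<le> K * l2 w"
  using l2_dominated[of "{()}" "\<lambda>_. w" "\<lambda>_. K" u] assms by simp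

lemma l2_bound2:
  assumes "fsupp w" "fsupp w'" "0 \<le> K" "0 \<le> K'" "\<And>x. cmod (u x) \<le> K * cmod (w x) + K' * cmod (w' x)"
  shows "l2 u \<le> K * l2 w + K' * l2 w'"
  using l2_dominated[of "{True, False}" "\<lambda>b. if b then w else w'" "\<lambda>b. if b then K else K'" u] assms
  by simp

lemma l2_diff_le:
  assumes "fsupp u" "fsupp w"
  shows "l2 (\<lambda>x. u x - w x) \<le> l2 u + l2 w"
  using l2_bound2[OF assms, of 1 1 "\<lambda>x. u x - w x"] by (simp add: norm_triangle_ineq4)

section \<open>The energy identity\<close>

lemma infsum_shift_diff:
  fixes f :: "'a::group_add \<Rightarrow> real"
  shows "(\<Sum>\<^sub>\<infinity>x. f (x - g)) = (\<Sum>\<^sub>\<infinity>x. f x)"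
  using infsum_shift[of f "- g"] by simp

lemma infsum_sum_fsupp:
  fixes f :: "'i \<Rightarrow> 'a \<Rightarrow> real"
  assumes "\<And>i. i \<in> I \<Longrightarrow> fsupp (f i)"
  shows "(\<Sum>\<^sub>\<infinity>x. \<Sum>i\<in>I. f i x) = (\<Sum>i\<in>I. \<Sum>\<^sub>\<infinity>x. f i x)"
  using assms
proof (induction I rule: infinite_finite_induct)
  case (insert i I)
  then have "(\<Sum>\<^sub>\<infinity>x. f i x + (\<Sum>i\<in>I. f i x)) = (\<Sum>\<^sub>\<infinity>x. f i x) + (\<Sum>\<^sub>\<infinity>x. \<Sum>i\<in>I. f i x)"
    by (intro infsum_add fsupp_summable fsupp_sum) auto
  then show ?case using insert by simp
qed simp_all

lemma infsum_diff_fsupp: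
  fixes f g :: "'a \<Rightarrow> real"
  assumes "fsupp f" "fsupp g"
  shows "(\<Sum>\<^sub>\<infinity>x. f x - g x) = (\<Sum>\<^sub>\<infinity>x. f x) - (\<Sum>\<^sub>\<infinity>x. g x)"
  using infsum_add[OF fsupp_summable[OF fsupp_diff[OF assms]] fsupp_summable[OF assms(2)]] by simp

lemma sum_uminus_symmetric:
  fixes U :: "'a::group_add set"
  assumes "\<And>e. e \<in> U \<Longrightarrow> - e \<in> U"
  shows "(\<Sum>e\<in>U. F (- e)) = (\<Sum>e\<in>U. F e)"
  by (rule sum.reindex_bij_witness[of _ uminus uminus]) (use assms in auto)

text \<open>Comes from exp (-d) = cosh d - sinh d with \<open>d = f (x + e) - f x\<close>.
  Exchanging x and x + e changes the sign of d, so the cosh kernel is symmetric and the sinh kernel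
  skew.\<close>

definition sym_op :: "'a::plus set \<Rightarrow> ('a \<Rightarrow> real) \<Rightarrow> real \<Rightarrow> ('a \<Rightarrow> complex) \<Rightarrow> 'a \<Rightarrow> complex" where
  "sym_op U f mu u x = (\<Sum>e\<in>U. of_real (cosh (f (x + e) - f x)) * u (x + e)) - of_real mu * u x"

definition skew_op :: "'a::plus set \<Rightarrow> ('a \<Rightarrow> real) \<Rightarrow> ('a \<Rightarrow> complex) \<Rightarrow> 'a \<Rightarrow> complex" where
  "skew_op U f u x = - (\<Sum>e\<in>U. of_real (sinh (f (x + e) - f x)) * u (x + e))"

definition corr :: "('a::plus \<Rightarrow> complex) \<Rightarrow> 'a \<Rightarrow> 'a \<Rightarrow> 'a \<Rightarrow> real" where
  "corr u e e' x = Re (u (x + e) * cnj (u (x + e')))"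

context
  fixes U :: "'a::ab_group_add set" and f :: "'a \<Rightarrow> real" and mu :: real and u :: "'a \<Rightarrow> complex"
  assumes U: "finite U" "\<And>e. e \<in> U \<Longrightarrow> - e \<in> U" and u: "fsupp u"
begin

lemma fsupp_sym_op: "fsupp (sym_op U f mu u)"
  unfolding sym_op_def[abs_def] by (intro fsupp_intros u)

lemma fsupp_skew_op: "fsupp (skew_op U f u)"
  unfolding skew_op_def[abs_def] by (intro fsupp_intros u)

lemma corr_commute: "corr u e e' x = corr u e' e x"
  by (simp add: corr_def)

lemma fsupp_corr: "fsupp (corr u e e')"
  using fsupp_shift[OF u, of e] by (rule fsupp_mono) (simp add: corr_def)

text \<open>\<open>corr\<close> is symmetric in e and e', so the product cosh * sinh may be averaged
  with its transpose, and the addition formula applies.\<close>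

lemma cross_term_swap:
  "(\<Sum>e\<in>U. \<Sum>e'\<in>U. cosh (d e) * sinh (d e') * corr u e e' x) * 2
    = (\<Sum>e\<in>U. \<Sum>e'\<in>U. sinh (d e + d e') * corr u e e' x)"
proof -
  have "(\<Sum>e\<in>U. \<Sum>e'\<in>U. cosh (d e) * sinh (d e') * corr u e e' x)
      = (\<Sum>e\<in>U. \<Sum>e'\<in>U. sinh (d e) * cosh (d e') * corr u e e' x)"
    by (subst sum.swap) (simp add: corr_commute mult.commute)
  then show ?thesis
    by (simp add: sinh_add distrib_right sum.distrib)
qed

text \<open>Shifting x by -e and then renaming e to -e reproduces the sum with the opposite sign,
  because sinh is odd. This is the cross term of the constant \<open>mu\<close> with the skew
  part.\<close>

lemma potential_term_vanishes:
  "(\<Sum>\<^sub>\<infinity>x. \<Sum>e\<in>U. sinh (f (x + e) - f x) * corr u 0 e x) = 0" (is "?Z = 0")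
proof -
  have "?Z = (\<Sum>e\<in>U. \<Sum>\<^sub>\<infinity>x. sinh (f (x + e) - f x) * corr u 0 e x)"
    by (intro infsum_sum_fsupp fsupp_intros fsupp_corr)
  also have "\<dots> = (\<Sum>e\<in>U. \<Sum>\<^sub>\<infinity>x. sinh (f (x - e + e) - f (x - e)) * corr u 0 e (x - e))"
    by (intro sum.cong refl infsum_shift_diff[where f = "\<lambda>x. sinh (f (x + e) - f x) * corr u 0 e x" for e, symmetric])
  also have "\<dots> = (\<Sum>e\<in>U. \<Sum>\<^sub>\<infinity>x. - (sinh (f (x + - e) - f x) * corr u 0 (- e) x))"
  proof (intro sum.cong refl infsum_cong)
    fix e x
    have "sinh (f (x - e + e) - f (x - e)) = - sinh (f (x + - e) - f x)"
      using sinh_minus[of "f (x + - e) - f x"] by simp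
    moreover have "corr u 0 e (x - e) = corr u 0 (- e) x"
      by (simp add: corr_def mult.commute)
    ultimately show "sinh (f (x - e + e) - f (x - e)) * corr u 0 e (x - e)
        = - (sinh (f (x + - e) - f x) * corr u 0 (- e) x)" by simp
  qed
  also have "\<dots> = (\<Sum>e\<in>U. \<Sum>\<^sub>\<infinity>x. - (sinh (f (x + e) - f x) * corr u 0 e x))"
    by (rule sum_uminus_symmetric[OF U(2)])
  also have "\<dots> = - (\<Sum>e\<in>U. \<Sum>\<^sub>\<infinity>x. sinh (f (x + e) - f x) * corr u 0 e x)"
    by (simp add: infsum_uminus sum_negf)
  also have "\<dots> = - ?Z"
    by (subst infsum_sum_fsupp) (auto intro!: fsupp_intros fsupp_corr)
  finally show ?thesis by simp
qed

text \<open>Shifting x by -(e + e') sends the pair (e, e') to (-e', -e): the correlation keeps its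
  form and the sinh changes sign. Being zero, this sum can be added to the cross terms to make their
  kernel small.\<close>

lemma diagonal_term_vanishes:
  "(\<Sum>\<^sub>\<infinity>x. \<Sum>e\<in>U. \<Sum>e'\<in>U. sinh (f (x + e + e') - f x) * corr u e e' x) = 0" (is "?Z = 0")
proof -
  let ?s = "\<lambda>e e'. \<Sum>\<^sub>\<infinity>x. sinh (f (x + e + e') - f x) * corr u e e' x"
  have Z: "?Z = (\<Sum>e\<in>U. \<Sum>e'\<in>U. ?s e e')"
    by (subst infsum_sum_fsupp, (intro fsupp_intros fsupp_corr)[1])
      (intro sum.cong refl infsum_sum_fsupp fsupp_intros fsupp_corr)
  have s: "?s e e' = - ?s (- e') (- e)" for e e'
  proof -
    have "?s e e' = (\<Sum>\<^sub>\<infinity>x. sinh (f (x - (e + e') + e + e') - f (x - (e + e'))) * corr u e e' (x - (e + e')))"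
      by (rule infsum_shift_diff[where f = "\<lambda>x. sinh (f (x + e + e') - f x) * corr u e e' x", symmetric])
    also have "\<dots> = (\<Sum>\<^sub>\<infinity>x. - (sinh (f (x + - e' + - e) - f x) * corr u (- e') (- e) x))"
    proof (intro infsum_cong)
      fix x
      have x: "x - (e + e') + e + e' = x" "x - (e + e') = x + - e' + - e"
        by (simp_all add: algebra_simps)
      have "sinh (f x - f (x + - e' + - e)) = - sinh (f (x + - e' + - e) - f x)"
        using sinh_minus[of "f (x + - e' + - e) - f x"] by simp
      moreover have "corr u e e' (x + - e' + - e) = corr u (- e') (- e) x"
        by (simp add: corr_def algebra_simps)
      ultimately show "sinh (f (x - (e + e') + e + e') - f (x - (e + e'))) * corr u e e' (x - (e + e'))
          = - (sinh (f (x + - e' + - e) - f x) * corr u (- e') (- e) x)"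
        unfolding x by simp
    qed
    finally show ?thesis by (simp add: infsum_uminus)
  qed
  have "?Z = - (\<Sum>e\<in>U. \<Sum>e'\<in>U. ?s (- e') (- e))"
    unfolding Z by (subst s) (simp add: sum_negf)
  also have "(\<Sum>e\<in>U. \<Sum>e'\<in>U. ?s (- e') (- e)) = (\<Sum>e\<in>U. \<Sum>e'\<in>U. ?s e' e)"
    by (simp only: sum_uminus_symmetric[OF U(2), of "\<lambda>e'. ?s e' e" for e]
        sum_uminus_symmetric[OF U(2), of "\<lambda>e. \<Sum>e'\<in>U. ?s e' e"])
  also have "\<dots> = ?Z"
    unfolding Z by (rule sum.swap)
  finally show ?thesis by simp
qed

lemma norm_sum_cross:
  "2 * Re (sym_op U f mu u x * cnj (skew_op U f u x))
     = 2 * mu * (\<Sum>e\<in>U. sinh (f (x + e) - f x) * corr u 0 e x)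
       - (\<Sum>e\<in>U. \<Sum>e'\<in>U. sinh ((f (x + e) - f x) + (f (x + e') - f x)) * corr u e e' x)"
proof -
  have "sym_op U f mu u x * cnj (skew_op U f u x)
      = of_real mu * (\<Sum>e\<in>U. of_real (sinh (f (x + e) - f x)) * (u x * cnj (u (x + e))))
        - (\<Sum>e\<in>U. \<Sum>e'\<in>U. of_real (cosh (f (x + e) - f x) * sinh (f (x + e') - f x))
            * (u (x + e) * cnj (u (x + e'))))"
  proof -
    define V W where "V = (\<Sum>e\<in>U. of_real (cosh (f (x + e) - f x)) * u (x + e))"
      and "W = (\<Sum>e\<in>U. of_real (sinh (f (x + e) - f x)) * cnj (u (x + e)))"
    have "cnj (skew_op U f u x) = - W"
      by (simp add: skew_op_def W_def)
    then have "sym_op U f mu u x * cnj (skew_op U f u x) = of_real mu * (u x * W) - V * W"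
      unfolding sym_op_def V_def[symmetric] by (simp add: algebra_simps)
    then show ?thesis
      unfolding V_def W_def sum_product by (simp add: sum_distrib_left mult_ac)
  qed
  moreover have re: "Re (of_real c * z) = c * Re z" for c z
    by simp
  ultimately have "Re (sym_op U f mu u x * cnj (skew_op U f u x))
      = mu * (\<Sum>e\<in>U. sinh (f (x + e) - f x) * corr u 0 e x)
        - (\<Sum>e\<in>U. \<Sum>e'\<in>U. cosh (f (x + e) - f x) * sinh (f (x + e') - f x) * corr u e e' x)"
    by (simp only: minus_complex.sel Re_sum re corr_def add_0_right)
  then show ?thesis
    unfolding cross_term_swap[where d = "\<lambda>e. f (x + e) - f x", symmetric] by (simp only: algebra_simps)
qed

lemma energy_identity:
  "(l2 (\<lambda>x. (\<Sum>e\<in>U. of_real (exp (- (f (x + e) - f x))) * u (x + e)) - of_real mu * u x))\<^sup>2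
    = (l2 (sym_op U f mu u))\<^sup>2 + (l2 (skew_op U f u))\<^sup>2
      + (\<Sum>\<^sub>\<infinity>x. \<Sum>e\<in>U. \<Sum>e'\<in>U.
          (sinh (f (x + e + e') - f x) - sinh ((f (x + e) - f x) + (f (x + e') - f x))) * corr u e e' x)"
proof -
  let ?A = "\<lambda>x. (\<Sum>e\<in>U. of_real (exp (- (f (x + e) - f x))) * u (x + e)) - of_real mu * u x"
  let ?D = "\<lambda>x. \<Sum>e\<in>U. \<Sum>e'\<in>U. sinh (f (x + e + e') - f x) * corr u e e' x"
  let ?P = "\<lambda>x. \<Sum>e\<in>U. sinh (f (x + e) - f x) * corr u 0 e x"
  let ?S = "\<lambda>x. \<Sum>e\<in>U. \<Sum>e'\<in>U. sinh ((f (x + e) - f x) + (f (x + e') - f x)) * corr u e e' x"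
  have A: "?A x = sym_op U f mu u x + skew_op U f u x" for x
  proof -
    have "complex_of_real (exp (- d)) = of_real (cosh d) - of_real (sinh d)" for d
      unfolding cosh_minus_sinh[symmetric] by simp
    then show ?thesis
      unfolding sym_op_def skew_op_def by (simp only: left_diff_distrib sum_subtractf) simp
  qed
  have sq: "(cmod (?A x))\<^sup>2 = (cmod (sym_op U f mu u x))\<^sup>2 + (cmod (skew_op U f u x))\<^sup>2 + (2 * mu * ?P x - ?S x)" for x
    unfolding A norm_sum_cross[symmetric] cmod_power2 by (simp add: power2_eq_square algebra_simps)
  have D: "?D x - ?S x = (\<Sum>e\<in>U. \<Sum>e'\<in>U.
      (sinh (f (x + e + e') - f x) - sinh ((f (x + e) - f x) + (f (x + e') - f x))) * corr u e e' x)" for x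
    by (simp add: sum_subtractf left_diff_distrib)
  have P: "fsupp ?P" and S: "fsupp ?S" and DD: "fsupp ?D"
    by (intro fsupp_intros fsupp_corr)+
  have "(l2 ?A)\<^sup>2 = (\<Sum>\<^sub>\<infinity>x. (cmod (sym_op U f mu u x))\<^sup>2 + (cmod (skew_op U f u x))\<^sup>2) + (\<Sum>\<^sub>\<infinity>x. 2 * mu * ?P x - ?S x)"
    unfolding l2_sq sq
    by (intro infsum_add fsupp_summable fsupp_add fsupp_diff fsupp_mult fsupp_cmod fsupp_sym_op fsupp_skew_op P S)
  also have "(\<Sum>\<^sub>\<infinity>x. (cmod (sym_op U f mu u x))\<^sup>2 + (cmod (skew_op U f u x))\<^sup>2) = (l2 (sym_op U f mu u))\<^sup>2 + (l2 (skew_op U f u))\<^sup>2"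
    unfolding l2_sq by (intro infsum_add fsupp_summable fsupp_cmod fsupp_sym_op fsupp_skew_op)
  also have "(\<Sum>\<^sub>\<infinity>x. 2 * mu * ?P x - ?S x) = 2 * mu * infsum ?P UNIV - infsum ?S UNIV"
    by (subst infsum_diff_fsupp[OF fsupp_mult[OF P] S]) (simp only: infsum_cmult_right')
  \<comment> \<open>Both sums vanish, so the potential term may be exchanged for the diagonal one,
    which cancels the kernel sinh (d_e + d_e') to leading order.\<close>
  also have "\<dots> = infsum ?D UNIV - infsum ?S UNIV"
    by (simp only: potential_term_vanishes diagonal_term_vanishes)
  also have "\<dots> = (\<Sum>\<^sub>\<infinity>x. ?D x - ?S x)"
    by (rule infsum_diff_fsupp[symmetric, OF DD S])
  finally show ?thesis unfolding D .
qed

end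

section \<open>Elimination of the averages\<close>

lemma l2_add_bound: "l2 u \<le> a \<Longrightarrow> l2 w \<le> b \<Longrightarrow> fsupp u \<Longrightarrow> fsupp w \<Longrightarrow> l2 (\<lambda>x. u x + w x) \<le> a + b"
  using l2_add_le[of u w] by simp

lemma l2_diff_bound: "l2 u \<le> a \<Longrightarrow> l2 w \<le> b \<Longrightarrow> fsupp u \<Longrightarrow> fsupp w \<Longrightarrow> l2 (\<lambda>x. u x - w x) \<le> a + b"
  using l2_diff_le[of u w] by simp

lemma l2_mult_bound:
  assumes "l2 u \<le> a" "\<And>x. \<bar>m x\<bar> \<le> M" "fsupp u"
  shows "l2 (\<lambda>x. of_real (m x) * u x) \<le> M * a"
proof -
  have M: "0 \<le> M" using assms(2) abs_ge_zero order_trans by blast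
  have "l2 (\<lambda>x. of_real (m x) * u x) \<le> M * l2 u"
    by (rule l2_bound[OF assms(3) M]) (simp add: norm_mult mult_right_mono assms(2))
  also have "\<dots> \<le> M * a" by (rule mult_left_mono[OF assms(1) M])
  finally show ?thesis .
qed

lemma l2_scale_bound: "l2 u \<le> a \<Longrightarrow> fsupp u \<Longrightarrow> l2 (\<lambda>x. of_real c * u x) \<le> \<bar>c\<bar> * a"
  by (rule l2_mult_bound) auto

section \<open>Averages and differences with slowly varying weights\<close>

definition avg :: "'a::ab_group_add \<Rightarrow> ('a \<Rightarrow> complex) \<Rightarrow> 'a \<Rightarrow> complex" where
  "avg e u x = (u (x + e) + u (x - e)) / 2"

definition dif :: "'a::ab_group_add \<Rightarrow> ('a \<Rightarrow> complex) \<Rightarrow> 'a \<Rightarrow> complex" where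
  "dif e u x = (u (x + e) - u (x - e)) / 2"

lemma fsupp_avg: "fsupp u \<Longrightarrow> fsupp (avg e u)"
  unfolding avg_def[abs_def] by (intro fsupp_intros)

lemma fsupp_dif: "fsupp u \<Longrightarrow> fsupp (dif e u)"
  unfolding dif_def[abs_def] by (intro fsupp_intros)

lemma l2_avg: "fsupp u \<Longrightarrow> l2 (avg e u) \<le> l2 u"
  using l2_bound2[of "\<lambda>x. u (x + e)" "\<lambda>x. u (x - e)" "1/2" "1/2" "avg e u"]
  by (simp add: fsupp_intros l2_shift l2_shift_diff avg_def norm_triangle_ineq norm_divide flip: add_divide_distrib)

lemma l2_dif: "fsupp u \<Longrightarrow> l2 (dif e u) \<le> l2 u"
  using l2_bound2[of "\<lambda>x. u (x + e)" "\<lambda>x. u (x - e)" "1/2" "1/2" "dif e u"]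
  by (simp add: fsupp_intros l2_shift l2_shift_diff dif_def norm_triangle_ineq4 norm_divide flip: add_divide_distrib)

text \<open>The operator form of \<open>cos\<^sup>2 = 1 - sin\<^sup>2\<close>: on plane waves \<^const>\<open>avg\<close> acts as the
  cosine and \<^const>\<open>dif\<close> as \<open>\<i>\<close> times the sine.\<close>

lemma avg_avg: "avg e (avg e u) x = u x + dif e (dif e u) x"
  by (simp add: avg_def dif_def field_simps)

lemma avg_commute: "avg e (avg e' u) x = avg e' (avg e u) x"
  by (simp add: avg_def field_simps)

definition wavg :: "('a::ab_group_add \<Rightarrow> real) \<Rightarrow> 'a \<Rightarrow> ('a \<Rightarrow> complex) \<Rightarrow> 'a \<Rightarrow> complex" where
  "wavg m e u x = of_real (m x) * avg e u x"

lemma wavg_add: "wavg m e (\<lambda>x. u x + w x) x = wavg m e u x + wavg m e w x"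
  and wavg_diff: "wavg m e (\<lambda>x. u x - w x) x = wavg m e u x - wavg m e w x"
  and wavg_scale: "wavg m e (\<lambda>x. c * u x) x = c * wavg m e u x"
  by (simp_all add: wavg_def avg_def algebra_simps add_divide_distrib diff_divide_distrib)

lemma fsupp_wavg: "fsupp u \<Longrightarrow> fsupp (wavg m e u)"
  unfolding wavg_def[abs_def] by (intro fsupp_intros fsupp_avg)

lemma l2_wavg:
  assumes "l2 u \<le> a" "\<And>x. \<bar>m x\<bar> \<le> M" "fsupp u"
  shows "l2 (wavg m e u) \<le> M * a"
  unfolding wavg_def[abs_def]
  by (intro l2_mult_bound assms fsupp_avg order_trans[OF l2_avg])

lemmas chain_fsupp = fsupp_add fsupp_diff fsupp_mult fsupp_wavg fsupp_avg fsupp_dif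

text \<open>The average sees m' only at x + e and x - e, so pulling m' out costs one increment of m'
  on each side.\<close>

lemma wavg_mult_commutator:
  assumes "\<And>x. \<bar>m x\<bar> \<le> M" "\<And>x. \<bar>m' (x + e) - m' x\<bar> \<le> eps" "fsupp u"
  shows "l2 (\<lambda>x. wavg m e (\<lambda>y. of_real (m' y) * u y) x - of_real (m' x) * wavg m e u x) \<le> M * (eps * l2 u)"
proof -
  have eps: "0 \<le> eps" using assms(2) abs_ge_zero order_trans by blast
  have var: "\<bar>m' (x - e) - m' x\<bar> \<le> eps" for x
    using assms(2)[of "x - e"] by (simp add: abs_minus_commute)
  let ?w = "\<lambda>x. (of_real (m' (x + e) - m' x) * u (x + e) + of_real (m' (x - e) - m' x) * u (x - e)) / 2"
  have "l2 ?w \<le> (eps / 2) * l2 (\<lambda>x. u (x + e)) + (eps / 2) * l2 (\<lambda>x. u (x - e))"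
  proof (rule l2_bound2)
    fix x
    have "cmod (?w x) \<le> (cmod (of_real (m' (x + e) - m' x) * u (x + e)) + cmod (of_real (m' (x - e) - m' x) * u (x - e))) / 2"
      by (simp add: norm_divide norm_triangle_ineq)
    also have "\<dots> \<le> (eps * cmod (u (x + e)) + eps * cmod (u (x - e))) / 2"
      unfolding norm_mult norm_of_real
      by (intro divide_right_mono add_mono mult_right_mono assms var) auto
    finally show "cmod (?w x) \<le> eps / 2 * cmod (u (x + e)) + eps / 2 * cmod (u (x - e))"
      by (simp add: field_simps)
  qed (use eps assms(3) in \<open>auto intro: fsupp_intros\<close>)
  then have "l2 ?w \<le> eps * l2 u"
    by (simp add: l2_shift l2_shift_diff)
  then have "l2 (\<lambda>x. of_real (m x) * ?w x) \<le> M * (eps * l2 u)"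
    by (intro l2_mult_bound assms fsupp_intros)
  moreover have "wavg m e (\<lambda>y. of_real (m' y) * u y) x - of_real (m' x) * wavg m e u x = of_real (m x) * ?w x" for x
    by (simp add: wavg_def avg_def field_simps)
  ultimately show ?thesis by (simp only:)
qed

text \<open>The previous commutator with \<open>avg e' u\<close> in place of u: both weights come to
  the front, leaving unweighted averages, which commute.\<close>

lemma wavg_wavg:
  assumes "\<And>x. \<bar>m x\<bar> \<le> M" "\<And>x. \<bar>m' (x + e) - m' x\<bar> \<le> eps" "fsupp u"
  shows "l2 (\<lambda>x. wavg m e (wavg m' e' u) x - of_real (m x * m' x) * avg e (avg e' u) x) \<le> M * (eps * l2 u)"
proof -
  have M: "0 \<le> M" using assms(1) abs_ge_zero order_trans by blast
  have eps: "0 \<le> eps" using assms(2) abs_ge_zero order_trans by blast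
  have "l2 (\<lambda>x. wavg m e (\<lambda>y. of_real (m' y) * avg e' u y) x - of_real (m' x) * wavg m e (avg e' u) x)
      \<le> M * (eps * l2 (avg e' u))"
    by (intro wavg_mult_commutator assms fsupp_avg)
  also have "\<dots> \<le> M * (eps * l2 u)"
    by (intro mult_left_mono l2_avg assms M eps)
  finally show ?thesis by (simp add: wavg_def[abs_def] mult_ac)
qed

context
  fixes M eps delta :: real and u :: "'a::ab_group_add \<Rightarrow> complex" and e1 e2 :: 'a and m1 m2 :: "'a \<Rightarrow> real"
  assumes M: "1 \<le> M" and u: "fsupp u" and err: "eps * l2 u \<le> delta"
    and bd1: "\<And>x. \<bar>m1 x\<bar> \<le> M" and bd2: "\<And>x. \<bar>m2 x\<bar> \<le> M"
    and slow1: "\<And>x e. e = e1 \<or> e = e2 \<Longrightarrow> \<bar>m1 (x + e) - m1 x\<bar> \<le> eps"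
    and slow2: "\<And>x e. e = e1 \<or> e = e2 \<Longrightarrow> \<bar>m2 (x + e) - m2 x\<bar> \<le> eps"
    and small1: "l2 (dif e1 u) \<le> delta" and small2: "l2 (dif e2 u) \<le> delta"
begin

text \<open>For constant m the square would be m^2 (u + dif (dif u)) by \<open>avg_avg\<close>. What
  remains is one commutator and one small second difference, both measured by
  \<open>delta\<close>.\<close>

lemma wavg_square:
  assumes bd: "\<And>x. \<bar>m x\<bar> \<le> M" and slow: "\<And>x. \<bar>m (x + e) - m x\<bar> \<le> eps" and small: "l2 (dif e u) \<le> delta"
  shows "l2 (\<lambda>x. wavg m e (wavg m e u) x - of_real ((m x)\<^sup>2) * u x) \<le> 2 * M\<^sup>2 * delta"
proof -
  have d: "0 \<le> delta" using small l2_nonneg order_trans by blast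
  have "l2 (\<lambda>x. (wavg m e (wavg m e u) x - of_real (m x * m x) * avg e (avg e u) x)
      + of_real ((m x)\<^sup>2) * dif e (dif e u) x) \<le> M * delta + M\<^sup>2 * delta"
  proof (intro l2_add_bound l2_mult_bound)
    show "l2 (\<lambda>x. wavg m e (wavg m e u) x - of_real (m x * m x) * avg e (avg e u) x) \<le> M * delta"
      by (rule order_trans[OF wavg_wavg mult_left_mono[OF err]]) (use bd slow u M in auto)
    show "l2 (dif e (dif e u)) \<le> delta"
      using l2_dif[OF fsupp_dif[OF u]] small by (rule order_trans)
    show "\<bar>(m x)\<^sup>2\<bar> \<le> M\<^sup>2" for x
      using power_mono[OF bd[of x], of 2] by simp
  qed (intro chain_fsupp u)+
  also have "M * delta \<le> M\<^sup>2 * delta"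
    using M d by (intro mult_right_mono) (auto simp: power2_eq_square)
  finally show ?thesis
    by (simp add: avg_avg power2_eq_square algebra_simps)
qed

lemma wavg_commutator:
  "l2 (\<lambda>x. wavg m1 e1 (wavg m2 e2 u) x - wavg m2 e2 (wavg m1 e1 u) x) \<le> 2 * M * delta"
proof -
  have le: "M * (eps * l2 u) \<le> M * delta" using err M by (intro mult_left_mono) auto
  have "l2 (\<lambda>x. (wavg m1 e1 (wavg m2 e2 u) x - of_real (m1 x * m2 x) * avg e1 (avg e2 u) x)
     - (wavg m2 e2 (wavg m1 e1 u) x - of_real (m2 x * m1 x) * avg e2 (avg e1 u) x)) \<le> M * delta + M * delta"
    by (intro l2_diff_bound order_trans[OF wavg_wavg le] bd1 bd2 slow1 slow2 u chain_fsupp; simp)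
  then show ?thesis
    by (simp add: avg_commute[of e2 e1] mult.commute[of "m2 _"])
qed

text \<open>Approximately \<open>m\<^sub>1 c\<^sub>1 u = m\<^sub>2 c\<^sub>2 u\<close>, and \<open>c\<^sub>j\<^sup>2 u = u\<close>; squaring eliminates the averages.\<close>

lemma eliminate_difference:
  assumes w: "l2 (\<lambda>x. wavg m1 e1 u x - wavg m2 e2 u x) \<le> delta"
  shows "l2 (\<lambda>x. of_real ((m1 x)\<^sup>2 - (m2 x)\<^sup>2) * u x) \<le> 8 * M\<^sup>2 * delta"
proof -
  have d: "0 \<le> delta" using small1 l2_nonneg order_trans by blast
  let ?A = "wavg m1 e1" and ?B = "wavg m2 e2"
  let ?w = "\<lambda>x. wavg m1 e1 u x - wavg m2 e2 u x"
  \<comment> \<open>Noncommutative factorisation: (A + B)(A - B) u + (A B - B A) u = A^2 u - B^2 u.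
    Then each square is replaced by a multiplication operator.\<close>
  have "l2 (\<lambda>x. ((?A ?w x + ?B ?w x) + (?A (?B u) x - ?B (?A u) x)
      + (?B (?B u) x - of_real ((m2 x)\<^sup>2) * u x)) - (?A (?A u) x - of_real ((m1 x)\<^sup>2) * u x))
      \<le> ((M * delta + M * delta) + 2 * M * delta + 2 * M\<^sup>2 * delta) + 2 * M\<^sup>2 * delta"
    by (intro l2_diff_bound l2_add_bound wavg_commutator wavg_square l2_wavg w bd1 bd2 slow1 slow2 u chain_fsupp small1 small2; simp)
  also have "\<dots> = 4 * (M * delta) + 4 * M\<^sup>2 * delta" by simp
  also have "M * delta \<le> M\<^sup>2 * delta"
    using M d by (intro mult_right_mono) (auto simp: power2_eq_square)
  finally show ?thesis
    by (simp add: wavg_diff algebra_simps)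
qed

text \<open>Substituting B u = mu u - A u approximately into B^2 u gives p u = 2 mu A u with p =
  m1^2 - m2^2 + mu^2; squaring this removes A. The resulting factor is ((m1 - mu)^2 - m2^2) ((m1 +
  mu)^2 - m2^2).\<close>

lemma eliminate_sum:
  assumes mu: "0 \<le> mu" "mu \<le> 2" and w: "l2 (\<lambda>x. wavg m1 e1 u x + wavg m2 e2 u x - of_real mu * u x) \<le> delta"
  shows "l2 (\<lambda>x. of_real (((m1 x)\<^sup>2 - (m2 x)\<^sup>2 + mu\<^sup>2)\<^sup>2 - 4 * mu\<^sup>2 * (m1 x)\<^sup>2) * u x) \<le> 140 * M ^ 4 * delta"
proof -
  have d: "0 \<le> delta" using small1 l2_nonneg order_trans by blast
  have M2: "1 \<le> M\<^sup>2" "M \<le> M\<^sup>2" using M by (auto simp: one_le_power self_le_power)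
  have mu2: "mu\<^sup>2 \<le> 4" using power_mono[OF mu(2) mu(1), of 2] by simp
  let ?A = "wavg m1 e1" and ?B = "wavg m2 e2"
  let ?w = "\<lambda>x. wavg m1 e1 u x + wavg m2 e2 u x - of_real mu * u x"
  define p where "p x = (m1 x)\<^sup>2 - (m2 x)\<^sup>2 + mu\<^sup>2" for x
  define z where "z x = of_real (p x) * u x - 2 * of_real mu * ?A u x" for x
  have z: "fsupp z" unfolding z_def[abs_def] by (intro chain_fsupp u)
  have fw: "fsupp ?w" by (intro chain_fsupp u)
  \<comment> \<open>(A - B) applied to ?w, minus mu ?w, equals p u - 2 mu A u once the commutator
    and the two squares are corrected.\<close>
  have "l2 (\<lambda>x. ((?A ?w x - ?B ?w x - (?A (?B u) x - ?B (?A u) x)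
      + (?B (?B u) x - of_real ((m2 x)\<^sup>2) * u x)) - (?A (?A u) x - of_real ((m1 x)\<^sup>2) * u x)) - of_real mu * ?w x)
      \<le> ((M * delta + M * delta + 2 * M * delta + 2 * M\<^sup>2 * delta) + 2 * M\<^sup>2 * delta) + \<bar>mu\<bar> * delta"
    by (intro l2_diff_bound l2_add_bound wavg_commutator wavg_square l2_wavg w bd1 bd2 slow1 slow2 u chain_fsupp small1 small2 l2_scale_bound; simp)
  also have "\<dots> = 4 * (M * delta) + 4 * (M\<^sup>2 * delta) + mu * delta" using mu by simp
  also have "\<dots> \<le> 4 * (M\<^sup>2 * delta) + 4 * (M\<^sup>2 * delta) + (2 * M\<^sup>2) * delta"
    using M2 d mu by (intro add_mono mult_left_mono mult_right_mono) auto
  also have "\<dots> = 10 * M\<^sup>2 * delta" by simp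
  also have "(\<lambda>x. ((?A ?w x - ?B ?w x - (?A (?B u) x - ?B (?A u) x)
      + (?B (?B u) x - of_real ((m2 x)\<^sup>2) * u x)) - (?A (?A u) x - of_real ((m1 x)\<^sup>2) * u x)) - of_real mu * ?w x) = z"
    by (rule ext) (simp add: wavg_diff wavg_add wavg_scale z_def p_def power2_eq_square algebra_simps)
  finally have lz: "l2 z \<le> 10 * M\<^sup>2 * delta" .
  have pb: "\<bar>p x\<bar> \<le> 5 * M\<^sup>2" for x
  proof -
    have "(m1 x)\<^sup>2 \<le> M\<^sup>2" "(m2 x)\<^sup>2 \<le> M\<^sup>2"
      using power_mono[OF bd1[of x], of 2] power_mono[OF bd2[of x], of 2] by simp_all
    then show ?thesis using mu2 M2 zero_le_power2[of "m1 x"] zero_le_power2[of "m2 x"] zero_le_power2[of mu]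
      unfolding p_def by linarith
  qed
  have sq: "\<bar>a\<^sup>2 - b\<^sup>2\<bar> \<le> 2 * M * eps" if "\<bar>a\<bar> \<le> M" "\<bar>b\<bar> \<le> M" "\<bar>a - b\<bar> \<le> eps" for a b :: real
  proof -
    have "\<bar>a\<^sup>2 - b\<^sup>2\<bar> = \<bar>a + b\<bar> * \<bar>a - b\<bar>" by (simp add: power2_eq_square algebra_simps flip: abs_mult)
    also have "\<dots> \<le> (2 * M) * eps" using that by (intro mult_mono) auto
    finally show ?thesis by simp
  qed
  have ps: "\<bar>p (x + e1) - p x\<bar> \<le> 4 * M * eps" for x
    using sq[OF bd1 bd1 slow1, of e1 x] sq[OF bd2 bd2 slow2, of e1 x] unfolding p_def by simp
  have pc: "l2 (\<lambda>x. ?A (\<lambda>y. of_real (p y) * u y) x - of_real (p x) * ?A u x) \<le> 4 * M\<^sup>2 * delta"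
  proof -
    have "M * (4 * M * eps * l2 u) = 4 * M\<^sup>2 * (eps * l2 u)" by (simp add: power2_eq_square)
    also have "\<dots> \<le> 4 * M\<^sup>2 * delta" using err by (intro mult_left_mono) auto
    finally have le: "M * (4 * M * eps * l2 u) \<le> 4 * M\<^sup>2 * delta" .
    show ?thesis
      by (rule order_trans[OF wavg_mult_commutator le]) (use bd1 ps u in auto)
  qed
  \<comment> \<open>The conjugate factor p + 2 mu A is applied to z = p u - 2 mu A u; the other
    terms commute p past A and replace A^2 by m1^2.\<close>
  have "l2 (\<lambda>x. of_real (p x) * z x + (of_real (2 * mu) * (?A z x - (?A (\<lambda>y. of_real (p y) * u y) x - of_real (p x) * ?A u x))
      + of_real (4 * mu\<^sup>2) * (?A (?A u) x - of_real ((m1 x)\<^sup>2) * u x)))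
      \<le> (5 * M\<^sup>2) * (10 * M\<^sup>2 * delta) + (\<bar>2 * mu\<bar> * (M * (10 * M\<^sup>2 * delta) + 4 * M\<^sup>2 * delta) + \<bar>4 * mu\<^sup>2\<bar> * (2 * M\<^sup>2 * delta))"
    by (intro l2_diff_bound l2_add_bound wavg_square l2_wavg l2_mult_bound l2_scale_bound lz pb pc bd1 slow1 u z small1 chain_fsupp; simp)
  also have "(\<lambda>x. of_real (p x) * z x + (of_real (2 * mu) * (?A z x - (?A (\<lambda>y. of_real (p y) * u y) x - of_real (p x) * ?A u x))
      + of_real (4 * mu\<^sup>2) * (?A (?A u) x - of_real ((m1 x)\<^sup>2) * u x))) = (\<lambda>x. of_real ((p x)\<^sup>2 - 4 * mu\<^sup>2 * (m1 x)\<^sup>2) * u x)"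
    by (rule ext) (simp add: z_def[abs_def] wavg_diff wavg_scale power2_eq_square algebra_simps)
  finally have "l2 (\<lambda>x. of_real ((p x)\<^sup>2 - 4 * mu\<^sup>2 * (m1 x)\<^sup>2) * u x)
      \<le> 50 * (M^4 * delta) + (2 * mu * (10 * (M ^ 3 * delta) + 4 * (M\<^sup>2 * delta)) + 8 * mu\<^sup>2 * (M\<^sup>2 * delta))"
    using mu by (simp add: power_numeral_reduce algebra_simps)
  also have "\<dots> \<le> 50 * (M^4 * delta) + (4 * (10 * (M ^ 4 * delta) + 4 * (M ^ 4 * delta)) + 32 * (M ^ 4 * delta))"
    using M d mu mu2 by (intro add_mono mult_mono mult_left_mono mult_right_mono power_increasing mult_nonneg_nonneg add_nonneg_nonneg zero_le_power) auto
  \<comment> \<open>50 + 4 * (10 + 4) + 32 = 138.\<close>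
  also have "\<dots> \<le> 140 * M ^ 4 * delta" using M d by simp
  finally show ?thesis by (simp add: p_def)
qed

end

section \<open>Taylor estimates and the eliminants\<close>

lemma cosh_mono_abs: "\<bar>x\<bar> \<le> c \<Longrightarrow> cosh x \<le> cosh (c::real)"
  using cosh_real_nonneg_le_iff[of "\<bar>x\<bar>" c] by simp

lemma abs_sinh_le_cosh: "\<bar>sinh x\<bar> \<le> cosh (x::real)"
  using sinh_less_cosh_real[of x] sinh_less_cosh_real[of "- x"] by simp

lemma abs_sinh_mono_abs: "\<bar>x\<bar> \<le> c \<Longrightarrow> \<bar>sinh x\<bar> \<le> cosh (c::real)"
  using abs_sinh_le_cosh[of x] cosh_mono_abs[of x c] by linarith

lemma sinh_lipschitz:
  fixes x y :: real
  assumes "\<bar>x\<bar> \<le> c" "\<bar>y\<bar> \<le> c"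
  shows "\<bar>sinh x - sinh y\<bar> \<le> cosh c * \<bar>x - y\<bar>"
proof -
  have "norm (sinh x - sinh y) \<le> cosh c * norm (x - y)"
  proof (rule field_differentiable_bound[of "{- c..c}"])
    show "(sinh has_field_derivative cosh z) (at z within {- c..c})" for z :: real
      by (auto intro!: derivative_eq_intros)
  qed (use assms in \<open>auto intro: cosh_mono_abs\<close>)
  then show ?thesis by simp
qed

lemma cosh_lipschitz:
  fixes x y :: real
  assumes "\<bar>x\<bar> \<le> c" "\<bar>y\<bar> \<le> c"
  shows "\<bar>cosh x - cosh y\<bar> \<le> cosh c * \<bar>x - y\<bar>"
proof -
  have "norm (cosh x - cosh y) \<le> cosh c * norm (x - y)"
  proof (rule field_differentiable_bound[of "{- c..c}"])
    show "(cosh has_field_derivative sinh z) (at z within {- c..c})" for z :: real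
      by (auto intro!: derivative_eq_intros)
  qed (use assms in \<open>auto intro: abs_sinh_mono_abs\<close>)
  then show ?thesis by simp
qed

lemma sinh_taylor2:
  fixes x y :: real
  assumes "\<bar>x\<bar> \<le> c" "\<bar>x + y\<bar> \<le> c"
  shows "\<bar>sinh (x + y) - sinh x - y * cosh x\<bar> \<le> cosh c * y\<^sup>2"
proof -
  have "\<bar>(sinh (x + y) - (x + y) * cosh x) - (sinh x - x * cosh x)\<bar> \<le> (cosh c * \<bar>y\<bar>) * \<bar>(x + y) - x\<bar>"
    unfolding real_norm_def[symmetric]
  proof (rule field_differentiable_bound[of "closed_segment x (x + y)"])
    fix z assume z: "z \<in> closed_segment x (x + y)"
    show "((\<lambda>t. sinh t - t * cosh x) has_field_derivative cosh z - cosh x) (at z within closed_segment x (x + y))"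
      by (auto intro!: derivative_eq_intros)
    have zc: "\<bar>z\<bar> \<le> c" and zx: "\<bar>z - x\<bar> \<le> \<bar>y\<bar>"
      using z assms by (auto simp: closed_segment_eq_real_ivl split: if_splits)
    have "\<bar>cosh z - cosh x\<bar> \<le> cosh c * \<bar>z - x\<bar>" by (rule cosh_lipschitz[OF zc assms(1)])
    also have "\<dots> \<le> cosh c * \<bar>y\<bar>" using zx by (intro mult_left_mono) auto
    finally show "norm (cosh z - cosh x) \<le> cosh c * norm y" by simp
  qed (auto simp: convex_closed_segment)
  moreover have "cosh c * \<bar>y\<bar> * \<bar>(x + y) - x\<bar> = cosh c * y\<^sup>2"
    by (simp add: power2_eq_square)
  moreover have "(sinh (x + y) - (x + y) * cosh x) - (sinh x - x * cosh x) = sinh (x + y) - sinh x - y * cosh x"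
    by (simp add: algebra_simps)
  ultimately show ?thesis by (simp only:)
qed

lemma sinh_ge_self: "0 \<le> x \<Longrightarrow> x \<le> sinh (x::real)"
  using DERIV_nonneg_imp_nondecreasing[of 0 x "\<lambda>t. sinh t - t"]
  by (force intro!: derivative_eq_intros simp: cosh_real_ge_1)

text \<open>Gives the lower bound for the determinant in \<open>dif_pointwise\<close>.\<close>

lemma mult_sinh_ge:
  fixes b n :: real assumes "0 \<le> b"
  shows "b * n\<^sup>2 \<le> n * sinh (b * n)"
proof (cases "0 \<le> n")
  case True
  then have "n * (b * n) \<le> n * sinh (b * n)"
    using assms by (intro mult_left_mono sinh_ge_self) auto
  then show ?thesis by (simp add: power2_eq_square algebra_simps)
next
  case False
  then have "(- n) * (b * (- n)) \<le> (- n) * sinh (b * (- n))"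
    using assms by (intro mult_left_mono sinh_ge_self mult_nonneg_nonneg) auto
  then show ?thesis by (simp add: power2_eq_square algebra_simps)
qed

lemma abs_sinh_le:
  fixes x :: real assumes "\<bar>x\<bar> \<le> c" shows "\<bar>sinh x\<bar> \<le> cosh c * \<bar>x\<bar>"
  using sinh_lipschitz[OF assms, of 0] assms by simp

lemma sinh_minus_self_bound:
  fixes x :: real assumes "\<bar>x\<bar> \<le> c" shows "\<bar>sinh x - x\<bar> \<le> cosh c * x\<^sup>2"
  using sinh_taylor2[of 0 c x] assms by simp

lemma ln_taylor2:
  fixes t :: real assumes "\<bar>t\<bar> \<le> 1/2"
  shows "\<bar>ln (1 + t) - t + t\<^sup>2 / 2\<bar> \<le> 2 * \<bar>t\<bar> ^ 3"
proof -
  have "\<bar>(ln (1 + t) - t + t\<^sup>2 / 2) - (ln (1 + 0) - 0 + 0\<^sup>2 / 2)\<bar> \<le> (2 * t\<^sup>2) * \<bar>t - 0\<bar>"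
    unfolding real_norm_def[symmetric]
  proof (rule field_differentiable_bound[of "closed_segment 0 t"])
    fix z assume z: "z \<in> closed_segment 0 t"
    have zt: "\<bar>z\<bar> \<le> \<bar>t\<bar>" using z by (auto simp: closed_segment_eq_real_ivl split: if_splits)
    then have z1: "1/2 \<le> 1 + z" using assms by linarith
    have "inverse (1 + z) - 1 + z = z\<^sup>2 / (1 + z)"
      using z1 by (simp add: field_simps power2_eq_square)
    moreover have "((\<lambda>t. ln (1 + t) - t + t\<^sup>2 / 2) has_field_derivative inverse (1 + z) - 1 + z) (at z within closed_segment 0 t)"
      using z1 by (auto intro!: derivative_eq_intros simp: field_simps)
    ultimately show "((\<lambda>t. ln (1 + t) - t + t\<^sup>2 / 2) has_field_derivative z\<^sup>2 / (1 + z)) (at z within closed_segment 0 t)"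
      by simp
    have "z\<^sup>2 / (1 + z) \<le> t\<^sup>2 / (1/2)"
      using z1 zt by (intro frac_le) (auto simp: abs_le_square_iff)
    then show "norm (z\<^sup>2 / (1 + z)) \<le> 2 * t\<^sup>2" using z1 by simp
  qed (auto simp: convex_closed_segment)
  then show ?thesis by (simp add: power3_eq_cube power2_eq_square abs_mult)
qed

text \<open>With \<open>r' = r (1 + t)\<close>, the hypothesis \<open>eq\<close> says \<open>2 t + t\<^sup>2 = 2 \<sigma> + \<tau>\<^sup>2\<close>,
  which expands \<open>t\<close> to second order without differentiating the square root.\<close>

lemma radial_taylor:
  fixes r r' s w a :: real
  assumes r: "0 < r" "0 < r'" and w: "0 \<le> w" "2 * w \<le> r"
    and s: "\<bar>s\<bar> \<le> r * w" and lip: "\<bar>r' - r\<bar> \<le> w" and eq: "r'\<^sup>2 = r\<^sup>2 + 2 * s + w\<^sup>2" and a: "0 \<le> a"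
  shows "\<bar>(a * r' + ln r') - (a * r + ln r) - (a + 1 / r) * s / r
      - ((a / r + 1 / r\<^sup>2) * w\<^sup>2 - (a / r + 2 / r\<^sup>2) * (s / r)\<^sup>2) / 2\<bar> \<le> 4 * (a + 1 / r) * w ^ 3 / r\<^sup>2"
proof -
  define t where "t = (r' - r) / r"
  define sg where "sg = s / r\<^sup>2"
  define tau where "tau = w / r"
  have r': "r' = r * (1 + t)" using r by (simp add: t_def field_simps)
  have s': "s = sg * r\<^sup>2" and w': "w = tau * r" using r by (simp_all add: sg_def tau_def)
  have tau: "0 \<le> tau" "tau \<le> 1/2" using w r by (auto simp: tau_def field_simps)
  have t: "\<bar>t\<bar> \<le> tau" using lip r by (simp add: t_def tau_def divide_right_mono)
  have sg: "\<bar>sg\<bar> \<le> tau" using s r by (simp add: sg_def tau_def power2_eq_square field_simps)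
  have "r\<^sup>2 * (1 + t)\<^sup>2 = r\<^sup>2 * (1 + 2 * sg + tau\<^sup>2)"
    using eq unfolding r' s' w' by (simp add: power2_eq_square algebra_simps)
  then have "(1 + t)\<^sup>2 = 1 + 2 * sg + tau\<^sup>2" using r by simp
  then have teq: "t = sg + tau\<^sup>2 / 2 - t\<^sup>2 / 2" by (simp add: power2_eq_square algebra_simps)
  have t2: "t\<^sup>2 \<le> tau\<^sup>2" using t by (simp add: abs_le_square_iff[symmetric] tau)
  have "\<bar>t - sg\<bar> \<le> tau\<^sup>2" using teq t2 zero_le_power2[of t] zero_le_power2[of tau] by linarith
  then have "\<bar>t - sg\<bar> * \<bar>t + sg\<bar> \<le> tau\<^sup>2 * (2 * tau)" using t sg by (intro mult_mono) auto
  moreover have "\<bar>t\<^sup>2 - sg\<^sup>2\<bar> = \<bar>t - sg\<bar> * \<bar>t + sg\<bar>"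
    by (simp add: power2_eq_square algebra_simps flip: abs_mult)
  ultimately have sq: "\<bar>t\<^sup>2 - sg\<^sup>2\<bar> \<le> 2 * tau ^ 3" by (simp add: power2_eq_square power3_eq_cube)
  have t3: "\<bar>t\<bar> ^ 3 \<le> tau ^ 3" using t by (intro power_mono) auto
  have R: "\<bar>t - (sg + tau\<^sup>2 / 2 - sg\<^sup>2 / 2)\<bar> \<le> tau ^ 3" using teq sq by linarith
  have "\<bar>ln (1 + t) - t + t\<^sup>2 / 2\<bar> \<le> 2 * \<bar>t\<bar> ^ 3" using t tau by (intro ln_taylor2) linarith
  \<comment> \<open>The logarithm contributes a second - sg^2 / 2. This is why the coefficient of
    the normal direction is 2 / r^2 against 1 / r^2 for the identity part, and why the Hessian is
    slightly negative there.\<close>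
  then have L: "\<bar>ln (1 + t) - (sg + tau\<^sup>2 / 2 - sg\<^sup>2)\<bar> \<le> 4 * tau ^ 3"
    using R sq t3 by linarith
  have ar: "0 \<le> a * r" using a r by simp
  have pos: "0 < 1 + t" using t tau by linarith
  have "(a * r' + ln r') - (a * r + ln r) - (a + 1 / r) * s / r
      - ((a / r + 1 / r\<^sup>2) * w\<^sup>2 - (a / r + 2 / r\<^sup>2) * (s / r)\<^sup>2) / 2
     = a * r * (t - (sg + tau\<^sup>2 / 2 - sg\<^sup>2 / 2)) + (ln (1 + t) - (sg + tau\<^sup>2 / 2 - sg\<^sup>2))"
  proof -
    have "ln (r * (1 + t)) = ln r + ln (1 + t)" using r pos by (simp add: ln_mult)
    then show ?thesis unfolding r' s' w' using r by (simp add: field_simps power2_eq_square)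
  qed
  also have "\<bar>\<dots>\<bar> \<le> a * r * tau ^ 3 + 4 * tau ^ 3"
    using mult_left_mono[OF R ar] L ar a r by (intro order_trans[OF abs_triangle_ineq] add_mono) (auto simp: abs_mult)
  also have "\<dots> \<le> 4 * (a * r) * tau ^ 3 + 4 * tau ^ 3"
    using ar tau by (intro add_mono mult_right_mono) auto
  also have "\<dots> = 4 * (a + 1 / r) * w ^ 3 / r\<^sup>2"
    unfolding w' using r by (simp add: field_simps power2_eq_square power3_eq_cube)
  finally show ?thesis .
qed

text \<open>The factor left by \<open>eliminate_sum\<close> for the weights cosh (b n1), cosh (b
  n2); \<open>elim_diff\<close> is the one left by \<open>eliminate_difference\<close> for the
  weights n2 sinh (b n1), n1 sinh (b n2).\<close>

definition elim_sum :: "real \<Rightarrow> real \<Rightarrow> real \<Rightarrow> real \<Rightarrow> real" where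
  "elim_sum mu b n1 n2 = ((cosh (b * n1))\<^sup>2 - (cosh (b * n2))\<^sup>2 + mu\<^sup>2)\<^sup>2 - 4 * mu\<^sup>2 * (cosh (b * n1))\<^sup>2"

definition elim_diff :: "real \<Rightarrow> real \<Rightarrow> real \<Rightarrow> real" where
  "elim_diff b n1 n2 = (n2 * sinh (b * n1))\<^sup>2 - (n1 * sinh (b * n2))\<^sup>2"

text \<open>With y = b x the derivative has the sign of y cosh y - sinh y, and sinh y = y cosh z for
  some z in (0, y) by the mean value theorem.\<close>

lemma sinh_divide_strict_mono:
  fixes p q :: real assumes "0 < p" "p < q" "0 < b"
  shows "sinh (b * p) / p < sinh (b * q) / q"
proof -
  have "\<exists>y. ((\<lambda>t. sinh (b * t) / t) has_real_derivative y) (at x) \<and> 0 < y" if "p \<le> x" "x \<le> q" for x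
  proof (intro exI conjI)
    have x: "0 < x" using that assms by simp
    show "((\<lambda>t. sinh (b * t) / t) has_real_derivative ((b * cosh (b * x)) * x - sinh (b * x)) / (x * x)) (at x)"
      using x by (auto intro!: derivative_eq_intros)
    have bx: "0 < b * x" using x assms by simp
    have "\<exists>z. 0 < z \<and> z < b * x \<and> sinh (b * x) - sinh 0 = (b * x - 0) * cosh z"
      using bx by (intro MVT2) (auto intro!: derivative_eq_intros)
    then obtain z where z: "0 < z" "z < b * x" "sinh (b * x) = b * x * cosh z" by auto
    have "cosh z < cosh (b * x)" using z by (simp add: cosh_real_nonneg_less_iff)
    then have "sinh (b * x) < (b * x) * cosh (b * x)" unfolding z(3) using bx by (rule mult_strict_left_mono)
    then show "0 < ((b * cosh (b * x)) * x - sinh (b * x)) / (x * x)" using x by (simp add: algebra_simps)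
  qed
  then show ?thesis
    using DERIV_pos_imp_increasing[OF assms(2), of "\<lambda>t. sinh (b * t) / t"] by blast
qed

text \<open>If both coordinates are nonzero, the equation says that sinh (b t) / t takes equal
  values at the two moduli, and this quotient is strictly increasing.\<close>

lemma elim_diff_zeroD:
  assumes "elim_diff b n1 n2 = 0" "0 < b"
  shows "n1 = 0 \<or> n2 = 0 \<or> \<bar>n1\<bar> = \<bar>n2\<bar>"
proof (rule ccontr)
  assume neg: "\<not> ?thesis"
  have "\<bar>n2 * sinh (b * n1)\<bar> = \<bar>n1 * sinh (b * n2)\<bar>"
    using assms(1) by (simp add: elim_diff_def power2_eq_iff abs_eq_iff)
  moreover have "\<bar>sinh (b * n)\<bar> = sinh (b * \<bar>n\<bar>)" for n
    using assms(2) by (simp add: sinh_real_abs[symmetric] abs_mult)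
  ultimately have "sinh (b * \<bar>n1\<bar>) / \<bar>n1\<bar> = sinh (b * \<bar>n2\<bar>) / \<bar>n2\<bar>"
    using neg by (simp add: abs_mult field_simps)
  moreover have "\<bar>n1\<bar> < \<bar>n2\<bar> \<or> \<bar>n2\<bar> < \<bar>n1\<bar>" using neg by auto
  ultimately show False
    using neg assms(2) sinh_divide_strict_mono[of "\<bar>n1\<bar>" "\<bar>n2\<bar>" b] sinh_divide_strict_mono[of "\<bar>n2\<bar>" "\<bar>n1\<bar>" b]
    by auto
qed

text \<open>The eliminant splits into four linear factors in the two cosh values and
  \<open>mu\<close>. The two factors containing the sum of the cosh values are positive because that
  sum is at least 2 > mu; here lambda < 4 enters.\<close>

lemma elim_sum_zeroD:
  assumes "elim_sum mu b n1 n2 = 0" "0 < mu" "mu < 2"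
  shows "\<bar>cosh (b * n1) - cosh (b * n2)\<bar> = mu"
proof -
  define p q where "p = cosh (b * n1)" and "q = cosh (b * n2)"
  have pq: "1 \<le> p" "1 \<le> q" by (auto simp: p_def q_def cosh_real_ge_1)
  have "(p - mu - q) * (p - mu + q) * ((p + mu - q) * (p + mu + q)) = elim_sum mu b n1 n2"
    by (simp add: elim_sum_def p_def[symmetric] q_def[symmetric] power2_eq_square algebra_simps)
  then have "p - mu - q = 0 \<or> p + mu - q = 0" using assms pq by auto
  then show ?thesis using assms by (auto simp: p_def[symmetric] q_def[symmetric])
qed

text \<open>At a common zero the cosh values differ by mu > 0, which excludes equal moduli, so one
  coordinate is 0 and the other satisfies cosh (b n) = 1 + mu. This contradicts cosh b < 1 + mu. At
  cosh b = 1 + mu the point (1, 0) is a common zero, so the threshold is sharp.\<close>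

lemma elim_nonzero:
  assumes mu: "0 < mu" "mu < 2" and b: "0 \<le> b" "cosh b < 1 + mu" and n: "0 < n1\<^sup>2 + n2\<^sup>2" "n1\<^sup>2 + n2\<^sup>2 \<le> 1"
  shows "elim_sum mu b n1 n2 \<noteq> 0 \<or> elim_diff b n1 n2 \<noteq> 0"
proof (rule ccontr)
  assume "\<not> ?thesis"
  then have F: "\<bar>cosh (b * n1) - cosh (b * n2)\<bar> = mu" and G: "elim_diff b n1 n2 = 0"
    using elim_sum_zeroD[OF _ mu] by auto
  have "0 < b" using F b mu by (cases "b = 0") auto
  from elim_diff_zeroD[OF G this] have "cosh (b * n1) = 1 \<or> cosh (b * n2) = 1 \<or> cosh (b * n1) = cosh (b * n2)"
  proof (elim disjE)
    assume "\<bar>n1\<bar> = \<bar>n2\<bar>"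
    then show ?thesis by (auto simp: abs_eq_iff)
  qed auto
  moreover have "cosh (b * n) < 1 + mu" if "n\<^sup>2 \<le> 1" for n
  proof -
    have "\<bar>b * n\<bar> \<le> b" using that b by (simp add: abs_mult mult_left_le abs_square_le_1)
    then show ?thesis using cosh_mono_abs[of "b * n" b] b by linarith
  qed
  then have "cosh (b * n1) < 1 + mu" "cosh (b * n2) < 1 + mu"
    using n zero_le_power2[of n1] zero_le_power2[of n2] by (smt (verit))+
  moreover have "1 \<le> cosh (b * n1)" "1 \<le> cosh (b * n2)" by (auto simp: cosh_real_ge_1)
  ultimately show False using F mu by auto
qed

text \<open>A continuous positive function on a compact set attains a positive minimum. The lower
  bound 1/4 for |n|^2 is the one provided by \<open>near_n_sq\<close>.\<close>

lemma elim_lower_bound: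
  assumes mu: "0 < mu" "mu < 2" and b1: "0 \<le> b1" "cosh b1 < 1 + mu"
  shows "\<exists>c>0. \<forall>b n1 n2. 0 \<le> b \<and> b \<le> b1 \<and> 1/4 \<le> n1\<^sup>2 + n2\<^sup>2 \<and> n1\<^sup>2 + n2\<^sup>2 \<le> 1 \<longrightarrow>
    c \<le> \<bar>elim_sum mu b n1 n2\<bar> + \<bar>elim_diff b n1 n2\<bar>"
proof -
  define K where "K = {0..b1} \<times> {n::real \<times> real. 1/4 \<le> (fst n)\<^sup>2 + (snd n)\<^sup>2 \<and> (fst n)\<^sup>2 + (snd n)\<^sup>2 \<le> 1}"
  define g where "g = (\<lambda>(b, n). \<bar>elim_sum mu b (fst n) (snd n)\<bar> + \<bar>elim_diff b (fst n) (snd n)\<bar>)"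
  have nrm: "(norm n)\<^sup>2 = (fst n)\<^sup>2 + (snd n)\<^sup>2" for n :: "real \<times> real"
    by (cases n) (simp add: norm_Pair)
  have "closed {n::real \<times> real. 1/4 \<le> (fst n)\<^sup>2 + (snd n)\<^sup>2 \<and> (fst n)\<^sup>2 + (snd n)\<^sup>2 \<le> 1}"
    by (intro closed_Collect_conj closed_Collect_le continuous_intros)
  moreover have "bounded {n::real \<times> real. 1/4 \<le> (fst n)\<^sup>2 + (snd n)\<^sup>2 \<and> (fst n)\<^sup>2 + (snd n)\<^sup>2 \<le> 1}"
    unfolding bounded_iff nrm[symmetric] by (intro exI[of _ 1]) (auto simp: abs_square_le_1)
  ultimately have "compact K"
    unfolding K_def by (intro compact_Times) (auto simp: compact_eq_bounded_closed)
  moreover have "(0, (1, 0)) \<in> K" using b1 by (simp add: K_def)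
  moreover have "continuous_on K g"
    unfolding g_def elim_sum_def elim_diff_def case_prod_beta by (intro continuous_intros)
  ultimately obtain k where k: "k \<in> K" "\<And>y. y \<in> K \<Longrightarrow> g k \<le> g y"
    using continuous_attains_inf[of K g] by blast
  obtain b n1 n2 where kk: "k = (b, (n1, n2))" by (cases k) auto
  have b: "0 \<le> b" "b \<le> b1" and n: "1/4 \<le> n1\<^sup>2 + n2\<^sup>2" "n1\<^sup>2 + n2\<^sup>2 \<le> 1" using k(1) by (auto simp: K_def kk)
  have "cosh b < 1 + mu" using cosh_mono_abs[of b b1] b b1 by simp
  then have "elim_sum mu b n1 n2 \<noteq> 0 \<or> elim_diff b n1 n2 \<noteq> 0"
    using n b by (intro elim_nonzero mu) auto
  then have "0 < g k" by (auto simp: g_def kk)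
  moreover have "g k \<le> \<bar>elim_sum mu b n1 n2\<bar> + \<bar>elim_diff b n1 n2\<bar>"
    if "0 \<le> b \<and> b \<le> b1 \<and> 1/4 \<le> n1\<^sup>2 + n2\<^sup>2 \<and> n1\<^sup>2 + n2\<^sup>2 \<le> 1" for b n1 n2
    using k(2)[of "(b, (n1, n2))"] that by (auto simp: K_def g_def)
  ultimately show ?thesis by blast
qed

section \<open>The weight on the lattice\<close>

definition index_dot :: "int \<times> int \<Rightarrow> int \<times> int \<Rightarrow> real" where
  "index_dot w w' = of_int (fst w) * of_int (fst w') + of_int (snd w) * of_int (snd w')"

lemma unit_steps_symmetric: "finite unit_steps" "e \<in> unit_steps \<Longrightarrow> - e \<in> unit_steps"
  by (auto simp: unit_steps_def)

lemma R_eq_norm: "R h x = norm (h, x)"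
  by (simp add: R_def norm_Pair)

lemma pt_add: "pt h (x + w) = pt h x + pt h w"
  by (simp add: pt_def algebra_simps)

lemma R_pos: "0 < h \<Longrightarrow> 0 < R h x"
  unfolding R_def by (intro real_sqrt_gt_zero add_pos_nonneg) auto

lemma norm_pt: "0 < h \<Longrightarrow> norm (pt h w) = h * sqrt (index_dot w w)"
  unfolding pt_def norm_scaleR norm_Pair by (simp add: index_dot_def power2_eq_square)

lemma R_lipschitz: "\<bar>R h (x + y) - R h x\<bar> \<le> norm y"
proof -
  have "\<bar>norm (h, x + y) - norm (h, x)\<bar> \<le> norm ((h, x + y) - (h, x))" by (rule norm_triangle_ineq3)
  then show ?thesis by (simp add: R_eq_norm norm_Pair)
qed

lemma R_pt_sq: "(R h (pt h x))\<^sup>2 = h\<^sup>2 + (h * of_int (fst x))\<^sup>2 + (h * of_int (snd x))\<^sup>2"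
  by (simp add: R_def pt_def norm_Pair power_mult_distrib)

text \<open>Makes later constants absolute: mu < 2 gives cosh b1 < 3 and hence b1 <= 3. The proof
  uses exp 3 >= 17/2, so cosh 3 > 3.\<close>

lemma cosh_bound_3: "cosh x < 3 \<Longrightarrow> 0 \<le> x \<Longrightarrow> x \<le> (3::real)"
proof (rule ccontr)
  assume "cosh x < 3" "0 \<le> x" "\<not> x \<le> 3"
  then have "cosh 3 < (3::real)" using cosh_real_nonneg_le_iff[of 3 x] by linarith
  moreover have "1 + 3 + 3\<^sup>2 / 2 \<le> exp (3::real)" by (rule exp_lower_Taylor_quadratic) simp
  then have "17 / 2 \<le> exp (3::real)" by simp
  moreover have "0 < exp (- 3::real)" by simp
  ultimately show False unfolding cosh_def by simp
qed

lemma sum_bilinear: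
  fixes p :: "'i \<Rightarrow> real" and z :: "'i \<Rightarrow> complex"
  shows "(\<Sum>e\<in>U. \<Sum>e'\<in>U. p e * p e' * Re (z e * cnj (z e'))) = (cmod (\<Sum>e\<in>U. of_real (p e) * z e))\<^sup>2"
proof -
  have "complex_of_real ((cmod (\<Sum>e\<in>U. of_real (p e) * z e))\<^sup>2)
      = (\<Sum>e\<in>U. of_real (p e) * z e) * (\<Sum>e\<in>U. of_real (p e) * cnj (z e))"
    unfolding complex_norm_square by simp
  also have "\<dots> = (\<Sum>e\<in>U. \<Sum>e'\<in>U. of_real (p e * p e') * (z e * cnj (z e')))"
    unfolding sum_product by (simp add: mult_ac)
  finally have "Re (complex_of_real ((cmod (\<Sum>e\<in>U. of_real (p e) * z e))\<^sup>2))
      = Re (\<Sum>e\<in>U. \<Sum>e'\<in>U. of_real (p e * p e') * (z e * cnj (z e')))" by simp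
  moreover have "Re (of_real r * w) = r * Re w" for r w by simp
  ultimately show ?thesis by (simp only: Re_sum Re_complex_of_real)
qed

text \<open>Splits a vector into its components along (p, q) and orthogonal to it; for a unit vector
  (p, q) this is an isometry.\<close>

lemma cmod_rotate:
  fixes x y :: complex and p q :: real
  shows "(cmod (of_real p * x + of_real q * y))\<^sup>2 + (cmod (of_real p * y - of_real q * x))\<^sup>2
    = (p\<^sup>2 + q\<^sup>2) * ((cmod x)\<^sup>2 + (cmod y)\<^sup>2)"
  unfolding cmod_power2 by (simp add: power2_eq_square algebra_simps)

text \<open>\<open>u\<close> will be \<open>v\<close> composed with \<open>pt h\<close>, and
  \<open>mu\<close> is lambda / 2. The number \<open>a + 4 / rho\<close> bounds the gradient length
  a + 1/R for R >= rho / 4, and \<open>b1\<close> keeps it uniformly below the critical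
  value.\<close>

locale lattice_weight =
  fixes a h rho mu b1 :: real and u :: "int \<times> int \<Rightarrow> complex"
  assumes a: "0 \<le> a" and h: "0 < h" "h \<le> 1" and rho: "100 \<le> rho" and ab: "a + 4 / rho \<le> b1"
    and mu: "0 < mu" "mu < 2" and b1: "cosh b1 < 1 + mu"
    and u: "fsupp u" and supp: "\<And>x. u x \<noteq> 0 \<Longrightarrow> rho / 2 \<le> R h (pt h x) \<and> R h (pt h x) \<le> 4 * rho"
begin

definition rad where "rad x = R h (pt h x)"

text \<open>Truncating the radius makes the coefficients slowly varying on the whole lattice,
  not only where \<open>u\<close> lives.\<close>

definition trad where "trad x = max (rad x) (rho / 4)"
text \<open>Where \<open>trad\<close> equals \<open>rad\<close>, \<open>b x\<close> times the vector
  (\<open>n1 x\<close>, \<open>n2 x\<close>) is the gradient (a + 1/R) x / R of the weight. Since R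
  contains h, this vector is slightly shorter than 1.\<close>

definition n1 where "n1 x = h * of_int (fst x) / trad x"
definition n2 where "n2 x = h * of_int (snd x) / trad x"
definition b where "b x = a + 1 / trad x"
definition kap where "kap = a + 1 / rho"
definition C1 where "C1 x = cosh (b x * n1 x)"
definition C2 where "C2 x = cosh (b x * n2 x)"
definition S1 where "S1 x = sinh (b x * n1 x)"
definition S2 where "S2 x = sinh (b x * n2 x)"
definition f where "f x = phi a h (pt h x) / h"
text \<open>Contains the support of \<open>u\<close> and its lattice neighbours, and the truncation
  of the radius is inactive there.\<close>

definition near where "near x \<longleftrightarrow> rho / 4 \<le> rad x \<and> rad x \<le> 5 * rho"

lemma kap_pos: "0 < kap" and rho_kap: "1 \<le> rho * kap"
proof -
  show "0 < kap" unfolding kap_def using a rho by (intro add_nonneg_pos) auto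
  have "rho * kap = rho * a + 1" using rho by (simp add: kap_def field_simps)
  then show "1 \<le> rho * kap" using a rho by simp
qed

lemma b1_bounds: "0 \<le> b1" "b1 \<le> 3" "cosh b1 \<le> 3"
proof -
  show 0: "0 \<le> b1" using a ab rho by (smt (verit) divide_nonneg_pos)
  show "b1 \<le> 3" "cosh b1 \<le> 3" using cosh_bound_3[of b1] 0 b1 mu by auto
qed

lemma kap_le: "kap \<le> 3"
proof -
  have "1 / rho \<le> 4 / rho" using rho by (intro divide_right_mono) auto
  then show ?thesis using ab b1_bounds unfolding kap_def by linarith
qed

lemma trad_ge: "rho / 4 \<le> trad x" and trad_pos: "0 < trad x"
  using rho by (auto simp: trad_def)

lemma inverse_trad: "1 / trad x \<le> 4 / rho" "0 < 1 / trad x"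
  using trad_ge[of x] trad_pos[of x] rho by (auto simp: field_simps)

lemma b_bounds: "0 < b x" "b x \<le> b1" "b x \<le> 4 * kap"
proof -
  show "0 < b x" unfolding b_def using a inverse_trad(2) by (rule add_nonneg_pos)
  show "b x \<le> b1" using inverse_trad[of x] ab unfolding b_def by linarith
  have "4 * kap = 4 * a + 4 / rho" by (simp add: kap_def)
  then show "b x \<le> 4 * kap" using inverse_trad[of x] a by (simp add: b_def)
qed

lemma n_sq: "(n1 x)\<^sup>2 + (n2 x)\<^sup>2 = ((rad x)\<^sup>2 - h\<^sup>2) / (trad x)\<^sup>2"
  unfolding n1_def n2_def power_divide add_divide_distrib[symmetric] rad_def R_pt_sq by simp

lemma n_sq_le: "(n1 x)\<^sup>2 + (n2 x)\<^sup>2 \<le> 1"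
proof -
  have "(rad x)\<^sup>2 \<le> (trad x)\<^sup>2"
    using R_pos[OF h(1)] by (intro power_mono) (auto simp: trad_def rad_def less_imp_le)
  then have "(rad x)\<^sup>2 - h\<^sup>2 \<le> (trad x)\<^sup>2" using zero_le_power2[of h] by linarith
  then show ?thesis unfolding n_sq using trad_pos[of x] by simp
qed

lemma n_le: "\<bar>n1 x\<bar> \<le> 1" "\<bar>n2 x\<bar> \<le> 1"
  using n_sq_le[of x] zero_le_power2[of "n1 x"] zero_le_power2[of "n2 x"]
  unfolding abs_square_le_1[symmetric] by linarith+

lemma near_trad: "near x \<Longrightarrow> trad x = rad x"
  by (auto simp: near_def trad_def)

text \<open>Here |n|^2 = 1 - h^2 / R^2 with h <= 1 and R >= 25.\<close>

lemma near_n_sq: assumes "near x" shows "1/4 \<le> (n1 x)\<^sup>2 + (n2 x)\<^sup>2"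
proof -
  have r: "25 \<le> rad x" using assms rho by (auto simp: near_def)
  then have "1 \<le> (rad x)\<^sup>2" by (simp add: one_le_power)
  moreover have "4 * h\<^sup>2 \<le> 3 * (rad x)\<^sup>2"
    using power_mono[of h 1 2] power_mono[OF r, of 2] h by simp
  moreover have "0 < (rad x)\<^sup>2" using r by simp
  ultimately show ?thesis unfolding n_sq near_trad[OF assms] by (simp add: pos_le_divide_eq)
qed

lemma near_b: assumes "near x" shows "kap / 5 \<le> b x"
proof -
  have "0 < rad x" "rad x \<le> 5 * rho" using assms rho by (auto simp: near_def)
  then have "1 / (5 * rho) \<le> 1 / rad x" by (intro divide_left_mono) auto
  moreover have "kap / 5 = a / 5 + 1 / (5 * rho)" by (simp add: kap_def add_divide_distrib)
  ultimately show ?thesis using a unfolding b_def near_trad[OF assms] by linarith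
qed

lemma bn_le: "\<bar>b x * n1 x\<bar> \<le> b x" "\<bar>b x * n2 x\<bar> \<le> b x"
  using n_le[of x] b_bounds[of x] by (auto simp: abs_mult mult_left_le)

lemma bn_le_b1: "\<bar>b x * n1 x\<bar> \<le> b1" "\<bar>b x * n2 x\<bar> \<le> b1"
  using bn_le[of x] b_bounds[of x] by linarith+

lemma C_bounds: "1 \<le> C1 x" "1 \<le> C2 x" "C1 x \<le> 3" "C2 x \<le> 3"
  using cosh_mono_abs[OF bn_le_b1(1)[of x]] cosh_mono_abs[OF bn_le_b1(2)[of x]] b1_bounds
  by (auto simp: C1_def C2_def cosh_real_ge_1)

lemma S_bounds: "\<bar>S1 x\<bar> \<le> 3 * b x" "\<bar>S2 x\<bar> \<le> 3 * b x"
proof -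
  have "cosh b1 * \<bar>y\<bar> \<le> 3 * b x" if "\<bar>y\<bar> \<le> b x" for y
    using that b1_bounds b_bounds[of x] by (intro mult_mono) auto
  then show "\<bar>S1 x\<bar> \<le> 3 * b x" "\<bar>S2 x\<bar> \<le> 3 * b x"
    using abs_sinh_le[OF bn_le_b1(1)[of x]] abs_sinh_le[OF bn_le_b1(2)[of x]] bn_le[of x]
    unfolding S1_def S2_def by (meson order_trans)+
qed

lemma S_le_3: "\<bar>S1 x\<bar> \<le> 3" "\<bar>S2 x\<bar> \<le> 3"
  using abs_sinh_mono_abs[OF bn_le_b1(1)[of x]] abs_sinh_mono_abs[OF bn_le_b1(2)[of x]] b1_bounds
  by (auto simp: S1_def S2_def)

lemma rad_step: "index_dot w w \<le> q\<^sup>2 \<Longrightarrow> 0 \<le> q \<Longrightarrow> \<bar>rad (x + w) - rad x\<bar> \<le> h * q"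
proof -
  assume "index_dot w w \<le> q\<^sup>2" "0 \<le> q"
  then have "sqrt (index_dot w w) \<le> q" by (simp add: real_le_lsqrt)
  then have "h * sqrt (index_dot w w) \<le> h * q" using h by (intro mult_left_mono) auto
  then show ?thesis
    using R_lipschitz[of h "pt h x" "pt h w"] norm_pt[OF h(1), of w] by (simp add: rad_def pt_add)
qed

lemma near_neighbour:
  assumes "u (x + e) \<noteq> 0" "e \<in> unit_steps" shows "near x"
proof -
  have "\<bar>rad (x + e) - rad x\<bar> \<le> h * 1"
    using assms(2) by (intro rad_step) (auto simp: unit_steps_def index_dot_def)
  then show ?thesis using supp[OF assms(1)] h rho unfolding near_def rad_def[symmetric] by linarith
qed

lemma near_support: "u x \<noteq> 0 \<Longrightarrow> near x"
  using supp[of x] rho by (auto simp: near_def rad_def)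

text \<open>100 covers the increments found below: 75 for the hyperbolic functions and 75 + 24 for
  their products with n1 or n2.\<close>

definition "eps = 100 * (h / rho)"

text \<open>In units of h / rho, one step changes n by 8 and b by 1, hence b n by 3 * 8 + 1 = 25;
  cosh and sinh have slope at most 3 on the range. The truncated radius makes this valid on the
  whole lattice.\<close>

lemma slow_variation:
  assumes e: "e = (1, 0) \<or> e = (0, 1)"
  shows "\<bar>C1 (x + e) - C1 x\<bar> \<le> eps" "\<bar>C2 (x + e) - C2 x\<bar> \<le> eps"
    "\<bar>n2 (x + e) * S1 (x + e) - n2 x * S1 x\<bar> \<le> eps" "\<bar>n1 (x + e) * S2 (x + e) - n1 x * S2 x\<bar> \<le> eps"
proof -
  let ?y = "x + e"
  have hr: "0 < h / rho" using h rho by simp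
  have r: "\<bar>trad ?y - trad x\<bar> \<le> h"
    using rad_step[of e 1 x] e by (auto simp: index_dot_def trad_def max_def)
  have key: "\<bar>p / trad ?y - q / trad x\<bar> \<le> 8 * (h / rho)" if "\<bar>p - q\<bar> \<le> h" "\<bar>q / trad x\<bar> \<le> 1" for p q
  proof -
    have "p / trad ?y - q / trad x = ((p - q) + (q / trad x) * (trad x - trad ?y)) / trad ?y"
      using trad_pos[of x] trad_pos[of ?y] by (simp add: field_simps)
    also have "\<bar>\<dots>\<bar> \<le> (h + 1 * h) / trad ?y"
    proof -
      have "\<bar>q / trad x\<bar> * \<bar>trad x - trad ?y\<bar> \<le> 1 * h"
        using that r by (intro mult_mono) auto
      then have "\<bar>(p - q) + (q / trad x) * (trad x - trad ?y)\<bar> \<le> h + 1 * h"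
        using that by (intro order_trans[OF abs_triangle_ineq] add_mono) (simp_all only: abs_mult)
      then show ?thesis
        unfolding abs_divide[of _ "trad ?y"] abs_of_pos[OF trad_pos]
        by (intro divide_right_mono less_imp_le[OF trad_pos])
    qed
    also have "\<dots> = 2 * h * (1 / trad ?y)" by simp
    also have "\<dots> \<le> 2 * h * (4 / rho)" using inverse_trad[of ?y] h by (intro mult_left_mono) auto
    finally show ?thesis by simp
  qed
  have n: "\<bar>n1 ?y - n1 x\<bar> \<le> 8 * (h / rho)" "\<bar>n2 ?y - n2 x\<bar> \<le> 8 * (h / rho)"
  proof -
    have "\<bar>h * of_int (fst ?y) - h * of_int (fst x)\<bar> \<le> h" "\<bar>h * of_int (snd ?y) - h * of_int (snd x)\<bar> \<le> h"
      using e h by (auto simp: algebra_simps)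
    from key[OF this(1) n_le(1)[of x, unfolded n1_def]] key[OF this(2) n_le(2)[of x, unfolded n2_def]]
    show "\<bar>n1 ?y - n1 x\<bar> \<le> 8 * (h / rho)" "\<bar>n2 ?y - n2 x\<bar> \<le> 8 * (h / rho)"
      by (simp_all only: n1_def n2_def)
  qed
  have bb: "\<bar>b ?y - b x\<bar> \<le> h / rho"
  proof -
    have "b ?y - b x = (trad x - trad ?y) * (1 / trad x) * (1 / trad ?y)"
      using trad_pos[of x] trad_pos[of ?y] by (simp add: b_def field_simps)
    also have "\<bar>\<dots>\<bar> \<le> h * (4 / rho) * (4 / rho)"
      using r inverse_trad[of x] inverse_trad[of ?y] h rho unfolding abs_mult
      by (intro mult_mono) auto
    also have "\<dots> = (h / rho) * (16 / rho)" by simp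
    also have "\<dots> \<le> (h / rho) * 1" using h rho by (intro mult_left_mono) auto
    finally show ?thesis by simp
  qed
  have bn: "\<bar>b ?y * p - b x * q\<bar> \<le> 25 * (h / rho)" if "\<bar>p - q\<bar> \<le> 8 * (h / rho)" "\<bar>q\<bar> \<le> 1" for p q
  proof -
    have "b ?y * p - b x * q = b ?y * (p - q) + (b ?y - b x) * q" by (simp add: algebra_simps)
    also have "\<bar>\<dots>\<bar> \<le> 3 * (8 * (h / rho)) + (h / rho) * 1"
    proof (rule order_trans[OF abs_triangle_ineq add_mono])
      show "\<bar>b ?y * (p - q)\<bar> \<le> 3 * (8 * (h / rho))"
        using that(1) b_bounds[of ?y] b1_bounds unfolding abs_mult by (intro mult_mono) linarith+
      show "\<bar>(b ?y - b x) * q\<bar> \<le> (h / rho) * 1"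
        using that(2) bb hr unfolding abs_mult by (intro mult_mono) linarith+
    qed
    finally show ?thesis by simp
  qed
  note B = bn[OF n(1) n_le(1)] bn[OF n(2) n_le(2)]
  have lip: "cosh b1 * \<bar>t\<bar> \<le> 75 * (h / rho)" if "\<bar>t\<bar> \<le> 25 * (h / rho)" for t
    using mult_mono[OF b1_bounds(3) that] by simp
  have "\<bar>C1 ?y - C1 x\<bar> \<le> 75 * (h / rho)" "\<bar>C2 ?y - C2 x\<bar> \<le> 75 * (h / rho)"
    unfolding C1_def C2_def
    by (rule order_trans[OF cosh_lipschitz[OF bn_le_b1(1) bn_le_b1(1)] lip[OF B(1)]],
        rule order_trans[OF cosh_lipschitz[OF bn_le_b1(2) bn_le_b1(2)] lip[OF B(2)]])
  then show "\<bar>C1 ?y - C1 x\<bar> \<le> eps" "\<bar>C2 ?y - C2 x\<bar> \<le> eps"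
    using hr unfolding eps_def by linarith+
  have S: "\<bar>S1 ?y - S1 x\<bar> \<le> 75 * (h / rho)" "\<bar>S2 ?y - S2 x\<bar> \<le> 75 * (h / rho)"
    unfolding S1_def S2_def
    by (rule order_trans[OF sinh_lipschitz[OF bn_le_b1(1) bn_le_b1(1)] lip[OF B(1)]],
        rule order_trans[OF sinh_lipschitz[OF bn_le_b1(2) bn_le_b1(2)] lip[OF B(2)]])
  have prod: "\<bar>p' * s' - p * s\<bar> \<le> eps"
    if "\<bar>p' - p\<bar> \<le> 8 * (h / rho)" "\<bar>s' - s\<bar> \<le> 75 * (h / rho)" "\<bar>p'\<bar> \<le> 1" "\<bar>s\<bar> \<le> 3" for p p' s s'
  proof -
    have "p' * s' - p * s = p' * (s' - s) + (p' - p) * s" by (simp add: algebra_simps)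
    also have "\<bar>\<dots>\<bar> \<le> 1 * (75 * (h / rho)) + (8 * (h / rho)) * 3"
      using that hr by (intro order_trans[OF abs_triangle_ineq] add_mono) (auto simp only: abs_mult intro!: mult_mono)
    finally show ?thesis using hr unfolding eps_def by linarith
  qed
  show "\<bar>n2 ?y * S1 ?y - n2 x * S1 x\<bar> \<le> eps" "\<bar>n1 ?y * S2 ?y - n1 x * S2 x\<bar> \<le> eps"
    by (intro prod n S n_le S_le_3)+
qed

end

section \<open>Second-order expansion of the weight and the commutator form\<close>

context lattice_weight
begin

definition n_dot where "n_dot x w = n1 x * of_int (fst w) + n2 x * of_int (snd w)"

text \<open>On \<open>near\<close> this is the Hessian of a R + log R as a bilinear form: a/R +
  1/R^2 on tangential vectors and, up to the defect of |n| from 1, -1/R^2 in the normal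
  direction.\<close>

definition hess where
  "hess x w w' = (a / rad x + 1 / (rad x)\<^sup>2) * index_dot w w' - (a / rad x + 2 / (rad x)\<^sup>2) * (n_dot x w * n_dot x w')"

lemma near_rad: assumes "near x" shows "0 < rad x" "1 / rad x \<le> 4 / rho" "1 / (5 * rho) \<le> 1 / rad x"
    "1 / (rad x)\<^sup>2 \<le> 16 / rho\<^sup>2"
proof -
  show pos: "0 < rad x" using assms rho by (auto simp: near_def)
  show inv: "1 / rad x \<le> 4 / rho" using inverse_trad(1)[of x] near_trad[OF assms] by simp
  show "1 / (5 * rho) \<le> 1 / rad x"
    using assms pos rho by (intro divide_left_mono) (auto simp: near_def)
  show "1 / (rad x)\<^sup>2 \<le> 16 / rho\<^sup>2"
    using power_mono[OF inv, of 2] pos by (simp add: power_divide)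
qed

text \<open>\<open>radial_taylor\<close> for the displacement h w, divided by h. Length up to 2 is
  allowed so that w may be a sum of two unit steps.\<close>

lemma taylor_f:
  assumes x: "near x" and w: "index_dot w w \<le> 4"
  shows "\<bar>f (x + w) - f x - b x * n_dot x w - h / 2 * hess x w w\<bar> \<le> 2048 * (h\<^sup>2 * kap / rho\<^sup>2)"
proof -
  define q where "q = sqrt (index_dot w w)"
  have q: "0 \<le> q" "q \<le> 2" "q\<^sup>2 = index_dot w w"
    using w real_sqrt_le_mono[OF w] by (auto simp: q_def index_dot_def)
  define s where "s = h\<^sup>2 * index_dot x w"
  have r: "0 < rad x" "0 < rad (x + w)" using R_pos[OF h(1)] by (auto simp: rad_def)
  have s: "s / rad x = h * n_dot x w"
    using near_trad[OF x] by (simp add: s_def n_dot_def n1_def n2_def index_dot_def power2_eq_square add_divide_distrib algebra_simps)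
  have nd: "\<bar>n_dot x w\<bar> \<le> q"
  proof -
    have "(n_dot x w)\<^sup>2 \<le> ((n1 x)\<^sup>2 + (n2 x)\<^sup>2) * index_dot w w"
      using zero_le_power2[of "n1 x * of_int (snd w) - n2 x * of_int (fst w)"]
      by (simp add: n_dot_def index_dot_def power2_eq_square algebra_simps)
    also have "\<dots> \<le> 1 * index_dot w w"
      using n_sq_le[of x] by (intro mult_right_mono) (auto simp: index_dot_def)
    finally have "(n_dot x w)\<^sup>2 \<le> q\<^sup>2" using q by simp
    then show ?thesis using q(1) abs_le_square_iff[of "n_dot x w" q] by simp
  qed
  have sle: "\<bar>s\<bar> \<le> rad x * (h * q)"
  proof -
    have "\<bar>s\<bar> = rad x * (h * \<bar>n_dot x w\<bar>)" using s r h by (simp add: field_simps abs_mult)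
    then show ?thesis using nd h r by (simp add: mult_left_mono)
  qed
  have step: "\<bar>rad (x + w) - rad x\<bar> \<le> h * q" using q by (intro rad_step) auto
  have eq: "(rad (x + w))\<^sup>2 = (rad x)\<^sup>2 + 2 * s + (h * q)\<^sup>2"
    unfolding rad_def R_pt_sq power_mult_distrib q(3) s_def index_dot_def
    by (simp add: power2_eq_square algebra_simps)
  have small: "2 * (h * q) \<le> rad x"
  proof -
    have "h * q \<le> 1 * 2" using h q by (intro mult_mono) auto
    then show ?thesis using x rho by (auto simp: near_def)
  qed
  have bb: "a + 1 / rad x = b x" using near_trad[OF x] by (simp add: b_def)
  have phi: "phi a h (pt h y) = a * rad y + ln (rad y)" for y by (simp add: phi_def rad_def)
  have "\<bar>phi a h (pt h (x + w)) - phi a h (pt h x) - b x * (h * n_dot x w)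
      - ((a / rad x + 1 / (rad x)\<^sup>2) * (h * q)\<^sup>2 - (a / rad x + 2 / (rad x)\<^sup>2) * (h * n_dot x w)\<^sup>2) / 2\<bar>
      \<le> 4 * b x * (h * q) ^ 3 / (rad x)\<^sup>2"
    using radial_taylor[OF r _ small sle step eq a] h q unfolding phi s[symmetric] bb by simp
  also have "\<dots> = 4 * b x * (h * q) ^ 3 * (1 / (rad x)\<^sup>2)" by simp
  \<comment> \<open>Uses b <= 4 kap, |w| <= 2 and 1/R^2 <= 16/rho^2, so 2048 = 16 * 8 * 16.\<close>
  also have "\<dots> \<le> 4 * (4 * kap) * (h * 2) ^ 3 * (16 / rho\<^sup>2)"
    using b_bounds[of x] near_rad[OF x] h q kap_pos by (intro mult_mono power_mono) auto
  also have "\<dots> = h * (2048 * (h\<^sup>2 * kap / rho\<^sup>2))" by (simp add: power3_eq_cube power2_eq_square)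
  also have "phi a h (pt h (x + w)) - phi a h (pt h x) - b x * (h * n_dot x w)
      - ((a / rad x + 1 / (rad x)\<^sup>2) * (h * q)\<^sup>2 - (a / rad x + 2 / (rad x)\<^sup>2) * (h * n_dot x w)\<^sup>2) / 2
      = h * (f (x + w) - f x - b x * n_dot x w - h / 2 * hess x w w)"
    using h unfolding f_def hess_def q(3)[symmetric] by (simp add: field_simps power2_eq_square)
  finally have "h * \<bar>f (x + w) - f x - b x * n_dot x w - h / 2 * hess x w w\<bar> \<le> h * (2048 * (h\<^sup>2 * kap / rho\<^sup>2))"
    by (simp only: abs_mult abs_of_pos[OF h(1)])
  then show ?thesis using h(1) by (rule mult_left_le_imp_le)
qed

lemma hess_bound:
  assumes x: "near x" and e: "e \<in> unit_steps" "e' \<in> unit_steps"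
  shows "\<bar>hess x e e'\<bar> \<le> 48 * (kap / rho)"
proof -
  have r: "0 < rad x" by (rule near_rad[OF x])
  have "\<bar>n_dot x e\<bar> \<le> 1" if "e \<in> unit_steps" for e
    using that n_le[of x] by (auto simp: unit_steps_def n_dot_def)
  then have nn: "\<bar>n_dot x e * n_dot x e'\<bar> \<le> 1"
    using e by (simp add: abs_mult mult_le_one)
  have ee: "\<bar>index_dot e e'\<bar> \<le> 1" using e by (auto simp: unit_steps_def index_dot_def)
  have k: "0 \<le> a / rad x + 1 / (rad x)\<^sup>2" "0 \<le> a / rad x + 2 / (rad x)\<^sup>2"
    using a r by auto
  have "\<bar>hess x e e'\<bar> \<le> (a / rad x + 1 / (rad x)\<^sup>2) * 1 + (a / rad x + 2 / (rad x)\<^sup>2) * 1"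
    unfolding hess_def using nn ee k
    by (intro order_trans[OF abs_triangle_ineq4] add_mono) (auto simp only: abs_mult abs_of_nonneg intro!: mult_left_mono)
  also have "\<dots> \<le> 3 * (b x * (1 / rad x))"
    using a r unfolding b_def near_trad[OF x] by (simp add: field_simps power2_eq_square)
  also have "\<dots> \<le> 3 * ((4 * kap) * (4 / rho))"
    using b_bounds[of x] near_rad[OF x] kap_pos by (intro mult_left_mono mult_mono) auto
  finally show ?thesis by simp
qed

text \<open>The order of h times the Hessian. It measures both the gain from the commutator and the
  error of linearising \<open>f\<close>; the errors in the commutator kernel are smaller by a
  further factor h / rho.\<close>

definition "omega = h * kap / rho"

lemma omega_bounds: "0 \<le> omega" "omega \<le> 3 / 100" "omega \<le> 3 * (h / rho)" "h\<^sup>2 * kap / rho\<^sup>2 = (h / rho) * omega"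
    "(h / rho) * omega \<le> omega / 100"
proof -
  show 0: "0 \<le> omega" using h kap_pos rho by (simp add: omega_def)
  have hr: "0 \<le> h / rho" "h / rho \<le> 1 / 100" using h rho by (auto simp: field_simps)
  have "omega = (h / rho) * kap" by (simp add: omega_def)
  also have "\<dots> \<le> (h / rho) * 3" using kap_le hr by (intro mult_left_mono) auto
  finally show 1: "omega \<le> 3 * (h / rho)" by (simp only: mult.commute)
  then show "omega \<le> 3 / 100" using hr by simp
  show "h\<^sup>2 * kap / rho\<^sup>2 = (h / rho) * omega" by (simp add: omega_def power2_eq_square)
  show "(h / rho) * omega \<le> omega / 100" using mult_right_mono[OF hr(2) 0] by simp
qed

lemma d_estimate:
  assumes x: "near x" and e: "e \<in> unit_steps"
  shows "\<bar>f (x + e) - f x - b x * n_dot x e\<bar> \<le> 50 * omega" "\<bar>b x * n_dot x e\<bar> \<le> 3"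
proof -
  have "index_dot e e \<le> 4" using e by (auto simp: unit_steps_def index_dot_def)
  from taylor_f[OF x this] have t: "\<bar>f (x + e) - f x - b x * n_dot x e - h / 2 * hess x e e\<bar> \<le> 2048 * ((h / rho) * omega)"
    unfolding omega_bounds(4) .
  have "h / 2 * \<bar>hess x e e\<bar> \<le> h / 2 * (48 * (kap / rho))"
    using h by (intro mult_left_mono hess_bound x e) auto
  then have "\<bar>h / 2 * hess x e e\<bar> \<le> 24 * omega" using h by (simp add: omega_def abs_mult)
  then show "\<bar>f (x + e) - f x - b x * n_dot x e\<bar> \<le> 50 * omega"
    using t omega_bounds(5,1) by linarith
  have "n_dot x e \<in> {n1 x, - n1 x, n2 x, - n2 x}" using e by (auto simp: unit_steps_def n_dot_def)
  then show "\<bar>b x * n_dot x e\<bar> \<le> 3" using bn_le_b1[of x] b1_bounds by auto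
qed

text \<open>With A = d_e + d_e' the kernel is sinh (A + y) - sinh A, where y is a mixed second
  difference of \<open>f\<close>. It is y cosh A to leading order; then y is replaced by its Hessian
  term and A by its linear part.\<close>

lemma kernel_estimate:
  assumes x: "near x" and e: "e \<in> unit_steps" "e' \<in> unit_steps"
  shows "\<bar>sinh (f (x + e + e') - f x) - sinh ((f (x + e) - f x) + (f (x + e') - f x))
      - h * hess x e e' * cosh (b x * n_dot x e + b x * n_dot x e')\<bar> \<le> 60000 * cosh 13 * ((h / rho) * omega)"
proof -
  define A where "A = (f (x + e) - f x) + (f (x + e') - f x)"
  define A0 where "A0 = b x * n_dot x e + b x * n_dot x e'"
  define y where "y = f (x + e + e') - f x - A"
  let ?t = "(h / rho) * omega"
  have q: "index_dot e e \<le> 4" "index_dot e' e' \<le> 4" "index_dot (e + e') (e + e') \<le> 4"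
    using e by (auto simp: unit_steps_def index_dot_def)
  note T = taylor_f[OF x q(1), unfolded omega_bounds(4)] taylor_f[OF x q(2), unfolded omega_bounds(4)]
    taylor_f[OF x q(3), unfolded omega_bounds(4)]
  have nd: "n_dot x (e + e') = n_dot x e + n_dot x e'" by (simp add: n_dot_def algebra_simps)
  have idx: "index_dot (e + e') (e + e') = index_dot e e + index_dot e' e' + 2 * index_dot e e'"
    by (simp add: index_dot_def algebra_simps)
  \<comment> \<open>Polarisation: in y the pure terms in e and e' cancel and only the mixed Hessian
    entry survives.\<close>
  have hs: "hess x (e + e') (e + e') = hess x e e + hess x e' e' + 2 * hess x e e'"
    unfolding hess_def nd idx by (simp add: algebra_simps)
  have hh: "h / 2 * hess x (e + e') (e + e') = h / 2 * hess x e e + h / 2 * hess x e' e' + h * hess x e e'"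
    unfolding hs by (simp add: algebra_simps)
  have bn: "b x * n_dot x (e + e') = b x * n_dot x e + b x * n_dot x e'"
    unfolding nd by (simp add: algebra_simps)
  have y: "\<bar>y - h * hess x e e'\<bar> \<le> 6144 * ?t"
    using T unfolding hh bn y_def A_def add.assoc[symmetric] by linarith
  have H: "\<bar>h * hess x e e'\<bar> \<le> 48 * omega"
  proof -
    have "h * \<bar>hess x e e'\<bar> \<le> h * (48 * (kap / rho))"
      using h by (intro mult_left_mono hess_bound x e) auto
    moreover have "h * (48 * (kap / rho)) = 48 * omega" by (simp add: omega_def)
    ultimately show ?thesis by (simp only: abs_mult abs_of_pos[OF h(1)])
  qed
  have A: "\<bar>A - A0\<bar> \<le> 100 * omega" "\<bar>A0\<bar> \<le> 6"
    using d_estimate[OF x e(1)] d_estimate[OF x e(2)] unfolding A_def A0_def by linarith+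
  have y1: "\<bar>y\<bar> \<le> 110 * omega" using y H omega_bounds(5,1) by linarith
  \<comment> \<open>As omega <= 3/100, A is at most 6 + 3 in modulus and A + y at most 3.3
    more.\<close>
  have A13: "\<bar>A\<bar> \<le> 13" "\<bar>A + y\<bar> \<le> 13" "\<bar>A0\<bar> \<le> 13" using A y1 omega_bounds(2) by linarith+
  have om2: "omega * omega \<le> 3 * ?t"
    using mult_right_mono[OF omega_bounds(3,1)] by simp
  have y2: "y\<^sup>2 \<le> 36300 * ?t"
  proof -
    have "y\<^sup>2 \<le> (110 * omega)\<^sup>2" using y1 power_mono[of "\<bar>y\<bar>" "110 * omega" 2] by simp
    then show ?thesis using om2 by (simp add: power2_eq_square)
  qed
  have "\<bar>sinh (A + y) - sinh A - y * cosh A\<bar> \<le> cosh 13 * y\<^sup>2"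
    by (rule sinh_taylor2[OF A13(1,2)])
  also have "\<dots> \<le> cosh 13 * (36300 * ?t)" using y2 by (intro mult_left_mono) auto
  finally have 1: "\<bar>sinh (A + y) - sinh A - y * cosh A\<bar> \<le> cosh 13 * (36300 * ?t)" .
  have "\<bar>(y - h * hess x e e') * cosh A\<bar> \<le> (6144 * ?t) * cosh 13"
    using y cosh_mono_abs[OF A13(1)] unfolding abs_mult by (intro mult_mono) auto
  then have 2: "\<bar>(y - h * hess x e e') * cosh A\<bar> \<le> cosh 13 * (6144 * ?t)" by (simp add: mult.commute)
  have "\<bar>cosh A - cosh A0\<bar> \<le> cosh 13 * (100 * omega)"
    by (rule order_trans[OF cosh_lipschitz[OF A13(1,3)]]) (use A(1) in \<open>auto intro: mult_left_mono\<close>)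
  then have "\<bar>h * hess x e e' * (cosh A - cosh A0)\<bar> \<le> (48 * omega) * (cosh 13 * (100 * omega))"
    using H omega_bounds(1) unfolding abs_mult[of "h * hess x e e'"] by (intro mult_mono) auto
  also have "\<dots> = cosh 13 * (4800 * (omega * omega))" by simp
  also have "\<dots> \<le> cosh 13 * (4800 * (3 * ?t))" using om2 by (intro mult_left_mono) auto
  finally have 3: "\<bar>h * hess x e e' * (cosh A - cosh A0)\<bar> \<le> cosh 13 * (14400 * ?t)" by simp
  have "sinh (f (x + e + e') - f x) = sinh (A + y)" by (simp add: y_def)
  then have "sinh (f (x + e + e') - f x) - sinh A - h * hess x e e' * cosh A0
      = (sinh (A + y) - sinh A - y * cosh A) + (y - h * hess x e e') * cosh A + h * hess x e e' * (cosh A - cosh A0)"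
    by (simp add: algebra_simps)
  \<comment> \<open>36300 + 6144 + 14400 = 56844.\<close>
  then have "\<bar>sinh (f (x + e + e') - f x) - sinh A - h * hess x e e' * cosh A0\<bar> \<le> cosh 13 * (56844 * ?t)"
    using 1 2 3 by linarith
  also have "\<dots> \<le> cosh 13 * (60000 * ?t)"
    using omega_bounds(1) h rho by (intro mult_left_mono mult_right_mono) auto
  finally show ?thesis by (simp only: A_def A0_def mult_ac)
qed

abbreviation "D1 \<equiv> dif (1, 0) u"
abbreviation "D2 \<equiv> dif (0, 1) u"
abbreviation "M1 \<equiv> avg (1, 0) u"
abbreviation "M2 \<equiv> avg (0, 1) u"

text \<open>Tangential (t) and normal (n) components, relative to (\<open>n1 x\<close>,
  \<open>n2 x\<close>), of the vector of weighted differences (D) and of the vector of weighted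
  means (M).\<close>

definition Dt where "Dt x = of_real (n1 x * C2 x) * D2 x - of_real (n2 x * C1 x) * D1 x"
definition Dn where "Dn x = of_real (n1 x * C1 x) * D1 x + of_real (n2 x * C2 x) * D2 x"
definition Mt where "Mt x = of_real (n1 x * S2 x) * M2 x - of_real (n2 x * S1 x) * M1 x"
definition Mn where "Mn x = of_real (n1 x * S1 x) * M1 x + of_real (n2 x * S2 x) * M2 x"

text \<open>The addition formula for cosh splits the kernel into rank-one pieces, each a squared
  modulus by \<open>sum_bilinear\<close>. A coordinate of e times cosh is odd in e and yields
  differences; times sinh it is even and yields averages.\<close>

lemma hess_form:
  "(\<Sum>e\<in>unit_steps. \<Sum>e'\<in>unit_steps. hess x e e' * cosh (b x * n_dot x e + b x * n_dot x e') * corr u e e' x)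
    = 4 * ((a / rad x + 1 / (rad x)\<^sup>2)
          * ((cmod (C1 x * D1 x))\<^sup>2 + (cmod (C2 x * D2 x))\<^sup>2 + (cmod (S1 x * M1 x))\<^sup>2 + (cmod (S2 x * M2 x))\<^sup>2)
        - (a / rad x + 2 / (rad x)\<^sup>2) * ((cmod (Dn x))\<^sup>2 + (cmod (Mn x))\<^sup>2))"
proof -
  let ?c = "\<lambda>e. cosh (b x * n_dot x e)" and ?s = "\<lambda>e. sinh (b x * n_dot x e)"
  let ?f = "\<lambda>e. real_of_int (fst e)" and ?g = "\<lambda>e. real_of_int (snd e)"
  let ?k1 = "a / rad x + 1 / (rad x)\<^sup>2" and ?k2 = "a / rad x + 2 / (rad x)\<^sup>2"
  let ?B = "\<lambda>p. \<Sum>e\<in>unit_steps. \<Sum>e'\<in>unit_steps. p e * p e' * Re (u (x + e) * cnj (u (x + e')))"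
  have "hess x e e' * cosh (b x * n_dot x e + b x * n_dot x e') * corr u e e' x =
      ?k1 * ((?f e * ?c e) * (?f e' * ?c e') * corr u e e' x + (?g e * ?c e) * (?g e' * ?c e') * corr u e e' x
         + (?f e * ?s e) * (?f e' * ?s e') * corr u e e' x + (?g e * ?s e) * (?g e' * ?s e') * corr u e e' x)
      - ?k2 * ((n_dot x e * ?c e) * (n_dot x e' * ?c e') * corr u e e' x + (n_dot x e * ?s e) * (n_dot x e' * ?s e') * corr u e e' x)" for e e'
    unfolding hess_def index_dot_def cosh_add by (simp add: algebra_simps)
  then have "(\<Sum>e\<in>unit_steps. \<Sum>e'\<in>unit_steps. hess x e e' * cosh (b x * n_dot x e + b x * n_dot x e') * corr u e e' x)
      = ?k1 * (?B (\<lambda>e. ?f e * ?c e) + ?B (\<lambda>e. ?g e * ?c e) + ?B (\<lambda>e. ?f e * ?s e) + ?B (\<lambda>e. ?g e * ?s e))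
        - ?k2 * (?B (\<lambda>e. n_dot x e * ?c e) + ?B (\<lambda>e. n_dot x e * ?s e))"
    by (simp only: corr_def sum_subtractf sum.distrib sum_distrib_left[symmetric])
  moreover have minus: "x - (1, 0) = x + (- 1, 0)" "x - (0, 1) = x + (0, - 1)"
    by (cases x; simp)+
  have "(\<Sum>e\<in>unit_steps. of_real (?f e * ?c e) * u (x + e)) = 2 * (C1 x * D1 x)"
    "(\<Sum>e\<in>unit_steps. of_real (?g e * ?c e) * u (x + e)) = 2 * (C2 x * D2 x)"
    "(\<Sum>e\<in>unit_steps. of_real (?f e * ?s e) * u (x + e)) = 2 * (S1 x * M1 x)"
    "(\<Sum>e\<in>unit_steps. of_real (?g e * ?s e) * u (x + e)) = 2 * (S2 x * M2 x)"
    "(\<Sum>e\<in>unit_steps. of_real (n_dot x e * ?c e) * u (x + e)) = 2 * Dn x"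
    "(\<Sum>e\<in>unit_steps. of_real (n_dot x e * ?s e) * u (x + e)) = 2 * Mn x"
    unfolding unit_steps_def
    by (simp_all add: n_dot_def Dn_def Mn_def C1_def C2_def S1_def S2_def dif_def avg_def
        minus field_simps)
  ultimately show ?thesis
    unfolding sum_bilinear by (simp add: norm_mult power_mult_distrib algebra_simps)
qed

text \<open>After rotation the tangential parts carry k1 = a/R + 1/R^2 and the normal parts k1 minus
  (a/R + 2/R^2), that is -1/R^2. As |n| <= 1 the rotation only loses, and k1 = b/R with b >= kap/5,
  R <= 5 rho.\<close>

lemma hess_form_lower:
  assumes "near x"
  shows "(4 / 25) * (kap / rho) * ((cmod (Dt x))\<^sup>2 + (cmod (Mt x))\<^sup>2) - 64 / rho\<^sup>2 * ((cmod (Dn x))\<^sup>2 + (cmod (Mn x))\<^sup>2)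
    \<le> (\<Sum>e\<in>unit_steps. \<Sum>e'\<in>unit_steps. hess x e e' * cosh (b x * n_dot x e + b x * n_dot x e') * corr u e e' x)"
proof -
  let ?k1 = "a / rad x + 1 / (rad x)\<^sup>2" and ?i = "1 / (rad x)\<^sup>2"
  have r: "0 < rad x" by (rule near_rad[OF assms])
  have rot: "(cmod (of_real p * (of_real q * z) + of_real p' * (of_real q' * z')))\<^sup>2 + (cmod (of_real p * (of_real q' * z') - of_real p' * (of_real q * z)))\<^sup>2
      \<le> (cmod (of_real q * z))\<^sup>2 + (cmod (of_real q' * z'))\<^sup>2" if "p\<^sup>2 + p'\<^sup>2 \<le> 1" for p q p' q' :: real and z z' :: complex
    unfolding cmod_rotate using mult_right_mono[OF that] by (simp add: add_nonneg_nonneg)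
  have al: "(cmod (Dn x))\<^sup>2 + (cmod (Dt x))\<^sup>2 \<le> (cmod (C1 x * D1 x))\<^sup>2 + (cmod (C2 x * D2 x))\<^sup>2"
    using rot[OF n_sq_le[of x], of "C1 x" "D1 x" "C2 x" "D2 x"] by (simp add: Dn_def Dt_def mult.assoc)
  have be: "(cmod (Mn x))\<^sup>2 + (cmod (Mt x))\<^sup>2 \<le> (cmod (S1 x * M1 x))\<^sup>2 + (cmod (S2 x * M2 x))\<^sup>2"
    using rot[OF n_sq_le[of x], of "S1 x" "M1 x" "S2 x" "M2 x"] by (simp add: Mn_def Mt_def mult.assoc)
  have "kap / rho / 25 = (kap / 5) * (1 / (5 * rho))" by simp
  also have "\<dots> \<le> b x * (1 / rad x)"
    using near_b[OF assms] near_rad[OF assms] kap_pos b_bounds[of x] rho by (intro mult_mono) auto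
  also have "\<dots> = ?k1" unfolding b_def near_trad[OF assms] by (simp add: add_divide_distrib power2_eq_square)
  finally have k1: "kap / rho / 25 \<le> ?k1" .
  have k0: "0 \<le> ?k1" using a r by auto
  have "4 * ((kap / rho / 25) * ((cmod (Dt x))\<^sup>2 + (cmod (Mt x))\<^sup>2) - (16 / rho\<^sup>2) * ((cmod (Dn x))\<^sup>2 + (cmod (Mn x))\<^sup>2))
      \<le> 4 * (?k1 * ((cmod (Dt x))\<^sup>2 + (cmod (Mt x))\<^sup>2) - ?i * ((cmod (Dn x))\<^sup>2 + (cmod (Mn x))\<^sup>2))"
    using k1 near_rad(4)[OF assms] by (intro mult_left_mono diff_mono mult_right_mono) auto
  also have "\<dots> = 4 * (?k1 * (((cmod (Dn x))\<^sup>2 + (cmod (Dt x))\<^sup>2) + ((cmod (Mn x))\<^sup>2 + (cmod (Mt x))\<^sup>2)) - (a / rad x + 2 / (rad x)\<^sup>2) * ((cmod (Dn x))\<^sup>2 + (cmod (Mn x))\<^sup>2))"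
    by (simp add: algebra_simps add_divide_distrib)
  also have "\<dots> \<le> 4 * (?k1 * (((cmod (C1 x * D1 x))\<^sup>2 + (cmod (C2 x * D2 x))\<^sup>2) + ((cmod (S1 x * M1 x))\<^sup>2 + (cmod (S2 x * M2 x))\<^sup>2)) - (a / rad x + 2 / (rad x)\<^sup>2) * ((cmod (Dn x))\<^sup>2 + (cmod (Mn x))\<^sup>2))"
    using k0 by (intro mult_left_mono diff_mono add_mono[OF al be] order_refl) auto
  finally show ?thesis unfolding hess_form by (simp add: algebra_simps)
qed

end

section \<open>Energy and ellipticity\<close>

lemma infsum_add_fsupp:
  fixes f g :: "'a \<Rightarrow> real"
  shows "fsupp f \<Longrightarrow> fsupp g \<Longrightarrow> (\<Sum>\<^sub>\<infinity>x. f x + g x) = (\<Sum>\<^sub>\<infinity>x. f x) + (\<Sum>\<^sub>\<infinity>x. g x)"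
  by (intro infsum_add fsupp_summable)

context lattice_weight
begin

lemma minus_unit: "x - (1, 0) = x + (- 1, 0)" "x - (0, 1) = x + (0, - 1)" for x :: "int \<times> int"
  by (cases x; simp)+

lemma not_near_zero:
  assumes "\<not> near x"
  shows "D1 x = 0" "D2 x = 0" "M1 x = 0" "M2 x = 0" "e \<in> unit_steps \<Longrightarrow> u (x + e) = 0"
proof -
  have z: "u (x + e) = 0" if "e \<in> unit_steps" for e
    using near_neighbour[OF _ that] assms by blast
  show "D1 x = 0" "D2 x = 0" "M1 x = 0" "M2 x = 0"
    using z[of "(1, 0)"] z[of "(- 1, 0)"] z[of "(0, 1)"] z[of "(0, - 1)"]
    by (simp_all add: dif_def avg_def minus_unit unit_steps_def)
qed (use near_neighbour assms in blast)

text \<open>Principal parts: up to errors of order omega, the skew operator is -2 \<open>Bs\<close>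
  and the symmetric one is 2 \<open>Xs\<close>.\<close>

definition Bs where "Bs x = of_real (S1 x) * D1 x + of_real (S2 x) * D2 x"
definition Xs where "Xs x = wavg C1 (1, 0) u x + wavg C2 (0, 1) u x - of_real mu * u x"

lemma fsupp_parts: "fsupp Dt" "fsupp Dn" "fsupp Mt" "fsupp Mn" "fsupp Bs" "fsupp Xs"
  unfolding Dt_def[abs_def] Dn_def[abs_def] Mt_def[abs_def] Mn_def[abs_def] Bs_def[abs_def] Xs_def[abs_def]
  by (intro chain_fsupp u)+

text \<open>The energy identity with the commutator form bounded below pointwise and then summed.
  The kernel error is split by 2 p q <= p^2 + q^2 over the 16 pairs of steps, so 960000 = 16 *
  60000.\<close>

lemma energy_lower:
  "(l2 (sym_op unit_steps f (2 * mu) u))\<^sup>2 + (l2 (skew_op unit_steps f u))\<^sup>2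
      + ((4 / 25) * omega * ((l2 Dt)\<^sup>2 + (l2 Mt)\<^sup>2) - 64 * h / rho\<^sup>2 * ((l2 Dn)\<^sup>2 + (l2 Mn)\<^sup>2)
        - 960000 * cosh 13 * (h / rho) * omega * (l2 u)\<^sup>2)
    \<le> (l2 (\<lambda>x. (\<Sum>e\<in>unit_steps. of_real (exp (- (f (x + e) - f x))) * u (x + e)) - of_real (2 * mu) * u x))\<^sup>2"
proof -
  define t where "t = 60000 * cosh 13 * ((h / rho) * omega)"
  have t: "0 \<le> t" unfolding t_def using omega_bounds(1) h rho by simp
  let ?k = "\<lambda>x e e'. sinh (f (x + e + e') - f x) - sinh ((f (x + e) - f x) + (f (x + e') - f x))"
  let ?q = "\<lambda>x e e'. hess x e e' * cosh (b x * n_dot x e + b x * n_dot x e')"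
  let ?K = "\<lambda>x. \<Sum>e\<in>unit_steps. \<Sum>e'\<in>unit_steps. ?k x e e' * corr u e e' x"
  let ?s = "\<lambda>w :: int \<times> int \<Rightarrow> complex. \<lambda>x. (cmod (w x))\<^sup>2"
  let ?L = "\<lambda>x. (4 / 25) * omega * (?s Dt x + ?s Mt x) - 64 * h / rho\<^sup>2 * (?s Dn x + ?s Mn x)
      - 4 * t * (\<Sum>e\<in>unit_steps. ?s (\<lambda>x. u (x + e)) x)"
  have LK: "?L x \<le> ?K x" for x
  \<comment> \<open>Away from \<open>near\<close> no neighbour of x lies in the support, so both
    sides vanish there.\<close>
  proof (cases "near x")
    case False
    then have "?K x = 0" by (simp add: corr_def not_near_zero)
    moreover have "?L x = 0" using not_near_zero[OF False] by (simp add: Dt_def Mt_def Dn_def Mn_def)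
    ultimately show ?thesis by (simp only:)
  next
    case True
    let ?Q = "\<Sum>e\<in>unit_steps. \<Sum>e'\<in>unit_steps. ?q x e e' * corr u e e' x"
    have "h * ((4 / 25) * (kap / rho) * (?s Dt x + ?s Mt x) - 64 / rho\<^sup>2 * (?s Dn x + ?s Mn x)) \<le> h * ?Q"
      using h by (intro mult_left_mono hess_form_lower True) auto
    moreover have "h * ((4 / 25) * (kap / rho) * (?s Dt x + ?s Mt x) - 64 / rho\<^sup>2 * (?s Dn x + ?s Mn x))
        = (4 / 25) * omega * (?s Dt x + ?s Mt x) - 64 * h / rho\<^sup>2 * (?s Dn x + ?s Mn x)"
      by (simp add: omega_def algebra_simps add_divide_distrib)
    moreover have "\<bar>?K x - h * ?Q\<bar> \<le> 4 * t * (\<Sum>e\<in>unit_steps. (cmod (u (x + e)))\<^sup>2)"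
    proof -
      have eq: "?K x - h * ?Q = (\<Sum>e\<in>unit_steps. \<Sum>e'\<in>unit_steps. (?k x e e' - h * ?q x e e') * corr u e e' x)"
        by (simp only: left_diff_distrib sum_subtractf sum_distrib_left mult.assoc)
      have "\<bar>?K x - h * ?Q\<bar> \<le> (\<Sum>e\<in>unit_steps. \<Sum>e'\<in>unit_steps. \<bar>(?k x e e' - h * ?q x e e') * corr u e e' x\<bar>)"
        unfolding eq by (intro order_trans[OF sum_abs] sum_mono sum_abs)
      also have "\<dots> \<le> (\<Sum>e\<in>unit_steps. \<Sum>e'\<in>unit_steps. t * (((cmod (u (x + e)))\<^sup>2 + (cmod (u (x + e')))\<^sup>2) / 2))"
      proof (intro sum_mono)
        fix e e' assume e: "e \<in> unit_steps" "e' \<in> unit_steps"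
        have k: "\<bar>?k x e e' - h * ?q x e e'\<bar> \<le> t"
          using kernel_estimate[OF True e] by (simp only: t_def mult.assoc)
        have "\<bar>corr u e e' x\<bar> \<le> cmod (u (x + e)) * cmod (u (x + e'))"
          unfolding corr_def using abs_Re_le_cmod[of "u (x + e) * cnj (u (x + e'))"] by (simp add: norm_mult)
        also have "\<dots> \<le> ((cmod (u (x + e)))\<^sup>2 + (cmod (u (x + e')))\<^sup>2) / 2"
          using sum_squares_bound[of "cmod (u (x + e))" "cmod (u (x + e'))"] by simp
        finally show "\<bar>(?k x e e' - h * ?q x e e') * corr u e e' x\<bar> \<le> t * (((cmod (u (x + e)))\<^sup>2 + (cmod (u (x + e')))\<^sup>2) / 2)"
          unfolding abs_mult by (intro mult_mono[OF k] t) auto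
      qed
      also have "\<dots> = 4 * t * (\<Sum>e\<in>unit_steps. (cmod (u (x + e)))\<^sup>2)"
        by (simp add: unit_steps_def algebra_simps)
      finally show ?thesis .
    qed
    ultimately show ?thesis by linarith
  qed
  have fs: "fsupp (?s Dt)" "fsupp (?s Mt)" "fsupp (?s Dn)" "fsupp (?s Mn)" "\<And>e. fsupp (?s (\<lambda>x. u (x + e)))"
    by (intro fsupp_cmod fsupp_parts fsupp_shift u)+
  have fc: "fsupp (corr u e e')" for e e' by (rule fsupp_corr[OF unit_steps_symmetric u])
  have fK: "fsupp ?K" by (intro fsupp_sum fsupp_mult fc)
  have f1: "fsupp (\<lambda>x. (4 / 25) * omega * (?s Dt x + ?s Mt x))" "fsupp (\<lambda>x. 64 * h / rho\<^sup>2 * (?s Dn x + ?s Mn x))"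
    "fsupp (\<lambda>x. 4 * t * (\<Sum>e\<in>unit_steps. ?s (\<lambda>x. u (x + e)) x))"
    by (intro fsupp_mult[where m = "\<lambda>_. _"] fsupp_add fsupp_sum fs)+
  have f2: "fsupp (\<lambda>x. (4 / 25) * omega * (?s Dt x + ?s Mt x) - 64 * h / rho\<^sup>2 * (?s Dn x + ?s Mn x))"
    by (rule fsupp_diff[OF f1(1,2)])
  have fL: "fsupp ?L" by (rule fsupp_diff[OF f2 f1(3)])
  have shifts: "(\<Sum>\<^sub>\<infinity>x. \<Sum>e\<in>unit_steps. ?s (\<lambda>x. u (x + e)) x) = 4 * (l2 u)\<^sup>2"
    unfolding infsum_sum_fsupp[OF fs(5)] l2_sq[symmetric] l2_shift by (simp add: unit_steps_def)
  have "infsum ?L UNIV = (4 / 25) * omega * ((l2 Dt)\<^sup>2 + (l2 Mt)\<^sup>2) - 64 * h / rho\<^sup>2 * ((l2 Dn)\<^sup>2 + (l2 Mn)\<^sup>2)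
      - 4 * t * (4 * (l2 u)\<^sup>2)"
    unfolding infsum_diff_fsupp[OF f2 f1(3)] infsum_diff_fsupp[OF f1(1,2)] infsum_cmult_right'
      infsum_add_fsupp[OF fs(1,2)] infsum_add_fsupp[OF fs(3,4)] shifts l2_sq ..
  moreover have "infsum ?L UNIV \<le> infsum ?K UNIV"
    by (intro infsum_mono fsupp_summable fL fK LK)
  moreover have "4 * t * (4 * (l2 u)\<^sup>2) = 960000 * cosh 13 * (h / rho) * omega * (l2 u)\<^sup>2"
    by (simp add: t_def)
  ultimately have "(4 / 25) * omega * ((l2 Dt)\<^sup>2 + (l2 Mt)\<^sup>2) - 64 * h / rho\<^sup>2 * ((l2 Dn)\<^sup>2 + (l2 Mn)\<^sup>2)
      - 960000 * cosh 13 * (h / rho) * omega * (l2 u)\<^sup>2 \<le> infsum ?K UNIV"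
    by (simp only:)
  moreover have "(l2 (\<lambda>x. (\<Sum>e\<in>unit_steps. of_real (exp (- (f (x + e) - f x))) * u (x + e)) - of_real (2 * mu) * u x))\<^sup>2
      = (l2 (sym_op unit_steps f (2 * mu) u))\<^sup>2 + (l2 (skew_op unit_steps f u))\<^sup>2 + infsum ?K UNIV"
    by (rule energy_identity[OF unit_steps_symmetric u])
  ultimately show ?thesis by (simp only: add_left_mono)
qed

lemma d_le_13:
  assumes "near x" "e \<in> unit_steps"
  shows "\<bar>f (x + e) - f x\<bar> \<le> 13" "\<bar>b x * n_dot x e\<bar> \<le> 13"
  using d_estimate[OF assms] omega_bounds(2) by linarith+

lemma perturbation_bound:
  assumes "\<And>x e. near x \<Longrightarrow> e \<in> unit_steps \<Longrightarrow> \<bar>k x e\<bar> \<le> cosh 13 * (50 * omega)"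
    and "\<And>x. w x = (\<Sum>e\<in>unit_steps. of_real (k x e) * u (x + e))"
  shows "l2 w \<le> 200 * cosh 13 * omega * l2 u"
proof -
  have "l2 w \<le> (\<Sum>e\<in>unit_steps. (cosh 13 * (50 * omega)) * l2 (\<lambda>x. u (x + e)))"
  proof (rule l2_dominated)
    fix x
    have "cmod (w x) \<le> (\<Sum>e\<in>unit_steps. \<bar>k x e\<bar> * cmod (u (x + e)))"
      unfolding assms(2) by (intro order_trans[OF norm_sum] sum_mono) (simp add: norm_mult)
    also have "\<dots> \<le> (\<Sum>e\<in>unit_steps. (cosh 13 * (50 * omega)) * cmod (u (x + e)))"
    proof (intro sum_mono)
      fix e assume e: "e \<in> unit_steps"
      show "\<bar>k x e\<bar> * cmod (u (x + e)) \<le> (cosh 13 * (50 * omega)) * cmod (u (x + e))"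
      proof (cases "near x")
        case True
        show ?thesis by (rule mult_right_mono[OF assms(1)[OF True e]]) simp
      qed (simp add: not_near_zero(5)[OF _ e])
    qed
    finally show "cmod (w x) \<le> (\<Sum>e\<in>unit_steps. (cosh 13 * (50 * omega)) * cmod (u (x + e)))" .
  qed (auto simp: unit_steps_def omega_bounds intro: fsupp_shift u)
  then show ?thesis by (simp add: l2_shift unit_steps_def)
qed

lemma sym_estimate: "l2 Xs \<le> l2 (sym_op unit_steps f (2 * mu) u) / 2 + 100 * cosh 13 * omega * l2 u"
proof -
  let ?X = "sym_op unit_steps f (2 * mu) u"
  have "l2 (\<lambda>x. ?X x - 2 * Xs x) \<le> 200 * cosh 13 * omega * l2 u"
  proof (rule perturbation_bound)
    show "\<bar>cosh (f (x + e) - f x) - cosh (b x * n_dot x e)\<bar> \<le> cosh 13 * (50 * omega)"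
      if "near x" "e \<in> unit_steps" for x e
      by (rule order_trans[OF cosh_lipschitz[OF d_le_13[OF that]]]) (use d_estimate(1)[OF that] in \<open>auto intro: mult_left_mono\<close>)
    show "?X x - 2 * Xs x = (\<Sum>e\<in>unit_steps. of_real (cosh (f (x + e) - f x) - cosh (b x * n_dot x e)) * u (x + e))" for x
      unfolding of_real_diff left_diff_distrib sum_subtractf
      by (simp add: sym_op_def Xs_def wavg_def avg_def unit_steps_def n_dot_def C1_def C2_def minus_unit field_simps)
  qed
  then have "l2 (\<lambda>x. of_real (1 / 2) * ?X x - of_real (1 / 2) * (?X x - 2 * Xs x))
      \<le> \<bar>1 / 2\<bar> * l2 ?X + \<bar>1 / 2\<bar> * (200 * cosh 13 * omega * l2 u)"
    by (intro l2_diff_bound l2_scale_bound order_refl chain_fsupp fsupp_parts fsupp_sym_op[OF unit_steps_symmetric u])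
  moreover have "of_real (1 / 2) * ?X x - of_real (1 / 2) * (?X x - 2 * Xs x) = Xs x" for x
    by (simp add: algebra_simps)
  ultimately show ?thesis by (simp add: mult_ac)
qed

lemma skew_estimate: "l2 Bs \<le> l2 (skew_op unit_steps f u) / 2 + 100 * cosh 13 * omega * l2 u"
proof -
  let ?Y = "skew_op unit_steps f u"
  have "l2 (\<lambda>x. ?Y x + 2 * Bs x) \<le> 200 * cosh 13 * omega * l2 u"
  proof (rule perturbation_bound)
    show "\<bar>sinh (b x * n_dot x e) - sinh (f (x + e) - f x)\<bar> \<le> cosh 13 * (50 * omega)"
      if "near x" "e \<in> unit_steps" for x e
      by (rule order_trans[OF sinh_lipschitz[OF d_le_13(2,1)[OF that]]]) (use d_estimate(1)[OF that] in \<open>auto intro: mult_left_mono simp: abs_minus_commute\<close>)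
    show "?Y x + 2 * Bs x = (\<Sum>e\<in>unit_steps. of_real (sinh (b x * n_dot x e) - sinh (f (x + e) - f x)) * u (x + e))" for x
      unfolding of_real_diff left_diff_distrib sum_subtractf
      by (simp add: skew_op_def Bs_def dif_def unit_steps_def n_dot_def S1_def S2_def minus_unit field_simps)
  qed
  then have "l2 (\<lambda>x. of_real (1 / 2) * (?Y x + 2 * Bs x) - of_real (1 / 2) * ?Y x)
      \<le> \<bar>1 / 2\<bar> * (200 * cosh 13 * omega * l2 u) + \<bar>1 / 2\<bar> * l2 ?Y"
    by (intro l2_diff_bound l2_scale_bound order_refl chain_fsupp fsupp_parts fsupp_skew_op[OF unit_steps_symmetric u])
  moreover have "of_real (1 / 2) * (?Y x + 2 * Bs x) - of_real (1 / 2) * ?Y x = Bs x" for x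
    by (simp add: algebra_simps)
  ultimately show ?thesis by (simp add: mult_ac)
qed

text \<open>Cramer's rule for the two equations \<^const>\<open>Dt\<close> and \<^const>\<open>Bs\<close> in the unknowns
  \<^term>\<open>D1 x\<close> and \<^term>\<open>D2 x\<close>; the determinant is at least \<open>b |n|\<^sup>2\<close>.\<close>

lemma dif_pointwise:
  "cmod (D1 x) \<le> 240 * cmod (Dt x) + 60 / kap * cmod (Bs x)"
  "cmod (D2 x) \<le> 240 * cmod (Dt x) + 60 / kap * cmod (Bs x)"
proof -
  have "cmod d \<le> 240 * cmod (Dt x) + 60 / kap * cmod (Bs x)"
    if near: "near x" and nsc: "\<bar>p\<bar> \<le> 3" "\<bar>s\<bar> \<le> 3 * b x"
      and eq: "of_real (n1 x * C2 x * S1 x + n2 x * C1 x * S2 x) * d = of_real p * Bs x + of_real s * Dt x" for d p s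
  proof -
    let ?D = "n1 x * C2 x * S1 x + n2 x * C1 x * S2 x"
    have "b x * (n1 x)\<^sup>2 \<le> n1 x * S1 x" "b x * (n2 x)\<^sup>2 \<le> n2 x * S2 x"
      unfolding S1_def S2_def using b_bounds[of x] by (auto intro: mult_sinh_ge)
    moreover have "0 \<le> b x * (n1 x)\<^sup>2" "0 \<le> b x * (n2 x)\<^sup>2" using b_bounds[of x] by auto
    ultimately have "b x * (n1 x)\<^sup>2 * 1 \<le> n1 x * S1 x * C2 x" "b x * (n2 x)\<^sup>2 * 1 \<le> n2 x * S2 x * C1 x"
      using C_bounds[of x] by - (rule mult_mono; linarith)+
    then have "b x * ((n1 x)\<^sup>2 + (n2 x)\<^sup>2) \<le> ?D" by (simp add: algebra_simps)
    moreover have "kap / 5 * (1 / 4) \<le> b x * ((n1 x)\<^sup>2 + (n2 x)\<^sup>2)"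
      using near_b[OF near] near_n_sq[OF near] kap_pos b_bounds[of x] by (intro mult_mono) auto
    \<comment> \<open>(kap / 5) * (1 / 4). Dividing by it turns the numerator bounds 12 kap and 3
      into 240 and 60 / kap.\<close>
    ultimately have D: "kap / 20 \<le> ?D" by simp
    have "kap / 20 * cmod d \<le> \<bar>?D\<bar> * cmod d"
      by (rule mult_right_mono[OF order_trans[OF D abs_ge_self]]) simp
    also have "\<dots> = cmod (of_real p * Bs x + of_real s * Dt x)"
      unfolding eq[symmetric] by (simp only: norm_mult norm_of_real)
    also have "\<dots> \<le> \<bar>p\<bar> * cmod (Bs x) + \<bar>s\<bar> * cmod (Dt x)"
      by (rule order_trans[OF norm_triangle_ineq]) (simp add: norm_mult)
    also have "\<dots> \<le> 3 * cmod (Bs x) + (12 * kap) * cmod (Dt x)"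
      using nsc b_bounds[of x] by (intro add_mono mult_right_mono) auto
    finally have "cmod d \<le> (3 * cmod (Bs x) + (12 * kap) * cmod (Dt x)) / (kap / 20)"
      using kap_pos by (simp add: pos_le_divide_eq mult.commute)
    also have "\<dots> = 240 * cmod (Dt x) + 60 / kap * cmod (Bs x)"
      using kap_pos by (simp add: field_simps)
    finally show ?thesis .
  qed
  note main = this
  have nc: "\<bar>n * c\<bar> \<le> 3" if "\<bar>n\<bar> \<le> 1" "\<bar>c\<bar> \<le> 3" for n c :: real
    using mult_mono[OF that] by (simp add: abs_mult)
  show "cmod (D1 x) \<le> 240 * cmod (Dt x) + 60 / kap * cmod (Bs x)"
  proof (cases "near x")
    case True
    show ?thesis
      by (rule main[OF True nc, of "n1 x" "C2 x" "- S2 x"])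
        (use n_le[of x] C_bounds[of x] S_bounds[of x] in \<open>auto simp: Dt_def Bs_def algebra_simps\<close>)
  qed (use kap_pos in \<open>simp add: not_near_zero\<close>)
  show "cmod (D2 x) \<le> 240 * cmod (Dt x) + 60 / kap * cmod (Bs x)"
  proof (cases "near x")
    case True
    show ?thesis
      by (rule main[OF True nc, of "n2 x" "C1 x" "S1 x"])
        (use n_le[of x] C_bounds[of x] S_bounds[of x] in \<open>auto simp: Dt_def Bs_def algebra_simps\<close>)
  qed (use kap_pos in \<open>simp add: not_near_zero\<close>)
qed

text \<open>\<open>delta\<close> dominates every approximate identity satisfied by \<open>u\<close>,
  so both eliminants times \<open>u\<close> are bounded by multiples of it. On the support their
  moduli add up to at least c. The error terms of order h / rho times \<open>l2 u\<close> are
  absorbed on the left by \<open>small\<close>.\<close>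

lemma ellipticity:
  assumes c: "0 < c"
    and lower: "\<And>b n1 n2. 0 \<le> b \<and> b \<le> b1 \<and> 1/4 \<le> n1\<^sup>2 + n2\<^sup>2 \<and> n1\<^sup>2 + n2\<^sup>2 \<le> 1 \<Longrightarrow> c \<le> \<bar>elim_sum mu b n1 n2\<bar> + \<bar>elim_diff b n1 n2\<bar>"
    and small: "153600000 * cosh 13 * (h / rho) \<le> c"
  shows "(c * l2 u)\<^sup>2 \<le> 4 * 5760000\<^sup>2 *
    ((l2 (sym_op unit_steps f (2 * mu) u))\<^sup>2 + (l2 (skew_op unit_steps f u) / kap)\<^sup>2 + (l2 Dt)\<^sup>2 + (l2 Mt)\<^sup>2)"
proof -
  let ?X = "l2 (sym_op unit_steps f (2 * mu) u)" and ?Y = "l2 (skew_op unit_steps f u)"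
  define delta where "delta = 240 * l2 Dt + 60 / kap * l2 Bs + l2 Xs + l2 Mt + eps * l2 u"
  have eps: "0 \<le> eps" using h rho by (simp add: eps_def)
  have n0: "0 \<le> l2 Dt" "0 \<le> 60 / kap * l2 Bs" "0 \<le> l2 Xs" "0 \<le> l2 Mt" "0 \<le> eps * l2 u"
    using kap_pos eps by (auto intro!: mult_nonneg_nonneg divide_nonneg_pos l2_nonneg)
  then have d0: "0 \<le> delta" "eps * l2 u \<le> delta" "l2 Xs \<le> delta" "l2 Mt \<le> delta"
    "240 * l2 Dt + 60 / kap * l2 Bs \<le> delta"
    unfolding delta_def by linarith+
  have "l2 D1 \<le> 240 * l2 Dt + 60 / kap * l2 Bs" "l2 D2 \<le> 240 * l2 Dt + 60 / kap * l2 Bs"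
    using kap_pos by (intro l2_bound2 dif_pointwise fsupp_parts; simp)+
  then have d: "l2 D1 \<le> delta" "l2 D2 \<le> delta" using d0(5) by linarith+
  have sl: "e = (1, 0) \<or> e = (0, 1) \<Longrightarrow> \<bar>C1 (x + e) - C1 x\<bar> \<le> eps" "e = (1, 0) \<or> e = (0, 1) \<Longrightarrow> \<bar>C2 (x + e) - C2 x\<bar> \<le> eps" for x e
    by (rule slow_variation; assumption)+
  have sl': "e = (1, 0) \<or> e = (0, 1) \<Longrightarrow> \<bar>n2 (x + e) * S1 (x + e) - n2 x * S1 x\<bar> \<le> eps" "e = (1, 0) \<or> e = (0, 1) \<Longrightarrow> \<bar>n1 (x + e) * S2 (x + e) - n1 x * S2 x\<bar> \<le> eps" for x e
    by (rule slow_variation; assumption)+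
  have C3: "\<bar>C1 x\<bar> \<le> 3" "\<bar>C2 x\<bar> \<le> 3" for x using C_bounds[of x] by auto
  have S3: "\<bar>n2 x * S1 x\<bar> \<le> 3" "\<bar>n1 x * S2 x\<bar> \<le> 3" for x
    using mult_mono[OF n_le(2)[of x] S_le_3(1)[of x]] mult_mono[OF n_le(1)[of x] S_le_3(2)[of x]] by (auto simp: abs_mult)
  have three: "1 \<le> (3::real)" by simp
  let ?F = "\<lambda>x. of_real (elim_sum mu (b x) (n1 x) (n2 x)) * u x"
  let ?G = "\<lambda>x. of_real (elim_diff (b x) (n1 x) (n2 x)) * u x"
  have F: "l2 ?F \<le> 140 * 3 ^ 4 * delta"
  proof -
    have "l2 (\<lambda>x. of_real (((C1 x)\<^sup>2 - (C2 x)\<^sup>2 + mu\<^sup>2)\<^sup>2 - 4 * mu\<^sup>2 * (C1 x)\<^sup>2) * u x) \<le> 140 * 3 ^ 4 * delta"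
      by (rule eliminate_sum[OF three u d0(2) C3 sl d])
        (use mu d0(3) in \<open>auto simp: Xs_def[abs_def]\<close>)
    then show ?thesis by (simp add: elim_sum_def C1_def C2_def)
  qed
  have G: "l2 ?G \<le> 8 * 3\<^sup>2 * delta"
  proof -
    have "l2 (\<lambda>x. wavg (\<lambda>x. n2 x * S1 x) (1, 0) u x - wavg (\<lambda>x. n1 x * S2 x) (0, 1) u x) = l2 Mt"
      unfolding l2_def by (simp add: wavg_def Mt_def norm_minus_commute)
    then have "l2 (\<lambda>x. of_real ((n2 x * S1 x)\<^sup>2 - (n1 x * S2 x)\<^sup>2) * u x) \<le> 8 * 3\<^sup>2 * delta"
      by (intro eliminate_difference[OF three u d0(2) S3 sl' d]) (use d0(4) in auto)
    then show ?thesis by (simp add: elim_diff_def S1_def S2_def)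
  qed
  have fFG: "fsupp ?F" "fsupp ?G" by (intro chain_fsupp u)+
  have "l2 (\<lambda>x. of_real c * u x) \<le> 1 * l2 ?F + 1 * l2 ?G"
  proof (rule l2_bound2[OF fFG])
    fix x
    show "cmod (of_real c * u x) \<le> 1 * cmod (?F x) + 1 * cmod (?G x)"
    proof (cases "u x = 0")
      case False
      then have "c \<le> \<bar>elim_sum mu (b x) (n1 x) (n2 x)\<bar> + \<bar>elim_diff (b x) (n1 x) (n2 x)\<bar>"
        using b_bounds[of x] n_sq_le[of x] near_n_sq[OF near_support] by (intro lower) auto
      then have "c * cmod (u x) \<le> (\<bar>elim_sum mu (b x) (n1 x) (n2 x)\<bar> + \<bar>elim_diff (b x) (n1 x) (n2 x)\<bar>) * cmod (u x)"
        by (intro mult_right_mono) auto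
      then show ?thesis using c by (simp add: norm_mult distrib_right)
    qed simp
  qed auto
  \<comment> \<open>140 * 81 + 8 * 9 = 11412.\<close>
  then have "c * l2 u \<le> 12000 * delta"
    using F G d0(1) c by (simp add: l2_scale)
  also have "delta \<le> 240 * (?X + ?Y / kap + l2 Dt + l2 Mt) + 6400 * cosh 13 * (h / rho) * l2 u"
  proof -
    have "60 / kap * l2 Bs \<le> 60 / kap * (?Y / 2 + 100 * cosh 13 * omega * l2 u)"
      using kap_pos by (intro mult_left_mono skew_estimate) auto
    \<comment> \<open>Division by kap is affordable because omega / kap = h / rho.\<close>
    also have "\<dots> = 30 * (?Y / kap) + 6000 * (cosh 13 * (h / rho) * l2 u)"
      using kap_pos by (simp add: omega_def field_simps)
    finally have 1: "60 / kap * l2 Bs \<le> 30 * (?Y / kap) + 6000 * (cosh 13 * (h / rho) * l2 u)" .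
    have "100 * cosh 13 * omega * l2 u \<le> 100 * cosh 13 * (3 * (h / rho)) * l2 u"
      using omega_bounds(3) l2_nonneg[of u] by (intro mult_right_mono mult_left_mono) auto
    then have 2: "l2 Xs \<le> ?X / 2 + 300 * (cosh 13 * (h / rho) * l2 u)"
      using sym_estimate by simp
    have "1 * ((h / rho) * l2 u) \<le> cosh 13 * ((h / rho) * l2 u)"
      using h rho l2_nonneg[of u] by (intro mult_right_mono) (auto simp: cosh_real_ge_1)
    then have 3: "eps * l2 u \<le> 100 * (cosh 13 * (h / rho) * l2 u)"
      by (simp add: eps_def)
    have "0 \<le> ?X" "0 \<le> ?Y / kap" "0 \<le> l2 Mt" using kap_pos by (auto intro!: l2_nonneg divide_nonneg_pos)
    have "delta \<le> 240 * (?X + ?Y / kap + l2 Dt + l2 Mt) + 6400 * (cosh 13 * (h / rho) * l2 u)"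
    proof -
      have "240 * dt + p + xs + mt + q \<le> 240 * (X + y + dt + mt) + 6400 * E"
        if "0 \<le> X" "0 \<le> y" "0 \<le> mt" "p \<le> 30 * y + 6000 * E" "xs \<le> X / 2 + 300 * E" "q \<le> 100 * E"
        for dt p xs mt q X y E :: real
        using that by (simp add: field_simps)
      from this[OF \<open>0 \<le> ?X\<close> \<open>0 \<le> ?Y / kap\<close> \<open>0 \<le> l2 Mt\<close> 1 2 3] show ?thesis
        unfolding delta_def .
    qed
    then show ?thesis by (simp only: mult.assoc)
  qed
  finally have "c * l2 u \<le> 2880000 * (?X + ?Y / kap + l2 Dt + l2 Mt) + (76800000 * cosh 13 * (h / rho)) * l2 u"
    by simp
  \<comment> \<open>76800000 = 12000 * 6400 is half of the constant in \<open>small\<close>, so half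
    of c * \<open>l2 u\<close> is absorbed and the remaining constant doubles to 5760000.\<close>
  moreover have "(153600000 * cosh 13 * (h / rho)) * l2 u \<le> c * l2 u"
    using small l2_nonneg by (rule mult_right_mono)
  ultimately have "c * l2 u \<le> 5760000 * (?X + ?Y / kap + l2 Dt + l2 Mt)" by linarith
  then have "(c * l2 u)\<^sup>2 \<le> (5760000 * (?X + ?Y / kap + l2 Dt + l2 Mt))\<^sup>2"
    using c l2_nonneg[of u] by (intro power_mono) auto
  also have "\<dots> = 5760000\<^sup>2 * (?X + ?Y / kap + l2 Dt + l2 Mt)\<^sup>2" by (rule power_mult_distrib)
  also have "(p + q + r + s)\<^sup>2 \<le> 4 * (p\<^sup>2 + q\<^sup>2 + r\<^sup>2 + s\<^sup>2)" for p q r s :: real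
  proof -
    have "0 \<le> (p - q)\<^sup>2 + (p - r)\<^sup>2 + (p - s)\<^sup>2 + (q - r)\<^sup>2 + (q - s)\<^sup>2 + (r - s)\<^sup>2" by simp
    then show ?thesis by (simp add: power2_eq_square algebra_simps)
  qed
  finally show ?thesis by simp
qed

end

section \<open>The Carleman estimates\<close>

context lattice_weight
begin

definition conj_u where
  "conj_u x = (\<Sum>e\<in>unit_steps. of_real (exp (- (f (x + e) - f x))) * u (x + e)) - of_real (2 * mu) * u x"

text \<open>Half of the skew term is kept in reserve: for \<open>a = 0\<close> it has to absorb the normal components.\<close>

lemma energy_coercive:
  assumes c: "0 < c"
    and lower: "\<And>b n1 n2. 0 \<le> b \<and> b \<le> b1 \<and> 1/4 \<le> n1\<^sup>2 + n2\<^sup>2 \<and> n1\<^sup>2 + n2\<^sup>2 \<le> 1 \<Longrightarrow> c \<le> \<bar>elim_sum mu b n1 n2\<bar> + \<bar>elim_diff b n1 n2\<bar>"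
    and small: "153600000 * cosh 13 / rho \<le> c" and G: "G = c\<^sup>2 / (4 * 5760000\<^sup>2)"
    and small2: "960000 * cosh 13 / rho \<le> G / 25"
  shows "3 / 25 * G * omega * (l2 u)\<^sup>2 + (l2 (skew_op unit_steps f u))\<^sup>2 / 2
      \<le> (l2 conj_u)\<^sup>2 + 64 * h / rho\<^sup>2 * ((l2 Dn)\<^sup>2 + (l2 Mn)\<^sup>2)"
proof -
  let ?X = "l2 (sym_op unit_steps f (2 * mu) u)" and ?Y = "l2 (skew_op unit_steps f u)"
  let ?k = "960000 * cosh 13 * (h / rho) * omega * (l2 u)\<^sup>2"
  have hr: "h / rho \<le> 1 / rho" using h rho by (simp add: divide_right_mono)
  have "153600000 * cosh 13 * (h / rho) \<le> 153600000 * cosh 13 * (1 / rho)"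
    using hr by (intro mult_left_mono) auto
  then have "(c * l2 u)\<^sup>2 \<le> 4 * 5760000\<^sup>2 * (?X\<^sup>2 + (?Y / kap)\<^sup>2 + (l2 Dt)\<^sup>2 + (l2 Mt)\<^sup>2)"
    using small by (intro ellipticity[OF c lower]) auto
  then have "G * (l2 u)\<^sup>2 \<le> ?X\<^sup>2 + (?Y / kap)\<^sup>2 + (l2 Dt)\<^sup>2 + (l2 Mt)\<^sup>2"
    by (simp add: G power_mult_distrib field_simps)
  then have "4 / 25 * omega * (G * (l2 u)\<^sup>2) \<le> 4 / 25 * omega * (?X\<^sup>2 + (?Y / kap)\<^sup>2 + (l2 Dt)\<^sup>2 + (l2 Mt)\<^sup>2)"
    using omega_bounds(1) by (intro mult_left_mono) auto
  then have 1: "4 / 25 * G * omega * (l2 u)\<^sup>2 \<le> 4 / 25 * omega * ?X\<^sup>2 + 4 / 25 * omega * (?Y / kap)\<^sup>2 + 4 / 25 * omega * ((l2 Dt)\<^sup>2 + (l2 Mt)\<^sup>2)"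
    by (simp add: algebra_simps)
  have X: "4 / 25 * omega * ?X\<^sup>2 \<le> 1 * ?X\<^sup>2" using omega_bounds(2) by (intro mult_right_mono) auto
  \<comment> \<open>The weight 1 / kap on the skew part costs omega / kap^2 = h / (rho kap) <= 1, so
    this term fits into half of the skew energy.\<close>
  have "omega * (?Y / kap)\<^sup>2 = h / (rho * kap) * ?Y\<^sup>2"
    using kap_pos by (simp add: omega_def power2_eq_square field_simps)
  also have "\<dots> \<le> 1 * ?Y\<^sup>2"
    using rho_kap h by (intro mult_right_mono) (auto simp: divide_le_eq)
  finally have "4 / 25 * (omega * (?Y / kap)\<^sup>2) \<le> ?Y\<^sup>2 / 2"
    using zero_le_power2[of ?Y] by linarith
  then have Y: "4 / 25 * omega * (?Y / kap)\<^sup>2 \<le> ?Y\<^sup>2 / 2" by (simp only: mult.assoc)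
  have "?k = 960000 * cosh 13 * (h / rho) * (omega * (l2 u)\<^sup>2)" by simp
  also have "\<dots> \<le> G / 25 * (omega * (l2 u)\<^sup>2)"
  proof (rule mult_right_mono)
    have "960000 * cosh 13 * (h / rho) \<le> 960000 * cosh 13 * (1 / rho)"
      using hr by (intro mult_left_mono) auto
    then show "960000 * cosh 13 * (h / rho) \<le> G / 25" using small2 by simp
  qed (use omega_bounds(1) in auto)
  finally have k: "?k \<le> 1 / 25 * G * omega * (l2 u)\<^sup>2" by simp
  have "3 / 25 * g + y / 2 \<le> A + n"
    if "4 / 25 * g \<le> xo + yo + d" "xo \<le> 1 * xx" "yo \<le> y / 2" "xx + y + (d - n - k) \<le> A" "k \<le> 1 / 25 * g"
    for g y A n xo yo d xx k :: real
    using that by (simp add: field_simps)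
  from this[of "G * omega * (l2 u)\<^sup>2", OF _ X Y energy_lower[folded conj_u_def[abs_def]]] 1 k
  show ?thesis by (simp only: mult.assoc)
qed

text \<open>Enough when a is bounded below: the normal terms enter with h / rho^2 while the gain
  omega is of order h / rho, so a large rho absorbs them.\<close>

lemma l2_normal_crude: "l2 Dn \<le> 6 * l2 u" "l2 Mn \<le> 6 * l2 u"
proof -
  have b: "\<bar>p * q\<bar> \<le> 3" if "\<bar>p\<bar> \<le> 1" "\<bar>q\<bar> \<le> 3" for p q :: real
    using mult_mono[OF that] by (simp add: abs_mult)
  have C: "\<bar>C1 x\<bar> \<le> 3" "\<bar>C2 x\<bar> \<le> 3" for x using C_bounds[of x] by auto
  have "l2 Dn \<le> 3 * l2 u + 3 * l2 u"
    unfolding Dn_def[abs_def] by (intro l2_add_bound l2_mult_bound b n_le C l2_dif chain_fsupp u)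
  then show "l2 Dn \<le> 6 * l2 u" by simp
  have "l2 Mn \<le> 3 * l2 u + 3 * l2 u"
    unfolding Mn_def[abs_def] by (intro l2_add_bound l2_mult_bound b n_le S_le_3 l2_avg chain_fsupp u)
  then show "l2 Mn \<le> 6 * l2 u" by simp
qed

lemma carleman_positive:
  assumes c: "0 < c"
    and lower: "\<And>b n1 n2. 0 \<le> b \<and> b \<le> b1 \<and> 1/4 \<le> n1\<^sup>2 + n2\<^sup>2 \<and> n1\<^sup>2 + n2\<^sup>2 \<le> 1 \<Longrightarrow> c \<le> \<bar>elim_sum mu b n1 n2\<bar> + \<bar>elim_diff b n1 n2\<bar>"
    and small: "153600000 * cosh 13 / rho \<le> c" and G: "G = c\<^sup>2 / (4 * 5760000\<^sup>2)"
    and small2: "960000 * cosh 13 / rho \<le> G / 25"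
    and a0: "0 < a0" "a0 \<le> a" and small3: "4608 / (a0 * rho) \<le> G / 25"
  shows "2 / 25 * G * a0 * (h * inverse rho * (l2 u)\<^sup>2) \<le> (l2 conj_u)\<^sup>2"
proof -
  have Gp: "0 < G" using c by (simp add: G)
  have ka: "a0 \<le> kap" using a0 rho unfolding kap_def by (smt (verit) divide_nonneg_pos)
  have "(l2 Dn)\<^sup>2 \<le> (6 * l2 u)\<^sup>2" "(l2 Mn)\<^sup>2 \<le> (6 * l2 u)\<^sup>2"
    by (intro power_mono l2_normal_crude l2_nonneg)+
  then have "(l2 Dn)\<^sup>2 + (l2 Mn)\<^sup>2 \<le> 72 * (l2 u)\<^sup>2" by (simp add: power_mult_distrib)
  then have "64 * h / rho\<^sup>2 * ((l2 Dn)\<^sup>2 + (l2 Mn)\<^sup>2) \<le> 64 * h / rho\<^sup>2 * (72 * (l2 u)\<^sup>2)"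
    using h by (intro mult_left_mono) auto
  \<comment> \<open>4608 = 64 * 72; the quotient of h / rho^2 by omega is 1 / (kap rho).\<close>
  also have "\<dots> = 4608 / (kap * rho) * (omega * (l2 u)\<^sup>2)"
    using kap_pos rho by (simp add: omega_def power2_eq_square field_simps)
  also have "\<dots> \<le> G / 25 * (omega * (l2 u)\<^sup>2)"
  proof (rule mult_right_mono)
    have "4608 / (kap * rho) \<le> 4608 / (a0 * rho)"
      using ka a0 rho kap_pos by (intro divide_left_mono mult_right_mono) auto
    then show "4608 / (kap * rho) \<le> G / 25" using small3 by linarith
  qed (use omega_bounds(1) in auto)
  finally have n: "64 * h / rho\<^sup>2 * ((l2 Dn)\<^sup>2 + (l2 Mn)\<^sup>2) \<le> 1 / 25 * (G * omega * (l2 u)\<^sup>2)" by simp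
  have "3 / 25 * (G * omega * (l2 u)\<^sup>2) + (l2 (skew_op unit_steps f u))\<^sup>2 / 2
      \<le> (l2 conj_u)\<^sup>2 + 64 * h / rho\<^sup>2 * ((l2 Dn)\<^sup>2 + (l2 Mn)\<^sup>2)"
    using energy_coercive[OF c lower small G small2] by (simp only: mult.assoc)
  then have "2 / 25 * (G * omega * (l2 u)\<^sup>2) \<le> (l2 conj_u)\<^sup>2"
    using n zero_le_power2[of "l2 (skew_op unit_steps f u)"] by linarith
  moreover have "2 / 25 * G * (l2 u)\<^sup>2 * (h * a0 / rho) \<le> 2 / 25 * G * (l2 u)\<^sup>2 * omega"
    unfolding omega_def using Gp ka h rho by (intro mult_left_mono divide_right_mono) auto
  moreover have "2 / 25 * (G * omega * (l2 u)\<^sup>2) = 2 / 25 * G * (l2 u)\<^sup>2 * omega"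
    by simp
  moreover have "2 / 25 * G * a0 * (h * inverse rho * (l2 u)\<^sup>2) = 2 / 25 * G * (l2 u)\<^sup>2 * (h * a0 / rho)"
    by (simp add: field_simps)
  ultimately show ?thesis by linarith
qed

text \<open>For a = 0 the gain is only h / rho^2, the order of the normal loss, so crude bounds
  fail. Now b = 1/R is small: S_j is close to b n_j and C_j to 1, so \<open>Dn\<close> is R times
  \<open>Bs\<close> up to O(1/rho), and \<open>Mn\<close> carries a factor sinh of order
  1/rho.\<close>

lemma l2_normal_log_weight:
  assumes a0: "a = 0"
  shows "l2 Dn \<le> 5 * rho * l2 Bs + 48 / rho * l2 u" "l2 Mn \<le> 24 / rho * l2 u"
proof -
  have b4: "b x \<le> 4 / rho" for x using inverse_trad(1)[of x] unfolding b_def by (simp add: a0)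
  have S: "\<bar>S1 x\<bar> \<le> 12 / rho" "\<bar>S2 x\<bar> \<le> 12 / rho" for x
    using S_bounds[of x] b4[of x] by simp_all
  have nS: "\<bar>p * q\<bar> \<le> 12 / rho" if "\<bar>p\<bar> \<le> 1" "\<bar>q\<bar> \<le> 12 / rho" for p q :: real
    using mult_mono[OF that] by (simp add: abs_mult)
  have "l2 Mn \<le> 12 / rho * l2 u + 12 / rho * l2 u"
    unfolding Mn_def[abs_def] by (intro l2_add_bound l2_mult_bound nS n_le S l2_avg chain_fsupp u)
  then show "l2 Mn \<le> 24 / rho * l2 u" by simp
  let ?w = "\<lambda>x. complex_of_real (cmod (D1 x) + cmod (D2 x))"
  have fw: "fsupp ?w"
  proof -
    have "fsupp (\<lambda>x. complex_of_real (cmod (dif e u x)))" for e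
      using fsupp_dif[OF u, of e] by (rule fsupp_mono) simp
    then show ?thesis unfolding of_real_add by (intro fsupp_add)
  qed
  have "l2 ?w \<le> 1 * l2 D1 + 1 * l2 D2"
    by (intro l2_bound2 fsupp_dif u) (auto simp del: of_real_add)
  then have lw: "l2 ?w \<le> 2 * l2 u" using l2_dif[OF u, of "(1, 0)"] l2_dif[OF u, of "(0, 1)"] by linarith
  have "l2 Dn \<le> (5 * rho) * l2 Bs + (24 / rho) * l2 ?w"
  proof (rule l2_bound2[OF fsupp_parts(5) fw])
    fix x
    show "cmod (Dn x) \<le> (5 * rho) * cmod (Bs x) + (24 / rho) * cmod (?w x)"
    proof (cases "near x")
      case False
      then show ?thesis using rho by (simp add: Dn_def not_near_zero del: of_real_add)
    next
      case True
      have bp: "0 < b x" "b x = 1 / rad x" using b_bounds[of x] near_trad[OF True] unfolding b_def by (simp_all add: a0)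
      have est: "\<bar>n * cosh (b x * n) - sinh (b x * n) / b x\<bar> \<le> 24 / rho" if n: "\<bar>n\<bar> \<le> 1" for n
      proof -
        have bn: "\<bar>b x * n\<bar> \<le> b x" using n bp(1) by (simp add: abs_mult mult_left_le)
        then have bn1: "\<bar>b x * n\<bar> \<le> b1" using b_bounds[of x] by linarith
        have "\<bar>cosh (b x * n) - cosh 0\<bar> \<le> cosh b1 * \<bar>b x * n - 0\<bar>"
          using bn1 b1_bounds by (intro cosh_lipschitz) auto
        also have "\<dots> \<le> 3 * b x" using bn b1_bounds by (intro mult_mono) auto
        finally have 1: "\<bar>n * (cosh (b x * n) - 1)\<bar> \<le> 1 * (3 * b x)"
          using n unfolding abs_mult by (intro mult_mono) auto
        have "\<bar>sinh (b x * n) - b x * n\<bar> \<le> cosh b1 * (b x * n)\<^sup>2" by (rule sinh_minus_self_bound[OF bn1])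
        also have "\<dots> \<le> 3 * (b x)\<^sup>2"
          using b1_bounds power_mono[OF bn, of 2] by (intro mult_mono) auto
        finally have "\<bar>(sinh (b x * n) - b x * n) / b x\<bar> \<le> 3 * (b x)\<^sup>2 / b x"
          using bp unfolding abs_divide by (simp add: divide_right_mono)
        then have 2: "\<bar>sinh (b x * n) / b x - n\<bar> \<le> 3 * b x"
          using bp(1) by (simp add: diff_divide_distrib power2_eq_square)
        show ?thesis using 1 2 b4[of x] by (simp add: algebra_simps)
      qed
      have e: "\<bar>n1 x * C1 x - S1 x / b x\<bar> \<le> 24 / rho" "\<bar>n2 x * C2 x - S2 x / b x\<bar> \<le> 24 / rho"
        unfolding C1_def C2_def S1_def S2_def by (rule est[OF n_le(1)], rule est[OF n_le(2)])
      have r5: "\<bar>rad x\<bar> \<le> 5 * rho" using True near_rad(1)[OF True] by (simp add: near_def)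
      \<comment> \<open>The multiples of S_j / b subtracted from the coefficients are exactly R
        times the coefficients of \<open>Bs\<close>.\<close>
      have Dn_eq: "Dn x = of_real (rad x) * Bs x + of_real (n1 x * C1 x - S1 x / b x) * D1 x + of_real (n2 x * C2 x - S2 x / b x) * D2 x"
        unfolding Dn_def Bs_def bp(2) by (simp add: algebra_simps)
      have "cmod (Dn x) \<le> \<bar>rad x\<bar> * cmod (Bs x) + \<bar>n1 x * C1 x - S1 x / b x\<bar> * cmod (D1 x) + \<bar>n2 x * C2 x - S2 x / b x\<bar> * cmod (D2 x)"
        unfolding Dn_eq by (intro order_trans[OF norm_triangle_ineq] add_mono) (simp_all only: norm_mult norm_of_real order_refl)
      also have "\<dots> \<le> (5 * rho) * cmod (Bs x) + (24 / rho) * cmod (D1 x) + (24 / rho) * cmod (D2 x)"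
        by (intro add_mono mult_right_mono e r5 norm_ge_zero)
      also have "\<dots> = (5 * rho) * cmod (Bs x) + (24 / rho) * cmod (?w x)"
        unfolding norm_of_real by (simp add: distrib_left)
      finally show ?thesis .
    qed
  qed (use rho in auto)
  also have "(24 / rho) * l2 ?w \<le> (24 / rho) * (2 * l2 u)"
    using lw rho by (intro mult_left_mono) auto
  finally show "l2 Dn \<le> 5 * rho * l2 Bs + 48 / rho * l2 u" by simp
qed

text \<open>The normal difference is bounded through the skew part, whose contribution goes into the
  half kept in \<open>energy_coercive\<close>; the remaining normal terms gain an extra 1 /
  rho^2.\<close>

lemma carleman_zero:
  assumes c: "0 < c"
    and lower: "\<And>b n1 n2. 0 \<le> b \<and> b \<le> b1 \<and> 1/4 \<le> n1\<^sup>2 + n2\<^sup>2 \<and> n1\<^sup>2 + n2\<^sup>2 \<le> 1 \<Longrightarrow> c \<le> \<bar>elim_sum mu b n1 n2\<bar> + \<bar>elim_diff b n1 n2\<bar>"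
    and small: "153600000 * cosh 13 / rho \<le> c" and G: "G = c\<^sup>2 / (4 * 5760000\<^sup>2)"
    and small2: "960000 * cosh 13 / rho \<le> G / 25"
    and a0: "a = 0" and h0: "h \<le> 1 / 1600" and small3: "192 * (548 * cosh 13)\<^sup>2 / rho \<le> G / 25"
  shows "2 / 25 * G * (h * inverse (rho\<^sup>2) * (l2 u)\<^sup>2) \<le> (l2 conj_u)\<^sup>2"
proof -
  let ?Y = "l2 (skew_op unit_steps f u)"
  \<comment> \<open>548 = 500 + 48: the error in \<open>skew_estimate\<close> multiplied by 5 rho,
    plus the error in \<open>l2_normal_log_weight\<close>.\<close>
  define J where "J = 548 * cosh (13::real)"
  have J: "548 \<le> J" using cosh_real_ge_1[of 13] by (simp add: J_def)
  have om: "omega = h / rho\<^sup>2" unfolding omega_def kap_def by (simp add: a0 power2_eq_square)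
  have "5 * rho * l2 Bs \<le> 5 * rho * (?Y / 2 + 100 * cosh 13 * omega * l2 u)"
    using rho by (intro mult_left_mono skew_estimate) auto
  also have "\<dots> = 5 / 2 * rho * ?Y + 500 * cosh 13 * (h / rho) * l2 u"
    using rho by (simp add: om field_simps power2_eq_square)
  finally have "5 * rho * l2 Bs \<le> 5 / 2 * rho * ?Y + 500 * cosh 13 * (h / rho) * l2 u" .
  moreover have "500 * cosh 13 * (h / rho) * l2 u \<le> 500 * cosh 13 * (1 / rho) * l2 u"
    using h rho by (intro mult_right_mono mult_left_mono divide_right_mono l2_nonneg) auto
  moreover have "500 * cosh 13 * (1 / rho) * l2 u + 48 / rho * l2 u \<le> J / rho * l2 u"
  proof -
    have "(500 * cosh 13 + 48) / rho * l2 u \<le> J / rho * l2 u"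
      using cosh_real_ge_1[of 13] rho by (intro mult_right_mono divide_right_mono l2_nonneg) (auto simp: J_def)
    then show ?thesis by (simp add: add_divide_distrib distrib_right)
  qed
  ultimately have Dn: "l2 Dn \<le> 5 / 2 * rho * ?Y + J / rho * l2 u"
    using l2_normal_log_weight(1)[OF a0] by linarith
  have "(l2 Dn)\<^sup>2 \<le> (5 / 2 * rho * ?Y + J / rho * l2 u)\<^sup>2" by (rule power_mono[OF Dn l2_nonneg])
  also have "\<dots> \<le> 2 * (5 / 2 * rho * ?Y)\<^sup>2 + 2 * (J / rho * l2 u)\<^sup>2"
    using sum_squares_bound[of "5 / 2 * rho * ?Y" "J / rho * l2 u"] by (simp only: power2_sum)
  also have "(5 / 2 * rho * ?Y)\<^sup>2 = 25 / 4 * (rho\<^sup>2 * ?Y\<^sup>2)"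
    by (simp add: power_mult_distrib power_divide)
  finally have 1: "(l2 Dn)\<^sup>2 \<le> 25 / 2 * (rho\<^sup>2 * ?Y\<^sup>2) + 2 * (J / rho * l2 u)\<^sup>2" by simp
  have "24 / rho * l2 u \<le> J / rho * l2 u"
    using J rho by (intro mult_right_mono divide_right_mono l2_nonneg) auto
  then have "l2 Mn \<le> J / rho * l2 u" using l2_normal_log_weight(2)[OF a0] by linarith
  then have 2: "(l2 Mn)\<^sup>2 \<le> (J / rho * l2 u)\<^sup>2" by (intro power_mono l2_nonneg)
  have "64 * h / rho\<^sup>2 * ((l2 Dn)\<^sup>2 + (l2 Mn)\<^sup>2) \<le> 64 * h / rho\<^sup>2 * (25 / 2 * (rho\<^sup>2 * ?Y\<^sup>2) + 3 * (J / rho * l2 u)\<^sup>2)"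
    using 1 2 h by (intro mult_left_mono) auto
  also have "\<dots> = 800 * h * ?Y\<^sup>2 + 192 * J\<^sup>2 / rho * (1 / rho) * (omega * (l2 u)\<^sup>2)"
    using rho by (simp add: om power_mult_distrib power_divide field_simps power2_eq_square)
  \<comment> \<open>64 * 25 / 2 = 800, so h <= 1/1600 makes this exactly the reserved half of the
    skew energy.\<close>
  also have "800 * h * ?Y\<^sup>2 \<le> 1 / 2 * ?Y\<^sup>2"
    using h0 by (intro mult_right_mono) auto
  also have "192 * J\<^sup>2 / rho * (1 / rho) * (omega * (l2 u)\<^sup>2) \<le> G / 25 * 1 * (omega * (l2 u)\<^sup>2)"
    using small3 rho omega_bounds(1) unfolding J_def by (intro mult_right_mono mult_mono) (auto simp: G)
  finally have "64 * h / rho\<^sup>2 * ((l2 Dn)\<^sup>2 + (l2 Mn)\<^sup>2) \<le> 1 / 2 * ?Y\<^sup>2 + 1 / 25 * (G * omega * (l2 u)\<^sup>2)" by simp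
  moreover have "3 / 25 * (G * omega * (l2 u)\<^sup>2) + ?Y\<^sup>2 / 2
      \<le> (l2 conj_u)\<^sup>2 + 64 * h / rho\<^sup>2 * ((l2 Dn)\<^sup>2 + (l2 Mn)\<^sup>2)"
    using energy_coercive[OF c lower small G small2] by (simp only: mult.assoc)
  ultimately have "2 / 25 * (G * omega * (l2 u)\<^sup>2) \<le> (l2 conj_u)\<^sup>2" by linarith
  then show ?thesis by (simp add: om field_simps)
qed

end

section \<open>Transfer to the lattice and choice of the constants\<close>

lemma pt_inj: "0 < h \<Longrightarrow> inj (pt h)"
  by (rule injI) (auto simp: pt_def prod_eq_iff)

lemma l2norm_eq_l2: "0 < h \<Longrightarrow> l2norm h v = l2 (\<lambda>x. v (pt h x))"
  unfolding l2norm_def l2_def lattice_pts_def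
  by (subst infsum_reindex[OF pt_inj]) (simp_all add: comp_def)

lemma lattice_weight_intro:
  assumes "0 \<le> a" "0 < h" "h \<le> 1" "100 \<le> rho" "a + 4 / rho \<le> b1" "0 < mu" "mu < 2" "cosh b1 < 1 + mu"
    and fin: "finite (supp h v)" and sub: "supp h v \<subseteq> Omega h rho"
  shows "lattice_weight a h rho mu b1 (\<lambda>x. v (pt h x))"
proof
  have "{x. v (pt h x) \<noteq> 0} = pt h -` supp h v"
    by (auto simp: supp_def lattice_pts_def)
  then show "fsupp (\<lambda>x. v (pt h x))"
    unfolding fsupp_def using finite_vimageI[OF fin pt_inj[OF assms(2)]] by simp
  show "rho / 2 \<le> R h (pt h x) \<and> R h (pt h x) \<le> 4 * rho" if "v (pt h x) \<noteq> 0" for x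
    using sub that by (auto simp: supp_def lattice_pts_def Omega_def)
qed fact+

lemma l2norm_conj_op:
  assumes "lattice_weight a h rho mu b1 (\<lambda>x. v (pt h x))"
  shows "l2norm h (conj_op (2 * mu) a h v) = l2 (lattice_weight.conj_u a h mu (\<lambda>x. v (pt h x)))"
proof -
  interpret lattice_weight a h rho mu b1 "\<lambda>x. v (pt h x)" by (rule assms)
  have "conj_op (2 * mu) a h v (pt h x) = conj_u x" for x
    unfolding conj_op_explicit conj_u_def f_def pt_add[symmetric] diff_divide_distrib ..
  then show ?thesis by (simp add: l2norm_eq_l2[OF h(1)])
qed

theorem theorem8:
  fixes lam :: real
  assumes "0 < lam" and "lam < 4"
  shows "(\<forall>I :: real set. compact I \<and> is_interval I \<and> I \<subseteq> {0<..<arcosh (1 + lam / 2)} \<longrightarrow>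
           (\<exists>B C h0. B > 0 \<and> C > 0 \<and> h0 > 0 \<and>
             (\<forall>a\<in>I. \<forall>h \<rho>. \<forall>v :: real \<times> real \<Rightarrow> complex.
                0 < h \<and> h \<le> h0 \<and> \<rho> \<ge> B \<and> finite (supp h v) \<and> supp h v \<subseteq> Omega h \<rho> \<longrightarrow>
                h * inverse \<rho> * (l2norm h v)\<^sup>2 \<le> C * (l2norm h (conj_op lam a h v))\<^sup>2)))
         \<and>
         (\<exists>B C h0. B > 0 \<and> C > 0 \<and> h0 > 0 \<and>
             (\<forall>h \<rho>. \<forall>v :: real \<times> real \<Rightarrow> complex.
                0 < h \<and> h \<le> h0 \<and> \<rho> \<ge> B \<and> finite (supp h v) \<and> supp h v \<subseteq> Omega h \<rho> \<longrightarrow>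
                h * inverse (\<rho>\<^sup>2) * (l2norm h v)\<^sup>2 \<le> C * (l2norm h (conj_op lam 0 h v))\<^sup>2))"
proof -
  define mu where "mu = lam / 2"
  define al where "al = arcosh (1 + mu)"
  have mu: "0 < mu" "mu < 2" and lam: "lam = 2 * mu" using assms by (auto simp: mu_def)
  have al: "cosh al = 1 + mu" "0 \<le> al"
    unfolding al_def using mu by (auto intro: cosh_arcosh_real arcosh_nonneg_real)
  have cosh_lt: "cosh t < 1 + mu" if "0 \<le> t" "t < al" for t
    using that cosh_real_nonneg_less_iff[of t al] al by simp
  have al_pos: "0 < al" using al mu by (cases "al = 0") auto
  have frac: "k / \<rho> \<le> g" if "k / g \<le> \<rho>" "0 < g" "0 < \<rho>" for k g \<rho> :: real
    using that by (simp add: field_simps)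
  have scale: "p \<le> 1 / k * q" if "k * p \<le> q" "0 < k" for k p q :: real
    using that by (simp add: field_simps)
  have "\<exists>B C h0. B > 0 \<and> C > 0 \<and> h0 > 0 \<and>
             (\<forall>a\<in>I. \<forall>h \<rho>. \<forall>v :: real \<times> real \<Rightarrow> complex.
                0 < h \<and> h \<le> h0 \<and> \<rho> \<ge> B \<and> finite (supp h v) \<and> supp h v \<subseteq> Omega h \<rho> \<longrightarrow>
                h * inverse \<rho> * (l2norm h v)\<^sup>2 \<le> C * (l2norm h (conj_op lam a h v))\<^sup>2)"
    if I: "compact I" "I \<subseteq> {0<..<al}" for I
  \<comment> \<open>An empty interval has no extreme points to define constants from; the claim is
    then vacuous.\<close>
  proof (cases "I = {}")
    case True
    then show ?thesis by (intro exI[of _ 1]) auto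
  next
    case False
    obtain a0 where a0: "a0 \<in> I" "\<And>t. t \<in> I \<Longrightarrow> a0 \<le> t" using compact_attains_inf[OF I(1) False] by blast
    obtain a1 where a1: "a1 \<in> I" "\<And>t. t \<in> I \<Longrightarrow> t \<le> a1" using compact_attains_sup[OF I(1) False] by blast
    have a0p: "0 < a0" and a1p: "0 < a1" "a1 < al" using a0(1) a1(1) I(2) by auto
    \<comment> \<open>The midpoint between max I and the critical value leaves room for the extra 4
      / rho in the gradient length.\<close>
    define b1 where "b1 = (a1 + al) / 2"
    have b1: "0 \<le> b1" "b1 < al" "a1 < b1" using a1p by (auto simp: b1_def)
    have cb: "cosh b1 < 1 + mu" by (rule cosh_lt[OF b1(1,2)])
    obtain c where c: "0 < c" and low: "\<And>b n1 n2. 0 \<le> b \<and> b \<le> b1 \<and> 1/4 \<le> n1\<^sup>2 + n2\<^sup>2 \<and> n1\<^sup>2 + n2\<^sup>2 \<le> 1 \<Longrightarrow>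
        c \<le> \<bar>elim_sum mu b n1 n2\<bar> + \<bar>elim_diff b n1 n2\<bar>"
      using elim_lower_bound[OF mu b1(1) cb] by blast
    define G where "G = c\<^sup>2 / (4 * 5760000\<^sup>2)"
    have G: "0 < G" using c by (simp add: G_def)
    \<comment> \<open>A sum of positive thresholds, so rho >= B implies each smallness condition
      separately.\<close>
    define B where "B = 100 + 4 / (b1 - a1) + 153600000 * cosh 13 / c + 960000 * cosh 13 / (G / 25) + (4608 / a0) / (G / 25)"
    have pos: "0 < 4 / (b1 - a1)" "0 < 153600000 * cosh 13 / c" "0 < 960000 * cosh 13 / (G / 25)" "0 < (4608 / a0) / (G / 25)"
      using b1 c G a0p by (auto simp: cosh_real_pos intro!: divide_pos_pos mult_pos_pos)
    show ?thesis
    proof (rule exI[of _ B], rule exI[of _ "1 / (2 / 25 * G * a0)"], rule exI[of _ 1], intro conjI ballI allI impI; (elim conjE)?)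
      show "0 < B" unfolding B_def using pos by linarith
      show "0 < 1 / (2 / 25 * G * a0)" using G a0p by simp
    next
      fix a h \<rho> :: real and v :: "real \<times> real \<Rightarrow> complex"
      assume a: "a \<in> I" and h: "0 < h" "h \<le> 1" and \<rho>: "B \<le> \<rho>" and v: "finite (supp h v)" "supp h v \<subseteq> Omega h \<rho>"
      have r: "100 \<le> \<rho>" "4 / (b1 - a1) \<le> \<rho>" "153600000 * cosh 13 / c \<le> \<rho>"
        "960000 * cosh 13 / (G / 25) \<le> \<rho>" "(4608 / a0) / (G / 25) \<le> \<rho>"
        using \<rho> pos unfolding B_def by linarith+
      have aI: "0 \<le> a" "a0 \<le> a" "a \<le> a1" using a0(2)[OF a] a1(2)[OF a] a0p by auto
      have "4 / \<rho> \<le> b1 - a1" using frac[OF r(2)] b1 r(1) by simp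
      then have ab: "a + 4 / \<rho> \<le> b1" using aI by linarith
      interpret lattice_weight a h \<rho> mu b1 "\<lambda>x. v (pt h x)"
        by (rule lattice_weight_intro[OF aI(1) h r(1) ab mu cb v])
      have "2 / 25 * G * a0 * (h * inverse \<rho> * (l2 (\<lambda>x. v (pt h x)))\<^sup>2) \<le> (l2 conj_u)\<^sup>2"
      proof (rule carleman_positive[OF c low _ G_def _ a0p aI(2)])
        show "153600000 * cosh 13 / \<rho> \<le> c" using frac[OF r(3) c] r(1) by simp
        show "960000 * cosh 13 / \<rho> \<le> G / 25" using frac[OF r(4)] G r(1) by simp
        show "4608 / (a0 * \<rho>) \<le> G / 25" using frac[OF r(5)] G r(1) by (simp add: divide_divide_eq_left)
      qed
      from scale[OF this] show "h * inverse \<rho> * (l2norm h v)\<^sup>2 \<le> 1 / (2 / 25 * G * a0) * (l2norm h (conj_op lam a h v))\<^sup>2"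
        unfolding lam l2norm_conj_op[OF lattice_weight_axioms] l2norm_eq_l2[OF h(1), of v]
        using G a0p by simp
    qed simp
  qed
  moreover have "\<exists>B C h0. B > 0 \<and> C > 0 \<and> h0 > 0 \<and>
             (\<forall>h \<rho>. \<forall>v :: real \<times> real \<Rightarrow> complex.
                0 < h \<and> h \<le> h0 \<and> \<rho> \<ge> B \<and> finite (supp h v) \<and> supp h v \<subseteq> Omega h \<rho> \<longrightarrow>
                h * inverse (\<rho>\<^sup>2) * (l2norm h v)\<^sup>2 \<le> C * (l2norm h (conj_op lam 0 h v))\<^sup>2)"
  proof -
    \<comment> \<open>With a = 0 the gradient length is at most 4 / rho, so any value strictly
      between 0 and the critical one would do.\<close>
    define b1 where "b1 = al / 2"
    have b1: "0 \<le> b1" "b1 < al" "0 < b1" using al_pos by (auto simp: b1_def)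
    have cb: "cosh b1 < 1 + mu" by (rule cosh_lt[OF b1(1,2)])
    obtain c where c: "0 < c" and low: "\<And>b n1 n2. 0 \<le> b \<and> b \<le> b1 \<and> 1/4 \<le> n1\<^sup>2 + n2\<^sup>2 \<and> n1\<^sup>2 + n2\<^sup>2 \<le> 1 \<Longrightarrow>
        c \<le> \<bar>elim_sum mu b n1 n2\<bar> + \<bar>elim_diff b n1 n2\<bar>"
      using elim_lower_bound[OF mu b1(1) cb] by blast
    define G where "G = c\<^sup>2 / (4 * 5760000\<^sup>2)"
    have G: "0 < G" using c by (simp add: G_def)
    define B where "B = 100 + 4 / b1 + 153600000 * cosh 13 / c + 960000 * cosh 13 / (G / 25) + 192 * (548 * cosh 13)\<^sup>2 / (G / 25)"
    have pos: "0 < 4 / b1" "0 < 153600000 * cosh 13 / c" "0 < 960000 * cosh 13 / (G / 25)" "0 < 192 * (548 * cosh 13)\<^sup>2 / (G / 25)"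
      using b1 c G by (auto simp: cosh_real_pos intro!: divide_pos_pos mult_pos_pos)
    show ?thesis
    proof (rule exI[of _ B], rule exI[of _ "1 / (2 / 25 * G)"], rule exI[of _ "1 / 1600"], intro conjI allI impI; (elim conjE)?)
      show "0 < B" unfolding B_def using pos by linarith
      show "0 < 1 / (2 / 25 * G)" using G by simp
    next
      fix h \<rho> :: real and v :: "real \<times> real \<Rightarrow> complex"
      assume step: "0 < h" "h \<le> 1 / 1600" and \<rho>: "B \<le> \<rho>" and v: "finite (supp h v)" "supp h v \<subseteq> Omega h \<rho>"
      have r: "100 \<le> \<rho>" "4 / b1 \<le> \<rho>" "153600000 * cosh 13 / c \<le> \<rho>"
        "960000 * cosh 13 / (G / 25) \<le> \<rho>" "192 * (548 * cosh 13)\<^sup>2 / (G / 25) \<le> \<rho>"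
        using \<rho> pos unfolding B_def by linarith+
      have h1: "h \<le> 1" using step by simp
      have ab: "0 + 4 / \<rho> \<le> b1" using frac[OF r(2)] b1 r(1) by simp
      interpret lattice_weight 0 h \<rho> mu b1 "\<lambda>x. v (pt h x)"
        by (rule lattice_weight_intro[OF order_refl step(1) h1 r(1) ab mu cb v])
      have "2 / 25 * G * (h * inverse (\<rho>\<^sup>2) * (l2 (\<lambda>x. v (pt h x)))\<^sup>2) \<le> (l2 conj_u)\<^sup>2"
      proof (rule carleman_zero[OF c low _ G_def _ refl step(2)])
        show "153600000 * cosh 13 / \<rho> \<le> c" using frac[OF r(3) c] r(1) by simp
        show "960000 * cosh 13 / \<rho> \<le> G / 25" using frac[OF r(4)] G r(1) by simp
        show "192 * (548 * cosh 13)\<^sup>2 / \<rho> \<le> G / 25" using frac[OF r(5)] G r(1) by simp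
      qed
      from scale[OF this] show "h * inverse (\<rho>\<^sup>2) * (l2norm h v)\<^sup>2 \<le> 1 / (2 / 25 * G) * (l2norm h (conj_op lam 0 h v))\<^sup>2"
        unfolding lam l2norm_conj_op[OF lattice_weight_axioms] l2norm_eq_l2[OF h(1), of v]
        using G by simp
    qed simp
  qed
  ultimately show ?thesis
    by (intro conjI allI impI) (simp_all only: al_def mu_def)
qed

end
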